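(* Fix $L\ge 0$ and a set $\tilde\Omega$ with $\Omega^L\subseteq\tilde\Omega\subseteq C([0,T],H)$. Let $u$ be a minimax $L$-subsolution and let $v$ be a minimax $L$-supersolution of (TVP) on $[0,T]\times\tilde\Omega$. Then $u\le v$ on $[0,T]\times\tilde\Omega$.
   Context: Spaces. Let $T>0$. $H$ is a real Hilbert space with inner product $(\cdot,\cdot)$ and norm $|\cdot|$; $V$ is a separable reflexive Banach space with norm $\|\cdot\|$, continuously, densely and compactly embedded into $H$; $V^\ast$ is its dual with norm $\|\cdot\|_\ast$ and duality pairing $\langle x^\ast,x\rangle=x^\ast(x)$. With the usual identifications, $V\subseteq H\subseteq V^\ast$ and $\langle x,y\rangle=(x,y)$ for $x\in H$, $y\in V$. Fix $p\ge 2$, $q>1$ with $1/p+1/q=1$. For $t_0\in[0,T)$, $W_{pq}(t_0,T)$ is the space of all $\mathbf{x}\in L^p(t_0,T;V)$ possessing a generalized derivative $\mathbf{x}'\in L^q(t_0,T;V^\ast)$. Operator. $A:[0,T]\times V\to V^\ast$ is fixed and satisfies: (i) $t\mapsto\langle A(t,x),v\rangle$ is measurable for all $x,v\in V$; (ii) for a.e. $t$ and all $x,y\in V$, $\langle A(t,x)-A(t,y),x-y\rangle\ge 0$; (iii) for a.e. $t$ and all $x,y,v\in V$, $s\mapsto\langle A(t,x+sy),v\rangle$ is continuous on $[0,1]$; (iv) there are $a_1\in L^q(0,T)$, $c_1\ge0$ with $\|A(t,x)\|_\ast\le a_1(t)+c_1\|x\|^{p-1}$ for all $x\in V$ and a.e.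 $t$; (v) there is $c_2>0$ with $\langle A(t,x),x\rangle\ge c_2\|x\|^p$ for all $x\in V$ and a.e. $t$. Paths and continuity. $C([0,T],H)$ carries the sup norm. On $[0,T]\times C([0,T],H)$ and its subsets use the pseudo-metric $\mathbf{d}_\infty((t,x),(s,y))=|t-s|+\sup_{r\in[0,T]}|x(r\wedge t)-y(r\wedge s)|$; (semi-)continuity in $(t,x)$ is meant with respect to $\mathbf{d}_\infty$ (so such functions are non-anticipating, i.e. their value at time $t$ depends only on the path up to time $t$). USC and LSC denote real-valued upper and lower semicontinuous functions. Trajectories. For $L\ge 0$ and $(t_0,x_0)\in[0,T)\times C([0,T],H)$, $\mathcal{X}^L(t_0,x_0)$ is the set of all $x\in C([0,T],H)$ with $x=x_0$ on $[0,t_0]$ for which there exist $\mathbf{x}\in W_{pq}(t_0,T)$ and $f^x\in L^2(t_0,T;H)$ with $x=\mathbf{x}$ a.e. on $(t_0,T)$, $\mathbf{x}'(t)+A(t,\mathbf{x}(t))=f^x(t)$ a.e. on $(t_0,T)$, and $|f^x(t)|\le L(1+\sup_{0\le s\le t}|x(s)|)$ a.e. on $(t_0,T)$ ($\mathbf{x}$, $f^x$ are uniquely determined by $x$). Fix $x_\ast\in H$, regarded as a constant path, and put $\Omega^L:=\mathcal{X}^L(0,x_\ast)$. Data. $h:C([0,T],H)\to\mathbb{R}$ is continuous. $F:[0,T]\times C([0,T],H)\times H\to\mathbb{R}$ satisfies: (i) $F$ is continuous; (ii) there is $L_0\ge0$ with $|F(t,x,z)-F(t,x,\tilde z)|\le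 L_0(1+\sup_{0\le s\le t}|x(s)|)|z-\tilde z|$ for all $t,x,z,\tilde z$; (iii) for every $L\ge0$ and $(t_0,x_0)\in[0,T)\times C([0,T],H)$ there is a modulus of continuity $m_{L,t_0,x_0}$ such that for all $\varepsilon>0$, $t\in[t_0,T]$, $x,y\in\mathcal{X}^L(t_0,x_0)$: $F(t,x,\varepsilon^{-1}[x(t)-y(t)])-F(t,y,\varepsilon^{-1}[x(t)-y(t)])\le m_{L,t_0,x_0}(\varepsilon^{-1}|x(t)-y(t)|^2+\sup_{s\le t}|x(s)-y(s)|)$. (TVP) denotes the terminal-value problem $\partial_tu-\langle A(t,x(t)),\partial_xu\rangle+F(t,x,\partial_xu)=0$ on $[0,T)\times C([0,T],H)$, $u(T,x)=h(x)$. Minimax semisolutions. $u:[0,T]\times\tilde\Omega\to\mathbb{R}$ is a minimax $L$-subsolution (resp. $L$-supersolution) of (TVP) on $[0,T]\times\tilde\Omega$ if $u\in\mathrm{USC}([0,T]\times\tilde\Omega)$ (resp. $\mathrm{LSC}$), $u(T,\cdot)\le h$ (resp. $\ge h$) on $\tilde\Omega$, and for every $(t_0,x_0,z)\in[0,T)\times\tilde\Omega\times H$ there is $x\in\mathcal{X}^L(t_0,x_0)\cap\tilde\Omega$ such that for every $t\in[t_0,T]$: $u(t_0,x_0)\le$ (resp. $\ge$) $\int_{t_0}^t[(-f^x(s),z)+F(s,x,z)]\,ds+u(t,x)$. *)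

theory Defs
  imports "HOL-Analysis.Analysis"
begin

section \<open>The evolution triple\<close>

text \<open>
  The embedding of \<open>V\<close> into \<open>H\<close> is an explicit map \<open>\<iota>\<close>; the dual of \<open>V\<close> is the type
  \<open>'v \<Rightarrow>\<^sub>L real\<close> with the operator norm. Separability of \<open>V\<close> is expressed by the class
  \<open>second_countable_topology\<close>.
\<close>

definition reflexive_space :: "'v::real_normed_vector itself \<Rightarrow> bool" where
  "reflexive_space _ \<longleftrightarrow>
     (\<forall>\<Phi> :: ('v \<Rightarrow>\<^sub>L real) \<Rightarrow>\<^sub>L real. \<exists>x::'v. \<forall>f. blinfun_apply \<Phi> f = blinfun_apply f x)"

definition compact_dense_embedding ::
  "('v::real_normed_vector \<Rightarrow>\<^sub>L 'h::real_normed_vector) \<Rightarrow> bool" where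
  "compact_dense_embedding \<iota> \<longleftrightarrow>
     inj (blinfun_apply \<iota>) \<and>
     closure (range (blinfun_apply \<iota>)) = UNIV \<and>
     (\<forall>B. bounded B \<longrightarrow> compact (closure (blinfun_apply \<iota> ` B)))"

text \<open>
  \<open>H\<close> is separable because \<open>V\<close> is, so giving \<open>H\<close> the class \<open>second_countable_topology\<close> as well
  is no restriction:
\<close>

lemma separable_codomain_of_dense_embedding:
  fixes \<iota> :: "'v::{real_normed_vector, second_countable_topology} \<Rightarrow>\<^sub>L 'h::real_normed_vector"
  assumes "compact_dense_embedding \<iota>"
  shows "\<exists>D::'h set. countable D \<and> closure D = UNIV"
proof -
  obtain D :: "'v set" where D: "countable D"
    and dense: "\<And>X. open X \<Longrightarrow> X \<noteq> {} \<Longrightarrow> \<exists>d\<in>D. d \<in> X"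
    using countable_dense_setE by blast
  have "- closure D = {}"
    using dense[of "- closure D"] closure_subset[of D] by auto
  then have cl: "closure D = UNIV" by auto
  have "continuous_on (closure D) (blinfun_apply \<iota>)"
    by (intro linear_continuous_on blinfun.bounded_linear_right)
  then have "blinfun_apply \<iota> ` closure D \<subseteq> closure (blinfun_apply \<iota> ` D)"
    by (rule image_closure_subset) (rule closed_closure, rule closure_subset)
  then have "range (blinfun_apply \<iota>) \<subseteq> closure (blinfun_apply \<iota> ` D)"
    using cl by simp
  then have "closure (range (blinfun_apply \<iota>)) \<subseteq> closure (blinfun_apply \<iota> ` D)"
    by (rule closure_minimal) simp
  then have "closure (blinfun_apply \<iota> ` D) = UNIV"
    using assms unfolding compact_dense_embedding_def by blast
  moreover have "countable (blinfun_apply \<iota> ` D)"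
    using D by (rule countable_image)
  ultimately show ?thesis by (intro exI[of _ "blinfun_apply \<iota> ` D"]) simp
qed

text \<open>The identification of \<open>H\<close> with a subspace of the dual of \<open>V\<close>: \<open>y \<mapsto> (y, \<iota> \<cdot>)\<close>.\<close>

definition to_dual ::
  "('v::real_normed_vector \<Rightarrow>\<^sub>L 'h::real_inner) \<Rightarrow> 'h \<Rightarrow> ('v \<Rightarrow>\<^sub>L real)" where
  "to_dual \<iota> y = blinfun_inner_right y o\<^sub>L \<iota>"


section \<open>Bochner spaces and generalized derivatives\<close>

text \<open>
  Elements of \<open>L\<^sup>p\<close> are represented by functions. In a separable space (all of \<open>\<real>\<close>, \<open>H\<close>, \<open>V\<close>, and the
  dual of the separable reflexive space \<open>V\<close>) Borel measurability is strong measurability.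
\<close>

definition Lp_fun :: "real \<Rightarrow> real set \<Rightarrow> (real \<Rightarrow> 'b::real_normed_vector) \<Rightarrow> bool" where
  "Lp_fun p S f \<longleftrightarrow>
     f \<in> borel_measurable (lebesgue_on S) \<and>
     integrable (lebesgue_on S) (\<lambda>t. norm (f t) powr p)"

text \<open>
  The Bochner integral as in \<^const>\<open>has_bochner_integral\<close>, but without the constraint
  \<open>second_countable_topology\<close> on the codomain type, which is not available for
  \<open>'v \<Rightarrow>\<^sub>L real\<close> although that space is separable here.
\<close>

definition has_strong_integral ::
  "'a measure \<Rightarrow> ('a \<Rightarrow> 'b::real_normed_vector) \<Rightarrow> 'b \<Rightarrow> bool" where
  "has_strong_integral M f I \<longleftrightarrow>
     f \<in> borel_measurable M \<and>
     (\<exists>s. (\<forall>i::nat. Bochner_Integration.simple_bochner_integrable M (s i)) \<and>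
          (\<lambda>i. \<integral>\<^sup>+x. ennreal (norm (f x - s i x)) \<partial>M) \<longlonglongrightarrow> 0 \<and>
          (\<lambda>i. Bochner_Integration.simple_bochner_integral M (s i)) \<longlonglongrightarrow> I)"

definition test_function :: "real \<Rightarrow> real \<Rightarrow> (real \<Rightarrow> real) \<Rightarrow> bool" where
  "test_function a b \<phi> \<longleftrightarrow>
     (\<forall>n. (deriv ^^ n) \<phi> differentiable_on UNIV) \<and>
     closure {t. \<phi> t \<noteq> 0} \<subseteq> {a<..<b}"

text \<open>
  \<open>\<integral> \<phi>' X dt = - \<integral> \<phi> X' dt\<close>: the left-hand integral is taken in \<open>V\<close> and then regarded as an
  element of the dual of \<open>V\<close>, in which the right-hand integral is taken.
\<close>

definition generalized_derivative ::
  "('v::{banach, second_countable_topology} \<Rightarrow>\<^sub>L 'h::real_inner) \<Rightarrow> real \<Rightarrow> real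
     \<Rightarrow> (real \<Rightarrow> 'v) \<Rightarrow> (real \<Rightarrow> ('v \<Rightarrow>\<^sub>L real)) \<Rightarrow> bool" where
  "generalized_derivative \<iota> a b X X' \<longleftrightarrow>
     (\<forall>\<phi>. test_function a b \<phi> \<longrightarrow>
        has_strong_integral (lebesgue_on {a<..<b}) (\<lambda>t. \<phi> t *\<^sub>R X' t)
          (- to_dual \<iota> (blinfun_apply \<iota>
               (integral\<^sup>L (lebesgue_on {a<..<b}) (\<lambda>t. deriv \<phi> t *\<^sub>R X t)))))"

text \<open>\<open>X \<in> W\<^sub>p\<^sub>q(a, b)\<close> with generalized derivative \<open>X'\<close>.\<close>

definition Wpq ::
  "('v::{banach, second_countable_topology} \<Rightarrow>\<^sub>L 'h::real_inner) \<Rightarrow> real \<Rightarrow> real \<Rightarrow> real \<Rightarrow> real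
     \<Rightarrow> (real \<Rightarrow> 'v) \<Rightarrow> (real \<Rightarrow> ('v \<Rightarrow>\<^sub>L real)) \<Rightarrow> bool" where
  "Wpq \<iota> p q a b X X' \<longleftrightarrow>
     Lp_fun p {a<..<b} X \<and> Lp_fun q {a<..<b} X' \<and> generalized_derivative \<iota> a b X X'"


section \<open>The operator\<close>

definition admissible_operator ::
  "real \<Rightarrow> real \<Rightarrow> real \<Rightarrow> (real \<Rightarrow> 'v::real_normed_vector \<Rightarrow> ('v \<Rightarrow>\<^sub>L real)) \<Rightarrow> bool" where
  "admissible_operator T p q A \<longleftrightarrow>
     (\<forall>x v. (\<lambda>t. blinfun_apply (A t x) v) \<in> borel_measurable (lebesgue_on {0..T})) \<and>
     (AE t in lebesgue_on {0..T}. \<forall>x y. blinfun_apply (A t x - A t y) (x - y) \<ge> 0) \<and>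
     (AE t in lebesgue_on {0..T}. \<forall>x y v.
        continuous_on {0..1} (\<lambda>s. blinfun_apply (A t (x + s *\<^sub>R y)) v)) \<and>
     (\<exists>a1 c1. Lp_fun q {0..T} (a1 :: real \<Rightarrow> real) \<and> c1 \<ge> 0 \<and>
        (AE t in lebesgue_on {0..T}. \<forall>x. norm (A t x) \<le> a1 t + c1 * norm x powr (p - 1))) \<and>
     (\<exists>c2>0. AE t in lebesgue_on {0..T}. \<forall>x. blinfun_apply (A t x) x \<ge> c2 * norm x powr p)"


section \<open>Path space\<close>

text \<open>
  Paths are extensional, so that equality of paths is equality on \<open>[0, T]\<close>.
\<close>

definition paths :: "real \<Rightarrow> (real \<Rightarrow> 'h::topological_space) set" where
  "paths T = {x. x \<in> extensional {0..T} \<and> continuous_on {0..T} x}"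

definition const_path :: "real \<Rightarrow> 'h \<Rightarrow> (real \<Rightarrow> 'h)" where
  "const_path T c = restrict (\<lambda>_. c) {0..T}"

definition run_sup :: "(real \<Rightarrow> 'h::real_normed_vector) \<Rightarrow> real \<Rightarrow> real" where
  "run_sup x t = (SUP s\<in>{0..t}. norm (x s))"

definition sup_dist ::
  "real \<Rightarrow> (real \<Rightarrow> 'h::real_normed_vector) \<Rightarrow> (real \<Rightarrow> 'h) \<Rightarrow> real" where
  "sup_dist T x y = (SUP r\<in>{0..T}. norm (x r - y r))"

definition d_inf ::
  "real \<Rightarrow> real \<times> (real \<Rightarrow> 'h::real_normed_vector) \<Rightarrow> real \<times> (real \<Rightarrow> 'h) \<Rightarrow> real" where
  "d_inf T = (\<lambda>(t, x) (s, y).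
     \<bar>t - s\<bar> + (SUP r\<in>{0..T}. norm (x (min r t) - y (min r s))))"

text \<open>Continuity and semicontinuity of real functions on a set \<open>S\<close> with a pseudo-metric \<open>d\<close>.\<close>

definition pm_continuous :: "('a \<Rightarrow> 'a \<Rightarrow> real) \<Rightarrow> 'a set \<Rightarrow> ('a \<Rightarrow> real) \<Rightarrow> bool" where
  "pm_continuous d S f \<longleftrightarrow>
     (\<forall>a\<in>S. \<forall>e>0. \<exists>\<delta>>0. \<forall>b\<in>S. d a b < \<delta> \<longrightarrow> \<bar>f b - f a\<bar> < e)"

definition pm_usc :: "('a \<Rightarrow> 'a \<Rightarrow> real) \<Rightarrow> 'a set \<Rightarrow> ('a \<Rightarrow> real) \<Rightarrow> bool" where
  "pm_usc d S f \<longleftrightarrow>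
     (\<forall>a\<in>S. \<forall>e>0. \<exists>\<delta>>0. \<forall>b\<in>S. d a b < \<delta> \<longrightarrow> f b < f a + e)"

definition pm_lsc :: "('a \<Rightarrow> 'a \<Rightarrow> real) \<Rightarrow> 'a set \<Rightarrow> ('a \<Rightarrow> real) \<Rightarrow> bool" where
  "pm_lsc d S f \<longleftrightarrow>
     (\<forall>a\<in>S. \<forall>e>0. \<exists>\<delta>>0. \<forall>b\<in>S. d a b < \<delta> \<longrightarrow> f b > f a - e)"

definition modulus_of_continuity :: "(real \<Rightarrow> real) \<Rightarrow> bool" where
  "modulus_of_continuity m \<longleftrightarrow>
     mono_on {0..} m \<and> m 0 = 0 \<and> (m \<longlongrightarrow> 0) (at_right 0)"


section \<open>Trajectories\<close>

text \<open>\<open>trajectory_with \<iota> A p q T L t0 x0 x f\<close>: \<open>x \<in> \<X>\<^sup>L(t0, x0)\<close> with \<open>f\<^sup>x = f\<close>.\<close>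

definition trajectory_with ::
  "('v::{banach, second_countable_topology} \<Rightarrow>\<^sub>L 'h::{real_inner, banach, second_countable_topology})
     \<Rightarrow> (real \<Rightarrow> 'v \<Rightarrow> ('v \<Rightarrow>\<^sub>L real)) \<Rightarrow> real \<Rightarrow> real \<Rightarrow> real \<Rightarrow> real
     \<Rightarrow> real \<Rightarrow> (real \<Rightarrow> 'h) \<Rightarrow> (real \<Rightarrow> 'h) \<Rightarrow> (real \<Rightarrow> 'h) \<Rightarrow> bool" where
  "trajectory_with \<iota> A p q T L t0 x0 x f \<longleftrightarrow>
     x \<in> paths T \<and> (\<forall>t\<in>{0..t0}. x t = x0 t) \<and>
     Lp_fun 2 {t0<..<T} f \<and>
     (\<exists>X X'. Wpq \<iota> p q t0 T X X' \<and>
        (AE t in lebesgue_on {t0<..<T}. x t = blinfun_apply \<iota> (X t)) \<and>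
        (AE t in lebesgue_on {t0<..<T}. X' t + A t (X t) = to_dual \<iota> (f t))) \<and>
     (AE t in lebesgue_on {t0<..<T}. norm (f t) \<le> L * (1 + run_sup x t))"

definition trajectories ::
  "('v::{banach, second_countable_topology} \<Rightarrow>\<^sub>L 'h::{real_inner, banach, second_countable_topology})
     \<Rightarrow> (real \<Rightarrow> 'v \<Rightarrow> ('v \<Rightarrow>\<^sub>L real)) \<Rightarrow> real \<Rightarrow> real \<Rightarrow> real \<Rightarrow> real
     \<Rightarrow> real \<Rightarrow> (real \<Rightarrow> 'h) \<Rightarrow> (real \<Rightarrow> 'h) set" where
  "trajectories \<iota> A p q T L t0 x0 = {x. \<exists>f. trajectory_with \<iota> A p q T L t0 x0 x f}"


section \<open>Data of the terminal-value problem\<close>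

definition admissible_hamiltonian ::
  "('v::{banach, second_countable_topology} \<Rightarrow>\<^sub>L 'h::{real_inner, banach, second_countable_topology})
     \<Rightarrow> (real \<Rightarrow> 'v \<Rightarrow> ('v \<Rightarrow>\<^sub>L real)) \<Rightarrow> real \<Rightarrow> real \<Rightarrow> real
     \<Rightarrow> (real \<Rightarrow> (real \<Rightarrow> 'h) \<Rightarrow> 'h \<Rightarrow> real) \<Rightarrow> bool" where
  "admissible_hamiltonian \<iota> A p q T F \<longleftrightarrow>
     pm_continuous (\<lambda>(a, z) (b, w). d_inf T a b + norm (z - w))
       (({0..T} \<times> paths T) \<times> UNIV) (\<lambda>((t, x), z). F t x z) \<and>
     (\<exists>L0\<ge>0. \<forall>t\<in>{0..T}. \<forall>x\<in>paths T. \<forall>z z'.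
        \<bar>F t x z - F t x z'\<bar> \<le> L0 * (1 + run_sup x t) * norm (z - z')) \<and>
     (\<forall>L\<ge>0. \<forall>t0\<in>{0..<T}. \<forall>x0\<in>paths T. \<exists>m. modulus_of_continuity m \<and>
        (\<forall>\<epsilon>>0. \<forall>t\<in>{t0..T}. \<forall>x\<in>trajectories \<iota> A p q T L t0 x0.
           \<forall>y\<in>trajectories \<iota> A p q T L t0 x0.
           F t x ((1 / \<epsilon>) *\<^sub>R (x t - y t)) - F t y ((1 / \<epsilon>) *\<^sub>R (x t - y t))
             \<le> m ((1 / \<epsilon>) * (norm (x t - y t))\<^sup>2 + (SUP s\<in>{0..t}. norm (x s - y s)))))"


section \<open>Minimax semisolutions\<close>

text \<open>
  The source \<open>f\<^sup>x\<close> is determined by \<open>x\<close> up to null sets, so it is introduced by an existential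
  quantifier together with \<open>x\<close>.
\<close>

definition minimax_subsolution ::
  "('v::{banach, second_countable_topology} \<Rightarrow>\<^sub>L 'h::{real_inner, banach, second_countable_topology})
     \<Rightarrow> (real \<Rightarrow> 'v \<Rightarrow> ('v \<Rightarrow>\<^sub>L real)) \<Rightarrow> real \<Rightarrow> real \<Rightarrow> real
     \<Rightarrow> (real \<Rightarrow> (real \<Rightarrow> 'h) \<Rightarrow> 'h \<Rightarrow> real) \<Rightarrow> ((real \<Rightarrow> 'h) \<Rightarrow> real) \<Rightarrow> real \<Rightarrow> (real \<Rightarrow> 'h) set
     \<Rightarrow> (real \<Rightarrow> (real \<Rightarrow> 'h) \<Rightarrow> real) \<Rightarrow> bool" where
  "minimax_subsolution \<iota> A p q T F h L \<Omega> u \<longleftrightarrow>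
     pm_usc (d_inf T) ({0..T} \<times> \<Omega>) (\<lambda>(t, x). u t x) \<and>
     (\<forall>x\<in>\<Omega>. u T x \<le> h x) \<and>
     (\<forall>t0\<in>{0..<T}. \<forall>x0\<in>\<Omega>. \<forall>z. \<exists>x\<in>\<Omega>. \<exists>f. trajectory_with \<iota> A p q T L t0 x0 x f \<and>
        (\<forall>t\<in>{t0..T}. u t0 x0 \<le>
           integral\<^sup>L (lebesgue_on {t0..t}) (\<lambda>s. - inner (f s) z + F s x z) + u t x))"

definition minimax_supersolution ::
  "('v::{banach, second_countable_topology} \<Rightarrow>\<^sub>L 'h::{real_inner, banach, second_countable_topology})
     \<Rightarrow> (real \<Rightarrow> 'v \<Rightarrow> ('v \<Rightarrow>\<^sub>L real)) \<Rightarrow> real \<Rightarrow> real \<Rightarrow> real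
     \<Rightarrow> (real \<Rightarrow> (real \<Rightarrow> 'h) \<Rightarrow> 'h \<Rightarrow> real) \<Rightarrow> ((real \<Rightarrow> 'h) \<Rightarrow> real) \<Rightarrow> real \<Rightarrow> (real \<Rightarrow> 'h) set
     \<Rightarrow> (real \<Rightarrow> (real \<Rightarrow> 'h) \<Rightarrow> real) \<Rightarrow> bool" where
  "minimax_supersolution \<iota> A p q T F h L \<Omega> v \<longleftrightarrow>
     pm_lsc (d_inf T) ({0..T} \<times> \<Omega>) (\<lambda>(t, x). v t x) \<and>
     (\<forall>x\<in>\<Omega>. v T x \<ge> h x) \<and>
     (\<forall>t0\<in>{0..<T}. \<forall>x0\<in>\<Omega>. \<forall>z. \<exists>x\<in>\<Omega>. \<exists>f. trajectory_with \<iota> A p q T L t0 x0 x f \<and>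
        (\<forall>t\<in>{t0..T}. v t0 x0 \<ge>
           integral\<^sup>L (lebesgue_on {t0..t}) (\<lambda>s. - inner (f s) z + F s x z) + v t x))"

end

theory Submission
  imports Defs
begin

text \<open>
  Doubling of variables. Let \<open>u - v\<close> be positive somewhere and maximise, over times \<open>t\<close> and pairs of
  trajectories \<open>x, y\<close> lying in \<open>\<Omega>\<close>,
  \<open>u t x - v t y - |x t - y t|\<^sup>2 / (2\<epsilon>) - (1/\<epsilon>) \<integral> |x - y|\<^sup>2 - \<gamma> (T - t)\<close>.
  The supremum need not be attained, as \<open>\<Omega>\<close> is not closed, so an approximate maximiser \<open>(t1, x, y)\<close>
  is used. From there both
  semisolution inequalities are followed, with the frozen slope \<open>z = (x t1 - y t1) / \<epsilon>\<close>, over a time step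
  whose length does not depend on the maximiser. Monotonicity of \<open>A\<close> in the energy inequality for \<open>x - y\<close>
  removes the unbounded terms, the structure condition on \<open>F\<close> bounds the rest below \<open>\<gamma>\<close>, and the functional
  would increase by more than the approximation error.

  The uniform step length and the uniform continuity of \<open>F\<close> and \<open>h\<close> rest on the precompactness of the set of
  trajectories. It follows from the bounds of a trajectory in \<open>L\<^sup>p(V)\<close> and of its derivative in \<open>L\<^sup>q(V\<^sup>*)\<close>
  by approximating it in \<open>L\<^sup>1(H)\<close> by step functions with values in a compact set, and upgrading \<open>L\<^sup>1\<close>
  closeness to uniform closeness with the energy inequality.

  The energy inequality is obtained without a chain rule or smoothing in time: the increment of \<open>|w|\<^sup>2\<close> over a lag \<open>h\<close>
  is compared with the pairing of \<open>w'\<close> and \<open>w\<close>, with an error controlled by the integral of \<open>\<parallel>W t - W \<rho>\<parallel>\<^sup>p\<close>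
  over the strip \<open>t - h < \<rho> < t\<close>, which is \<open>o(h)\<close>.
\<close>

section \<open>Smooth cut-off functions\<close>

text \<open>The derivative of a trajectory is known only through infinitely differentiable test
  functions, and its values lie in the dual of V. Smooth cut-offs turn this into an integral
  identity between two times, tested with fixed vectors, and they allow trajectories to be
  concatenated. Concatenation is indispensable: each semisolution inequality hands over a new path
  that starts at the current time, and this path must compete again in the doubled functional.

  The integral penalty is there for the past. The modulus in the structure condition on F sees the
  supremum of |x - y| over all earlier times, whereas |x t - y t| sees only the present; combined
  with equicontinuity, a small integral forces a small supremum.

  The drift \<gamma> (T - t) pays for every error. The gain of one step has to beat the error of the
  approximate maximiser, so the order of the choices matters: \<epsilon> is fixed before the step
  length, which comes from equicontinuity and may depend on \<epsilon>, and the approximation error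
  is chosen last.\<close>

definition smooth_real :: "(real \<Rightarrow> real) \<Rightarrow> bool" where
  "smooth_real f \<longleftrightarrow> (\<forall>n. (deriv ^^ n) f differentiable_on UNIV)"

text \<open>The power of x is kept as an index because the family over all k is stable under
  differentiation: the derivative of member k combines members k + 2 and k + 1.\<close>

definition flat_exp :: "nat \<Rightarrow> real \<Rightarrow> real" where
  "flat_exp k x = (if x > 0 then exp (- (1 / x)) / x ^ k else 0)"

text \<open>The substitution y = 1 / h reduces this to the decay of y^k / exp y at infinity. It is
  what makes the members differentiable at 0.\<close>

lemma flat_exp_tendsto_0: "((\<lambda>h. flat_exp k h) \<longlongrightarrow> 0) (at_right 0)"
proof -
  have "((\<lambda>y::real. y ^ k / exp y) \<longlongrightarrow> 0) at_top"
    by (rule tendsto_power_div_exp_0)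
  then have "((\<lambda>h::real. (inverse h) ^ k / exp (inverse h)) \<longlongrightarrow> 0) (at_right 0)"
    using filterlim_compose[OF _ filterlim_inverse_at_top_right] by blast
  moreover have "\<forall>\<^sub>F h in at_right (0::real). (inverse h) ^ k / exp (inverse h) = flat_exp k h"
    unfolding eventually_at_filter
    by (rule always_eventually)
      (auto simp: flat_exp_def exp_minus field_simps power_inverse)
  ultimately show ?thesis by (rule Lim_transform_eventually)
qed

lemma flat_exp_deriv:
  "(flat_exp k has_real_derivative (flat_exp (Suc (Suc k)) x - k * flat_exp (Suc k) x)) (at x)"
proof -
  consider "x > 0" | "x < 0" | "x = 0" by linarith
  then show ?thesis
  proof cases
    case 1
    have ev: "\<forall>\<^sub>F y in nhds x. flat_exp k y = exp (- (1 / y)) / y ^ k"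
    proof -
      have "\<forall>\<^sub>F y in nhds x. y > 0"
        using 1 eventually_nhds_in_open[of "{0<..}" x] by simp
      then show ?thesis by eventually_elim (simp add: flat_exp_def)
    qed
    have "((\<lambda>y. exp (- (1 / y)) / y ^ k) has_real_derivative
        (flat_exp (Suc (Suc k)) x - k * flat_exp (Suc k) x)) (at x)"
    proof -
      have inv: "((\<lambda>y. 1 / y) has_real_derivative - 1 / x\<^sup>2) (at x)"
        using DERIV_inverse[of x UNIV] 1 by (simp add: divide_inverse power2_eq_square)
      have d1: "((\<lambda>y. exp (- (1 / y))) has_real_derivative exp (- (1 / x)) * (- (- 1 / x\<^sup>2))) (at x)"
        by (rule DERIV_fun_exp[OF DERIV_minus[OF inv]])
      have d2: "((\<lambda>y. (1 / y) ^ k) has_real_derivative real k * (- 1 / x\<^sup>2 * (1 / x) ^ (k - Suc 0))) (at x)"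
        using DERIV_power[OF inv, of k] by (simp add: mult.assoc)
      have e2: "real k * (- 1 / x\<^sup>2 * (1 / x) ^ (k - Suc 0)) = - real k * (1 / x) ^ Suc k"
        by (cases k) (simp_all add: power2_eq_square algebra_simps add_divide_distrib diff_divide_distrib)
      have e1: "(\<lambda>y::real. exp (- (1 / y)) * (1 / y) ^ k) = (\<lambda>y. exp (- (1 / y)) / y ^ k)"
        by (rule ext) (simp add: power_one_over)
      have e3: "exp (- (1 / x)) * (- (- 1 / x\<^sup>2)) * (1 / x) ^ k + - real k * (1 / x) ^ Suc k * exp (- (1 / x))
          = flat_exp (Suc (Suc k)) x - k * flat_exp (Suc k) x"
        using 1 by (simp add: flat_exp_def power_one_over power2_eq_square)
      show ?thesis
        using DERIV_mult[OF d1 d2[unfolded e2]] unfolding e1 e3 .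
    qed
    then show ?thesis by (rule DERIV_cong_ev[OF refl ev refl, THEN iffD2])
  next
    case 2
    have ev: "\<forall>\<^sub>F y in nhds x. flat_exp k y = 0"
    proof -
      have "\<forall>\<^sub>F y in nhds x. y < 0"
        using 2 eventually_nhds_in_open[of "{..<0}" x] by simp
      then show ?thesis by eventually_elim (simp add: flat_exp_def)
    qed
    have "(flat_exp k has_real_derivative 0) (at x)"
      by (rule DERIV_cong_ev[OF refl ev refl, THEN iffD2, OF DERIV_const])
    then show ?thesis using 2 by (simp add: flat_exp_def)
  next
    case 3
    have "((\<lambda>h. (flat_exp k (0 + h) - flat_exp k 0) / h) \<longlongrightarrow> 0) (at 0)"
    proof (rule filterlim_split_at)
      have "\<forall>\<^sub>F h in at_left (0::real). 0 = (flat_exp k (0 + h) - flat_exp k 0) / h"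
        unfolding eventually_at_filter
        by (rule always_eventually) (auto simp: flat_exp_def)
      then show "((\<lambda>h. (flat_exp k (0 + h) - flat_exp k 0) / h) \<longlongrightarrow> 0) (at_left 0)"
        by (rule Lim_transform_eventually[OF tendsto_const])
      \<comment> \<open>Division by h raises the index, so the right difference quotient at 0 is the
        next member of the family, which tends to 0.\<close>
      have "\<forall>\<^sub>F h in at_right (0::real). flat_exp (Suc k) h = (flat_exp k (0 + h) - flat_exp k 0) / h"
        unfolding eventually_at_filter
        by (rule always_eventually) (auto simp: flat_exp_def)
      then show "((\<lambda>h. (flat_exp k (0 + h) - flat_exp k 0) / h) \<longlongrightarrow> 0) (at_right 0)"
        by (rule Lim_transform_eventually[OF flat_exp_tendsto_0])
    qed
    then show ?thesis using 3 by (simp add: DERIV_def flat_exp_def)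
  qed
qed

text \<open>Smoothness is iterated differentiability, so it cannot be proved by rules for single derivatives;
the closure below is stable under differentiation, which yields all orders at once.\<close>

inductive_set smooth_closure :: "(real \<Rightarrow> real) set" where
  base: "smooth_real f \<Longrightarrow> f \<in> smooth_closure"
| const: "(\<lambda>x. c) \<in> smooth_closure"
| flat: "(\<lambda>x. flat_exp k (a * x + b)) \<in> smooth_closure"
| add: "f \<in> smooth_closure \<Longrightarrow> g \<in> smooth_closure \<Longrightarrow> (\<lambda>x. f x + g x) \<in> smooth_closure"
| mult: "f \<in> smooth_closure \<Longrightarrow> g \<in> smooth_closure \<Longrightarrow> (\<lambda>x. f x * g x) \<in> smooth_closure"
| inverse: "f \<in> smooth_closure \<Longrightarrow> (\<And>x. f x \<noteq> 0) \<Longrightarrow> (\<lambda>x. inverse (f x)) \<in> smooth_closure"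

lemma smooth_real_deriv:
  assumes "smooth_real f"
  shows "smooth_real (deriv f)" "(f has_real_derivative deriv f x) (at x)"
proof -
  show "smooth_real (deriv f)"
    unfolding smooth_real_def
  proof
    fix n
    have "(deriv ^^ Suc n) f differentiable_on UNIV"
      using assms unfolding smooth_real_def by blast
    then show "(deriv ^^ n) (deriv f) differentiable_on UNIV"
      by (simp add: funpow_swap1)
  qed
  have "f differentiable_on UNIV"
    using assms unfolding smooth_real_def by (metis funpow_0)
  then show "(f has_real_derivative deriv f x) (at x)"
    by (metis DERIV_imp_deriv UNIV_I differentiable_on_def real_differentiable_def)
qed

lemma smooth_closure_has_derivative:
  assumes "f \<in> smooth_closure"
  shows "\<exists>f'\<in>smooth_closure. \<forall>x. (f has_real_derivative f' x) (at x)"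
  using assms
proof induction
  case (base f)
  then show ?case using smooth_real_deriv smooth_closure.base by blast
next
  case (const c)
  then show ?case using smooth_closure.const[of 0] by (intro bexI[of _ "\<lambda>x. 0"]) auto
next
  case (flat k a b)
  have "((\<lambda>x. flat_exp k (a * x + b)) has_real_derivative
      a * (flat_exp (Suc (Suc k)) (a * x + b) + (- real k) * flat_exp (Suc k) (a * x + b))) (at x)" for x
    by (rule DERIV_chain2[OF flat_exp_deriv, THEN DERIV_cong]) (auto intro!: derivative_eq_intros)
  moreover have "(\<lambda>x. a * (flat_exp (Suc (Suc k)) (a * x + b) + (- real k) * flat_exp (Suc k) (a * x + b)))
      \<in> smooth_closure"
    by (rule smooth_closure.mult[OF smooth_closure.const
          smooth_closure.add[OF smooth_closure.flat
            smooth_closure.mult[OF smooth_closure.const smooth_closure.flat]]])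
  ultimately show ?case by (intro bexI allI)
next
  case (add f g)
  then obtain f' g' where *: "f' \<in> smooth_closure" "g' \<in> smooth_closure"
    "\<forall>x. (f has_real_derivative f' x) (at x)" "\<forall>x. (g has_real_derivative g' x) (at x)" by blast
  then show ?case
    by (intro bexI[of _ "\<lambda>x. f' x + g' x"]) (auto intro!: smooth_closure.add DERIV_add)
next
  case (mult f g)
  then obtain f' g' where *: "f' \<in> smooth_closure" "g' \<in> smooth_closure"
    "\<forall>x. (f has_real_derivative f' x) (at x)" "\<forall>x. (g has_real_derivative g' x) (at x)" by blast
  then have "((\<lambda>x. f x * g x) has_real_derivative (f x * g' x + f' x * g x)) (at x)" for x
    by (auto intro!: derivative_eq_intros)
  moreover have "(\<lambda>x. f x * g' x + f' x * g x) \<in> smooth_closure"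
    by (rule smooth_closure.add[OF smooth_closure.mult smooth_closure.mult]) (use * mult in auto)
  ultimately show ?case by (intro bexI allI)
next
  case (inverse f)
  then obtain f' where *: "f' \<in> smooth_closure"
    "\<forall>x. (f has_real_derivative f' x) (at x)" by blast
  then have "((\<lambda>x. inverse (f x)) has_real_derivative (- 1 * (inverse (f x) * f' x * inverse (f x)))) (at x)" for x
    using inverse by (auto intro!: derivative_eq_intros)
  moreover have "(\<lambda>x. - 1 * (inverse (f x) * f' x * inverse (f x))) \<in> smooth_closure"
    by (rule smooth_closure.mult[OF smooth_closure.const
          smooth_closure.mult[OF smooth_closure.mult[OF smooth_closure.inverse] smooth_closure.inverse]])
      (use * inverse in auto)
  ultimately show ?case by (intro bexI allI)
qed

lemma smooth_closure_smooth:
  assumes "f \<in> smooth_closure"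
  shows "smooth_real f"
proof -
  have "(deriv ^^ n) f \<in> smooth_closure" for n
  proof (induction n)
    case (Suc n)
    then obtain f' where f': "f' \<in> smooth_closure" "\<forall>x. ((deriv ^^ n) f has_real_derivative f' x) (at x)"
      using smooth_closure_has_derivative by blast
    then have "(deriv ^^ Suc n) f = f'" by (auto simp: fun_eq_iff intro!: DERIV_imp_deriv)
    then show ?case using f' by simp
  qed (use assms in simp)
  then have "(deriv ^^ n) f differentiable_on UNIV" for n
    using smooth_closure_has_derivative
    by (metis UNIV_I differentiable_on_def real_differentiable_def differentiable_at_withinI)
  then show ?thesis unfolding smooth_real_def by blast
qed

lemma smooth_real_continuous_on_deriv:
  assumes "smooth_real f"
  shows "continuous_on S f" "continuous_on S (deriv f)"
  using smooth_real_deriv(2)[OF assms] smooth_real_deriv(2)[OF smooth_real_deriv(1)[OF assms]]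
  by (meson DERIV_continuous_on has_field_derivative_at_within)+

text \<open>The classical smooth transition from 0 (left of 0) to 1 (right of 1). The denominator is
  positive because x and 1 - x cannot both be nonpositive.\<close>

definition smooth_step :: "real \<Rightarrow> real" where
  "smooth_step x = flat_exp 0 x * inverse (flat_exp 0 x + flat_exp 0 (1 - x))"

lemma flat_exp_nonneg: "0 \<le> flat_exp 0 x"
  by (simp add: flat_exp_def)

lemma flat_exp_sum_pos: "0 < flat_exp 0 x + flat_exp 0 (1 - x)"
proof (cases "x > 0")
  case True
  then show ?thesis using flat_exp_nonneg[of "1 - x"] by (simp add: flat_exp_def add_pos_nonneg)
qed (simp add: flat_exp_def)

lemma smooth_step_affine: "(\<lambda>x. smooth_step (a * x + b)) \<in> smooth_closure"
proof -
  have eq: "flat_exp 0 ((- a) * x + (1 - b)) = flat_exp 0 (1 - (a * x + b))" for x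
    by (simp add: algebra_simps)
  have "(\<lambda>x. flat_exp 0 (a * x + b) * inverse (flat_exp 0 (a * x + b) + flat_exp 0 ((- a) * x + (1 - b))))
      \<in> smooth_closure" (is "?f \<in> _")
  proof (rule smooth_closure.mult[OF smooth_closure.flat smooth_closure.inverse[OF smooth_closure.add
          [OF smooth_closure.flat smooth_closure.flat]]])
    show "flat_exp 0 (a * x + b) + flat_exp 0 ((- a) * x + (1 - b)) \<noteq> 0" for x
      unfolding eq using flat_exp_sum_pos[of "a * x + b"] by simp
  qed
  then show ?thesis unfolding eq smooth_step_def[symmetric] .
qed

lemma smooth_step_0: "x \<le> 0 \<Longrightarrow> smooth_step x = 0"
  by (simp add: smooth_step_def flat_exp_def)

lemma smooth_step_1: "x \<ge> 1 \<Longrightarrow> smooth_step x = 1"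
  by (simp add: smooth_step_def flat_exp_def)

lemma smooth_step_bounds: "0 \<le> smooth_step x" "smooth_step x \<le> 1"
  using flat_exp_nonneg[of x] flat_exp_nonneg[of "1 - x"] flat_exp_sum_pos[of x]
  by (auto simp: smooth_step_def divide_inverse[symmetric] divide_le_eq)

text \<open>The transition is moved to the interval from c to c + d. Its derivative then serves as a
  mollifier kernel of width d whose support lies to the right of c.\<close>

definition step_at :: "real \<Rightarrow> real \<Rightarrow> real \<Rightarrow> real" where
  "step_at c d r = smooth_step ((r - c) / d)"

lemma step_at_smooth: "step_at c d \<in> smooth_closure"
proof -
  have "step_at c d = (\<lambda>r. smooth_step ((1/d) * r + (- c / d)))"
    by (auto simp: step_at_def fun_eq_iff diff_divide_distrib)
  then show ?thesis using smooth_step_affine[of "1 / d" "- c / d"] by argo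
qed

lemma step_at_0: "d > 0 \<Longrightarrow> r \<le> c \<Longrightarrow> step_at c d r = 0"
  and step_at_1: "d > 0 \<Longrightarrow> r \<ge> c + d \<Longrightarrow> step_at c d r = 1"
  and step_at_bounds: "0 \<le> step_at c d r" "step_at c d r \<le> 1"
  by (auto simp: step_at_def smooth_step_0 smooth_step_bounds divide_le_0_iff
      le_divide_eq intro!: smooth_step_1)

lemma step_at_deriv: "(step_at c d has_real_derivative deriv (step_at c d) r) (at r)"
  using smooth_real_deriv(2) step_at_smooth smooth_closure_smooth by blast

lemma step_at_deriv_eq:
  assumes "d > 0"
  shows "deriv (step_at c d) r = deriv smooth_step ((r - c) / d) / d"
proof -
  have "smooth_real smooth_step"
    using smooth_step_affine[of 1 0] by (simp add: smooth_closure_smooth)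
  from smooth_real_deriv(2)[OF this]
  have "((\<lambda>r. smooth_step ((r - c) / d)) has_real_derivative
      deriv smooth_step ((r - c) / d) * (1 / d)) (at r)"
    by (rule DERIV_chain2) (use assms in \<open>auto intro!: derivative_eq_intros\<close>)
  then show ?thesis
    unfolding step_at_def[abs_def] using DERIV_imp_deriv by fastforce
qed

lemma smooth_step_deriv_outside:
  assumes "x < 0 \<or> x > 1"
  shows "deriv smooth_step x = 0"
proof -
  have "\<forall>\<^sub>F y in nhds x. smooth_step y = (if x < 0 then 0 else 1)"
  proof (cases "x < 0")
    case True
    have "\<forall>\<^sub>F y in nhds x. y < 0"
      using True eventually_nhds_in_open[of "{..<0}" x] by simp
    then show ?thesis by eventually_elim (use True in \<open>simp add: smooth_step_0\<close>)
  next
    case False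
    then have "\<forall>\<^sub>F y in nhds x. 1 < y"
      using assms eventually_nhds_in_open[of "{1<..}" x] by simp
    then show ?thesis by eventually_elim (use False in \<open>simp add: smooth_step_1\<close>)
  qed
  then have "deriv smooth_step x = deriv (\<lambda>y. if x < 0 then 0 else 1) x"
    by (rule deriv_cong_ev) simp
  then show ?thesis by simp
qed

lemma step_at_deriv_outside:
  assumes "d > 0" "r < c \<or> r > c + d"
  shows "deriv (step_at c d) r = 0"
  using assms smooth_step_deriv_outside[of "(r - c) / d"]
  by (auto simp: step_at_deriv_eq field_simps)

text \<open>By scaling, the derivative is 1 / d times a fixed continuous profile that vanishes
  outside the unit interval, so one constant serves all positions and widths. It is taken to be at
  least 1 so that it can be divided by later.\<close>

lemma step_at_deriv_bound:
  obtains C where "C \<ge> 1" "\<And>c d r. d > 0 \<Longrightarrow> \<bar>deriv (step_at c d) r\<bar> \<le> C / d"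
proof -
  have sm: "smooth_real smooth_step"
    using smooth_step_affine[of 1 0] by (simp add: smooth_closure_smooth)
  have "compact (deriv smooth_step ` {0..1})"
    by (rule compact_continuous_image[OF smooth_real_continuous_on_deriv(2)[OF sm] compact_Icc])
  then obtain C where C: "\<And>x. x \<in> {0..1} \<Longrightarrow> \<bar>deriv smooth_step x\<bar> \<le> C"
    unfolding real_norm_def[symmetric] by (meson bounded_iff compact_imp_bounded imageI)
  have "\<bar>deriv smooth_step x\<bar> \<le> max C 1" for x
    using C[of x] smooth_step_deriv_outside[of x] by (cases "x \<in> {0..1}") auto
  then have "\<bar>deriv (step_at c d) r\<bar> \<le> max C 1 / d" if "d > 0" for c d r
    using that by (simp add: step_at_deriv_eq divide_right_mono)
  then show ?thesis by (intro that[of "max C 1"]) auto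
qed

section \<open>Strong integrals\<close>

lemma integrable_lebesgue_on_iff:
  fixes f :: "real \<Rightarrow> 'b::{banach, second_countable_topology}"
  assumes "S \<in> sets lebesgue"
  shows "integrable (lebesgue_on S) f \<longleftrightarrow> set_integrable lebesgue S f"
  using assms by (simp add: integrable_restrict_space set_integrable_def)

lemma integrable_lebesgue_on_subset:
  fixes f :: "real \<Rightarrow> 'b::{banach, second_countable_topology}"
  assumes "integrable (lebesgue_on S) f" "T \<subseteq> S" "S \<in> sets lebesgue" "T \<in> sets lebesgue"
  shows "integrable (lebesgue_on T) f"
  using assms by (simp add: integrable_lebesgue_on_iff) (metis set_integrable_subset)

lemma AE_lebesgue_on_subset:
  assumes "AE t in lebesgue_on S. P t" "T \<subseteq> S" "S \<in> sets lebesgue" "T \<in> sets lebesgue"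
  shows "AE t in lebesgue_on T. P t"
proof -
  have "AE t in lebesgue. t \<in> S \<longrightarrow> P t"
    using assms by (subst (asm) AE_restrict_space_iff) auto
  then show ?thesis
    using assms by (subst AE_restrict_space_iff) auto
qed

text \<open>A simple function takes finitely many values, so the difference is treated on each of
  its level sets with a constant subtracted. This route is taken because in a codomain without a
  countable base, such as the dual of V as a type, differences of Borel functions need not be
  Borel.\<close>

lemma measurable_diff_simple:
  fixes f s :: "'a \<Rightarrow> 'b::real_normed_vector"
  assumes f: "f \<in> borel_measurable M" and s: "simple_function M s"
  shows "(\<lambda>x. norm (f x - s x)) \<in> borel_measurable M"
proof (rule measurable_compose_countable'[where f="\<lambda>i x. norm (f x - i)" and I="s ` space M"])
  show "(\<lambda>x. norm (f x - i)) \<in> borel_measurable M" for i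
    using f by (rule measurable_compose) (intro borel_measurable_continuous_onI continuous_intros)
  show "s \<in> M \<rightarrow>\<^sub>M count_space (s ` space M)"
    using s by (subst measurable_count_space_eq2) (auto simp: simple_function_def)
  show "countable (s ` space M)"
    using s by (simp add: simple_function_def countable_finite)
qed

lemma has_strong_integral_simple_approx:
  assumes "has_strong_integral M f I" "e > 0"
  obtains s where "Bochner_Integration.simple_bochner_integrable M s"
    "(\<integral>\<^sup>+x. ennreal (norm (f x - s x)) \<partial>M) < ennreal e"
    "norm (Bochner_Integration.simple_bochner_integral M s - I) < e"
proof -
  obtain s where s: "\<forall>i::nat. Bochner_Integration.simple_bochner_integrable M (s i)"
    "(\<lambda>i. \<integral>\<^sup>+x. ennreal (norm (f x - s i x)) \<partial>M) \<longlonglongrightarrow> 0"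
    "(\<lambda>i. Bochner_Integration.simple_bochner_integral M (s i)) \<longlonglongrightarrow> I"
    using assms(1) unfolding has_strong_integral_def by blast
  have "\<forall>\<^sub>F i in sequentially. (\<integral>\<^sup>+x. ennreal (norm (f x - s i x)) \<partial>M) < ennreal e"
    using order_tendstoD(2)[OF s(2)] assms(2) by simp
  moreover have "\<forall>\<^sub>F i in sequentially. dist (Bochner_Integration.simple_bochner_integral M (s i)) I < e"
    using tendstoD[OF s(3) assms(2)] .
  ultimately have "\<forall>\<^sub>F i in sequentially. (\<integral>\<^sup>+x. ennreal (norm (f x - s i x)) \<partial>M) < ennreal e
      \<and> dist (Bochner_Integration.simple_bochner_integral M (s i)) I < e"
    by eventually_elim simp
  then obtain i where "(\<integral>\<^sup>+x. ennreal (norm (f x - s i x)) \<partial>M) < ennreal e"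
    "dist (Bochner_Integration.simple_bochner_integral M (s i)) I < e"
    using eventually_happens'[OF sequentially_bot] by blast
  with s(1) show ?thesis by (intro that[of "s i"]) (auto simp: dist_norm)
qed

lemma has_strong_integralI:
  fixes f :: "'a \<Rightarrow> 'b::real_normed_vector"
  assumes f: "f \<in> borel_measurable M"
    and approx: "\<And>e. e > 0 \<Longrightarrow> \<exists>s. Bochner_Integration.simple_bochner_integrable M s \<and>
      (\<integral>\<^sup>+x. ennreal (norm (f x - s x)) \<partial>M) \<le> ennreal e \<and>
      norm (Bochner_Integration.simple_bochner_integral M s - I) \<le> e"
  shows "has_strong_integral M f I"
proof -
  have "\<forall>n::nat. \<exists>s. Bochner_Integration.simple_bochner_integrable M s \<and>
      (\<integral>\<^sup>+x. ennreal (norm (f x - s x)) \<partial>M) \<le> ennreal (inverse (Suc n)) \<and>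
      norm (Bochner_Integration.simple_bochner_integral M s - I) \<le> inverse (Suc n)"
    using approx by simp
  then obtain s where s: "\<And>n::nat. Bochner_Integration.simple_bochner_integrable M (s n)"
      "\<And>n. (\<integral>\<^sup>+x. ennreal (norm (f x - s n x)) \<partial>M) \<le> ennreal (inverse (Suc n))"
      "\<And>n. norm (Bochner_Integration.simple_bochner_integral M (s n) - I) \<le> inverse (Suc n)"
    by metis
  have "(\<lambda>n. ennreal (inverse (Suc n))) \<longlonglongrightarrow> 0"
    using tendsto_ennrealI[OF LIMSEQ_inverse_real_of_nat] by simp
  then have "(\<lambda>n. \<integral>\<^sup>+x. ennreal (norm (f x - s n x)) \<partial>M) \<longlonglongrightarrow> 0"
    by (rule tendsto_sandwich[OF _ _ tendsto_const, rotated 2]) (use s(2) in auto)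
  moreover have "(\<lambda>n. Bochner_Integration.simple_bochner_integral M (s n)) \<longlonglongrightarrow> I"
    by (rule Lim_transform_bound[OF _ LIMSEQ_inverse_real_of_nat, THEN LIM_zero_cancel])
      (use s(3) in auto)
  ultimately show ?thesis
    unfolding has_strong_integral_def using f s(1) by blast
qed

text \<open>The triangle inequality through a simple function close to the approximant g.
  Measurability of the distance between \<open>f\<close> and \<open>g\<close> is part of the
  hypothesis, since without a countable base it does not follow from measurability of the two
  functions.\<close>

lemma has_strong_integral_limit:
  fixes f :: "'a \<Rightarrow> 'b::real_normed_vector"
  assumes f: "f \<in> borel_measurable M"
    and approx: "\<And>e. e > 0 \<Longrightarrow> \<exists>g J. has_strong_integral M g J \<and>
      (\<lambda>x. norm (f x - g x)) \<in> borel_measurable M \<and>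
      (\<integral>\<^sup>+x. ennreal (norm (f x - g x)) \<partial>M) \<le> ennreal e \<and> norm (J - I) \<le> e"
  shows "has_strong_integral M f I"
proof (rule has_strong_integralI[OF f])
  fix e :: real assume "e > 0"
  then have e2: "e / 2 > 0" by simp
  obtain g J where g: "has_strong_integral M g J"
    and m1: "(\<lambda>x. norm (f x - g x)) \<in> borel_measurable M"
    and b1: "(\<integral>\<^sup>+x. ennreal (norm (f x - g x)) \<partial>M) \<le> ennreal (e / 2)" "norm (J - I) \<le> e / 2"
    using approx[OF e2] by blast
  obtain s where s: "Bochner_Integration.simple_bochner_integrable M s"
    and b2: "(\<integral>\<^sup>+x. ennreal (norm (g x - s x)) \<partial>M) < ennreal (e / 2)"
    "norm (Bochner_Integration.simple_bochner_integral M s - J) < e / 2"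
    by (rule has_strong_integral_simple_approx[OF g e2])
  have m2: "(\<lambda>x. norm (g x - s x)) \<in> borel_measurable M"
    using g s by (intro measurable_diff_simple)
      (auto simp: has_strong_integral_def elim: Bochner_Integration.simple_bochner_integrable.cases)
  have "(\<integral>\<^sup>+x. ennreal (norm (f x - s x)) \<partial>M)
      \<le> (\<integral>\<^sup>+x. ennreal (norm (f x - g x)) + ennreal (norm (g x - s x)) \<partial>M)"
    by (intro nn_integral_mono) (simp flip: ennreal_plus, metis norm_triangle_ineq diff_add_eq add_diff_cancel diff_add_cancel add_diff_eq)
  also have "\<dots> = (\<integral>\<^sup>+x. ennreal (norm (f x - g x)) \<partial>M) + (\<integral>\<^sup>+x. ennreal (norm (g x - s x)) \<partial>M)"
    using m1 m2 by (intro nn_integral_add) auto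
  also have "\<dots> \<le> ennreal (e / 2) + ennreal (e / 2)"
    using b1 b2 by (intro add_mono) auto
  also have "\<dots> = ennreal e"
    using \<open>e > 0\<close> by (simp flip: ennreal_plus)
  finally have "(\<integral>\<^sup>+x. ennreal (norm (f x - s x)) \<partial>M) \<le> ennreal e" .
  moreover have "norm (Bochner_Integration.simple_bochner_integral M s - I) \<le> e"
    using b1(2) b2(2) norm_triangle_ineq[of "Bochner_Integration.simple_bochner_integral M s - J" "J - I"]
    by simp
  ultimately show "\<exists>s. Bochner_Integration.simple_bochner_integrable M s \<and>
      (\<integral>\<^sup>+x. ennreal (norm (f x - s x)) \<partial>M) \<le> ennreal e \<and>
      norm (Bochner_Integration.simple_bochner_integral M s - I) \<le> e"
    using s by blast
qed

lemma has_strong_integral_add: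
  fixes f g :: "'a \<Rightarrow> 'b::real_normed_vector"
  assumes f: "has_strong_integral M f I" and g: "has_strong_integral M g J"
    and fg: "(\<lambda>x. f x + g x) \<in> borel_measurable M"
  shows "has_strong_integral M (\<lambda>x. f x + g x) (I + J)"
proof (rule has_strong_integralI[OF fg])
  fix e :: real assume "e > 0"
  then have e2: "e / 2 > 0" by simp
  obtain s where s: "Bochner_Integration.simple_bochner_integrable M s"
    "(\<integral>\<^sup>+x. ennreal (norm (f x - s x)) \<partial>M) < ennreal (e / 2)"
    "norm (Bochner_Integration.simple_bochner_integral M s - I) < e / 2"
    by (rule has_strong_integral_simple_approx[OF f e2])
  obtain t where t: "Bochner_Integration.simple_bochner_integrable M t"
    "(\<integral>\<^sup>+x. ennreal (norm (g x - t x)) \<partial>M) < ennreal (e / 2)"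
    "norm (Bochner_Integration.simple_bochner_integral M t - J) < e / 2"
    by (rule has_strong_integral_simple_approx[OF g e2])
  have m: "(\<lambda>x. norm (f x - s x)) \<in> borel_measurable M" "(\<lambda>x. norm (g x - t x)) \<in> borel_measurable M"
    using f g s(1) t(1) by (auto intro!: measurable_diff_simple
        simp: has_strong_integral_def elim: Bochner_Integration.simple_bochner_integrable.cases)
  have "(\<integral>\<^sup>+x. ennreal (norm (f x + g x - (s x + t x))) \<partial>M)
      \<le> (\<integral>\<^sup>+x. ennreal (norm (f x - s x)) + ennreal (norm (g x - t x)) \<partial>M)"
    by (intro nn_integral_mono) (simp flip: ennreal_plus add: norm_diff_triangle_ineq)
  also have "\<dots> = (\<integral>\<^sup>+x. ennreal (norm (f x - s x)) \<partial>M) + (\<integral>\<^sup>+x. ennreal (norm (g x - t x)) \<partial>M)"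
    using m by (intro nn_integral_add) auto
  also have "\<dots> \<le> ennreal (e / 2) + ennreal (e / 2)"
    using s t by (intro add_mono) auto
  also have "\<dots> = ennreal e"
    using \<open>e > 0\<close> by (simp flip: ennreal_plus)
  finally have "(\<integral>\<^sup>+x. ennreal (norm (f x + g x - (s x + t x))) \<partial>M) \<le> ennreal e" .
  moreover have "Bochner_Integration.simple_bochner_integrable M (\<lambda>x. s x + t x)"
    by (rule Bochner_Integration.simple_bochner_integrable_compose2[OF _ s(1) t(1)]) simp
  moreover have "norm (Bochner_Integration.simple_bochner_integral M (\<lambda>x. s x + t x) - (I + J)) \<le> e"
    using s(3) t(3) norm_diff_triangle_ineq[of "Bochner_Integration.simple_bochner_integral M s"
      "Bochner_Integration.simple_bochner_integral M t" I J]
    by (simp add: Bochner_Integration.simple_bochner_integral_add[OF s(1) t(1)])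
  ultimately show "\<exists>s. Bochner_Integration.simple_bochner_integrable M s \<and>
      (\<integral>\<^sup>+x. ennreal (norm (f x + g x - s x)) \<partial>M) \<le> ennreal e \<and>
      norm (Bochner_Integration.simple_bochner_integral M s - (I + J)) \<le> e"
    by blast
qed

lemma has_strong_integral_restrict_space:
  fixes f :: "'a \<Rightarrow> 'b::real_normed_vector"
  assumes \<Omega>: "\<Omega> \<inter> space M \<in> sets M" and f: "has_strong_integral (restrict_space M \<Omega>) f I"
  shows "has_strong_integral M (\<lambda>x. indicator \<Omega> x *\<^sub>R f x) I"
proof (rule has_strong_integralI)
  show "(\<lambda>x. indicator \<Omega> x *\<^sub>R f x) \<in> borel_measurable M"
    using f \<Omega> by (simp add: has_strong_integral_def borel_measurable_restrict_space_iff)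
  fix e :: real assume "e > 0"
  obtain s where s: "Bochner_Integration.simple_bochner_integrable (restrict_space M \<Omega>) s"
    "(\<integral>\<^sup>+x. ennreal (norm (f x - s x)) \<partial>restrict_space M \<Omega>) < ennreal e"
    "norm (Bochner_Integration.simple_bochner_integral (restrict_space M \<Omega>) s - I) < e"
    by (rule has_strong_integral_simple_approx[OF f \<open>e > 0\<close>])
  have "(\<integral>\<^sup>+x. ennreal (norm (indicator \<Omega> x *\<^sub>R f x - indicator \<Omega> x *\<^sub>R s x)) \<partial>M)
      = (\<integral>\<^sup>+x. ennreal (norm (f x - s x)) \<partial>restrict_space M \<Omega>)"
    by (subst nn_integral_restrict_space[OF \<Omega>], intro nn_integral_cong) (simp split: split_indicator)
  then show "\<exists>s. Bochner_Integration.simple_bochner_integrable M s \<and>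
      (\<integral>\<^sup>+x. ennreal (norm (indicator \<Omega> x *\<^sub>R f x - s x)) \<partial>M) \<le> ennreal e \<and>
      norm (Bochner_Integration.simple_bochner_integral M s - I) \<le> e"
    using s simple_bochner_integrable_restrict_space[OF \<Omega>, of s]
      simple_bochner_integral_restrict_space[OF \<Omega> s(1)]
    by (intro exI[of _ "\<lambda>x. indicator \<Omega> x *\<^sub>R s x"]) auto
qed

text \<open>Evaluation at a fixed vector is bounded and linear, so it carries simple approximants to
  simple approximants. It is the passage from integrals in the dual to real integrals, where
  dominated convergence is at hand.\<close>

lemma has_strong_integral_blinfun_apply:
  assumes "has_strong_integral M f I"
  shows "has_bochner_integral M (\<lambda>x. blinfun_apply (f x) v) (blinfun_apply I v)"
proof -
  have bl: "bounded_linear (\<lambda>f. blinfun_apply f v)"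
    by (rule blinfun.bounded_linear_left)
  interpret T: bounded_linear "\<lambda>f. blinfun_apply f v" by (rule bl)
  obtain s where s: "\<forall>i::nat. Bochner_Integration.simple_bochner_integrable M (s i)"
    and f_s: "(\<lambda>i. \<integral>\<^sup>+x. ennreal (norm (f x - s i x)) \<partial>M) \<longlonglongrightarrow> 0"
    and I_s: "(\<lambda>i. Bochner_Integration.simple_bochner_integral M (s i)) \<longlonglongrightarrow> I"
    and f: "f \<in> borel_measurable M"
    using assms(1) unfolding has_strong_integral_def by blast
  have m: "(\<lambda>x. norm (f x - s i x)) \<in> borel_measurable M" for i
    using f s by (auto intro!: measurable_diff_simple
        elim: Bochner_Integration.simple_bochner_integrable.cases)
  show ?thesis
  proof (rule has_bochner_integral.intros)
    show "(\<lambda>x. blinfun_apply (f x) v) \<in> borel_measurable M"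
      by (rule measurable_compose[OF f]) (intro borel_measurable_continuous_onI T.continuous_on continuous_on_id)
    show "Bochner_Integration.simple_bochner_integrable M (\<lambda>x. blinfun_apply (s i x) v)" for i
      using s by (auto intro: Bochner_Integration.simple_bochner_integrable_compose2[where p="\<lambda>x y. blinfun_apply x v"])
    have le: "(\<integral>\<^sup>+x. ennreal (norm (blinfun_apply (f x) v - blinfun_apply (s i x) v)) \<partial>M)
        \<le> ennreal (norm v) * (\<integral>\<^sup>+x. ennreal (norm (f x - s i x)) \<partial>M)" for i
    proof -
      have "(\<integral>\<^sup>+x. ennreal (norm (blinfun_apply (f x) v - blinfun_apply (s i x) v)) \<partial>M)
          \<le> (\<integral>\<^sup>+x. ennreal (norm v) * ennreal (norm (f x - s i x)) \<partial>M)"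
      proof (intro nn_integral_mono)
        fix x
        have "norm (blinfun_apply (f x - s i x) v) \<le> norm v * norm (f x - s i x)"
          by (subst mult.commute) (rule norm_blinfun)
        then show "ennreal (norm (blinfun_apply (f x) v - blinfun_apply (s i x) v))
            \<le> ennreal (norm v) * ennreal (norm (f x - s i x))"
          by (simp add: blinfun.diff_left[symmetric] ennreal_mult[symmetric] ennreal_leI)
      qed
      then show ?thesis using m by (simp add: nn_integral_cmult)
    qed
    have "(\<lambda>i. ennreal (norm v) * (\<integral>\<^sup>+x. ennreal (norm (f x - s i x)) \<partial>M)) \<longlonglongrightarrow> 0"
      using ennreal_tendsto_cmult[OF _ f_s] by simp
    then show "(\<lambda>i. \<integral>\<^sup>+x. ennreal (norm (blinfun_apply (f x) v - blinfun_apply (s i x) v)) \<partial>M) \<longlonglongrightarrow> 0"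
      by (rule tendsto_sandwich[OF _ _ tendsto_const, rotated 2]) (use le in auto)
    show "(\<lambda>i. Bochner_Integration.simple_bochner_integral M (\<lambda>x. blinfun_apply (s i x) v)) \<longlonglongrightarrow> blinfun_apply I v"
      using s I_s by (auto intro!: T.tendsto
          simp: Bochner_Integration.simple_bochner_integral_linear[OF T.linear_axioms])
  qed
qed

section \<open>Derivatives of steps as approximate identities\<close>

lemma step_at_deriv_integral:
  assumes "d > 0" "a \<le> c" "c + d \<le> b"
  shows "has_bochner_integral (lebesgue_on {a<..<b}) (deriv (step_at c d)) 1"
proof -
  have cont: "continuous_on {a..b} (deriv (step_at c d))"
    by (intro smooth_real_continuous_on_deriv(2) smooth_closure_smooth step_at_smooth)
  have int: "integrable (lebesgue_on {a<..<b}) (deriv (step_at c d))"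
    by (rule integrable_lebesgue_on_subset[OF continuous_imp_integrable_real[OF cont]]) auto
  have "(deriv (step_at c d) has_integral (step_at c d b - step_at c d a)) {a..b}"
    using assms step_at_deriv by (intro fundamental_theorem_of_calculus)
      (auto simp: has_real_derivative_iff_has_vector_derivative[symmetric] has_field_derivative_at_within)
  then have "integral {a..b} (deriv (step_at c d)) = 1"
    using assms by (simp add: step_at_0 step_at_1 integral_unique)
  then have "integral\<^sup>L (lebesgue_on {a<..<b}) (deriv (step_at c d)) = 1"
    using lebesgue_integral_eq_integral[OF int] by (simp add: integral_open_interval_real)
  with int show ?thesis by (simp add: has_bochner_integral_iff)
qed

text \<open>The kernel has mass one, so \<open>G\<close> can be moved under the integral; what
  remains is at most \<open>C / d * e\<close> on an interval of length \<open>d\<close>. The bound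
  is \<open>C * e\<close> and not \<open>e\<close> because only the size of the kernel is used and
  not its sign.\<close>

lemma step_at_deriv_approx:
  fixes g :: "real \<Rightarrow> 'b::{banach, second_countable_topology}"
  assumes C: "\<And>d c r. d > 0 \<Longrightarrow> \<bar>deriv (step_at c d) r\<bar> \<le> C / d"
    and d: "d > 0" "a \<le> c" "c + d \<le> b"
    and g: "g \<in> borel_measurable (lebesgue_on {a<..<b})"
    and e: "\<And>r. r \<in> {c..c+d} \<Longrightarrow> norm (g r - G) \<le> e"
  shows "integrable (lebesgue_on {a<..<b}) (\<lambda>r. deriv (step_at c d) r *\<^sub>R g r)"
    and "norm (integral\<^sup>L (lebesgue_on {a<..<b}) (\<lambda>r. deriv (step_at c d) r *\<^sub>R g r) - G) \<le> C * e"
proof -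
  let ?M = "lebesgue_on {a<..<b}" and ?D = "deriv (step_at c d)"
  have bd: "has_bochner_integral ?M ?D 1"
    by (rule step_at_deriv_integral[OF d])
  then have D: "integrable ?M ?D" "integral\<^sup>L ?M ?D = 1"
    by (simp_all add: has_bochner_integral_iff)
  have e0: "e \<ge> 0" using order_trans[OF norm_ge_zero e[of c]] d by simp
  have C0: "C \<ge> 0" using order_trans[OF abs_ge_zero C[of 1 0 0]] by simp
  have le: "norm (?D r *\<^sub>R (g r - G)) \<le> C / d * e * indicator {c..c+d} r" for r
  proof (cases "r \<in> {c..c+d}")
    case True
    have "\<bar>?D r\<bar> * norm (g r - G) \<le> C / d * e"
      using C0 d(1) by (intro mult_mono C e True) auto
    then show ?thesis using True by simp
  next
    case False
    then show ?thesis using step_at_deriv_outside[OF d(1), of r c] by auto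
  qed
  have meas: "(\<lambda>r. ?D r *\<^sub>R (g r - G)) \<in> borel_measurable ?M"
    by (intro borel_measurable_scaleR borel_measurable_diff borel_measurable_const
        borel_measurable_integrable[OF D(1)] g)
  have iind: "integrable ?M (\<lambda>r. C / d * e * indicator {c..c+d} r)"
    and ind: "integral\<^sup>L ?M (\<lambda>r. indicator {c..c+d} r) \<le> d"
  proof -
    have 1: "integrable lebesgue (indicator {c..c+d} :: real \<Rightarrow> real)"
      using d by (simp add: integrable_indicator_iff emeasure_lborel_Icc_eq)
    have 2: "integrable ?M (indicator {c..c+d} :: real \<Rightarrow> real)"
      using integrable_lebesgue_on_subset[of UNIV _ "{a<..<b}"] 1 by (simp add: lebesgue_on_UNIV_eq)
    then show "integrable ?M (\<lambda>r. C / d * e * indicator {c..c+d} r)" by simp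
    have "integral\<^sup>L ?M (indicator {c..c+d} :: real \<Rightarrow> real) \<le> integral\<^sup>L (lebesgue_on UNIV) (indicator {c..c+d})"
      using 1 by (intro integral_mono_lebesgue_on_AE) (auto simp: lebesgue_on_UNIV_eq)
    also have "\<dots> = d" using d by (simp add: lebesgue_on_UNIV_eq)
    finally show "integral\<^sup>L ?M (\<lambda>r. indicator {c..c+d} r :: real) \<le> d" .
  qed
  have i1: "integrable ?M (\<lambda>r. ?D r *\<^sub>R (g r - G))"
    by (rule Bochner_Integration.integrable_bound[OF iind meas], rule AE_I2)
      (rule order_trans[OF le], simp only: real_norm_def abs_ge_self)
  have eq: "(\<lambda>r. ?D r *\<^sub>R g r) = (\<lambda>r. ?D r *\<^sub>R (g r - G) + ?D r *\<^sub>R G)"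
    by (simp add: algebra_simps)
  have i2: "integrable ?M (\<lambda>r. ?D r *\<^sub>R G)" using D by simp
  show "integrable ?M (\<lambda>r. ?D r *\<^sub>R g r)"
    unfolding eq by (rule Bochner_Integration.integrable_add[OF i1 i2])
  have "integral\<^sup>L ?M (\<lambda>r. ?D r *\<^sub>R g r) - G = integral\<^sup>L ?M (\<lambda>r. ?D r *\<^sub>R (g r - G))"
    unfolding eq using D by (simp add: Bochner_Integration.integral_add[OF i1 i2])
  also have "norm \<dots> \<le> integral\<^sup>L ?M (\<lambda>r. C / d * e * indicator {c..c+d} r)"
    by (rule Bochner_Integration.integral_norm_bound_integral[OF i1 iind]) (rule le)
  also have "\<dots> = C / d * e * integral\<^sup>L ?M (\<lambda>r. indicator {c..c+d} r)"
    by (rule Bochner_Integration.integral_mult_right_zero)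
  also have "\<dots> \<le> C / d * e * d"
    using ind C0 e0 d(1) by (intro mult_left_mono) auto
  finally show "norm (integral\<^sup>L ?M (\<lambda>r. ?D r *\<^sub>R g r) - G) \<le> C * e"
    using d(1) by simp
qed

text \<open>The position of the kernel varies along with its width. The joining argument needs this:
  there the kernels sit strictly on one side of the joint and approach it.\<close>

lemma step_at_deriv_tendsto:
  fixes g :: "real \<Rightarrow> 'b::{banach, second_countable_topology}"
  assumes d: "\<And>n. d n > 0" "\<And>n. a \<le> c n" "\<And>n. c n + d n \<le> b"
    and lim: "d \<longlonglongrightarrow> 0" "c \<longlonglongrightarrow> c0"
    and g: "g \<in> borel_measurable (lebesgue_on {a<..<b})" "isCont g c0"
  shows "(\<lambda>n. integral\<^sup>L (lebesgue_on {a<..<b}) (\<lambda>r. deriv (step_at (c n) (d n)) r *\<^sub>R g r)) \<longlonglongrightarrow> g c0"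
proof -
  obtain C where C: "C \<ge> 1" "\<And>d c r. d > 0 \<Longrightarrow> \<bar>deriv (step_at c d) r\<bar> \<le> C / d"
    using step_at_deriv_bound by metis

  show "(\<lambda>n. integral\<^sup>L (lebesgue_on {a<..<b}) (\<lambda>r. deriv (step_at (c n) (d n)) r *\<^sub>R g r)) \<longlonglongrightarrow> g c0"
  proof (rule LIMSEQ_I)
    fix e :: real assume "e > 0"
    define e' where "e' = e / (2 * C)"
    have e': "e' > 0" "C * e' < e" using \<open>e > 0\<close> C(1) by (auto simp: e'_def field_simps)
    obtain \<delta> where \<delta>: "\<delta> > 0" "\<And>r. \<bar>r - c0\<bar> < \<delta> \<Longrightarrow> norm (g r - g c0) < e'"
      using g(2) e'(1) unfolding continuous_at_eps_delta dist_norm real_norm_def by blast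
    have "\<forall>\<^sub>F n in sequentially. \<bar>c n - c0\<bar> < \<delta> / 2"
      using tendstoD[OF lim(2), of "\<delta> / 2"] \<delta>(1) by (simp add: dist_real_def)
    moreover have "\<forall>\<^sub>F n in sequentially. \<bar>d n\<bar> < \<delta> / 2"
      using tendstoD[OF lim(1), of "\<delta> / 2"] \<delta>(1) by (simp add: dist_real_def)
    ultimately have "\<forall>\<^sub>F n in sequentially. norm (integral\<^sup>L (lebesgue_on {a<..<b})
        (\<lambda>r. deriv (step_at (c n) (d n)) r *\<^sub>R g r) - g c0) < e"
    proof eventually_elim
      case (elim n)
      have near: "norm (g r - g c0) \<le> e'" if "r \<in> {c n..c n + d n}" for r
        using \<delta>(2)[of r] elim that by (intro less_imp_le) (auto simp: abs_if split: if_splits)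
      have "norm (integral\<^sup>L (lebesgue_on {a<..<b})
        (\<lambda>r. deriv (step_at (c n) (d n)) r *\<^sub>R g r) - g c0) \<le> C * e'"
        by (rule step_at_deriv_approx(2)[OF C(2) d(1) d(2) d(3) g(1) near])
      then show ?case using e'(2) by linarith
    qed
    then show "\<exists>no. \<forall>n\<ge>no. norm (integral\<^sup>L (lebesgue_on {a<..<b})
        (\<lambda>r. deriv (step_at (c n) (d n)) r *\<^sub>R g r) - g c0) < e"
      by (simp add: eventually_sequentially)
  qed
qed

section \<open>Weak derivatives and joining\<close>

lemma le_one_plus_powr:
  assumes "p \<ge> 1" "(x::real) \<ge> 0"
  shows "x \<le> 1 + x powr p"
proof (cases "x \<le> 1")
  case True
  then show ?thesis by (smt (verit) powr_ge_zero)
next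
  case False
  then have "x powr 1 \<le> x powr p" using assms by (intro powr_mono) auto
  then show ?thesis using False by simp
qed

lemma integrable_const_lebesgue_on:
  fixes c :: "'b::{banach, second_countable_topology}"
  shows "integrable (lebesgue_on {a<..<b::real}) (\<lambda>_. c)"
  by (rule finite_measure.integrable_const)
    (auto intro!: finite_measure_lebesgue_on)

lemma Lp_fun_integrable_norm:
  assumes "Lp_fun p {a<..<b} X" "p \<ge> 1"
  shows "integrable (lebesgue_on {a<..<b}) (\<lambda>t. norm (X t))"
proof (rule Bochner_Integration.integrable_bound)
  show "integrable (lebesgue_on {a<..<b}) (\<lambda>t. 1 + norm (X t) powr p)"
    using assms by (intro Bochner_Integration.integrable_add integrable_const_lebesgue_on) (auto simp: Lp_fun_def)
  show "(\<lambda>t. norm (X t)) \<in> borel_measurable (lebesgue_on {a<..<b})"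
    using assms(1) unfolding Lp_fun_def
    by (auto intro!: measurable_compose[of X _ borel norm] borel_measurable_continuous_onI continuous_intros)
  show "AE t in lebesgue_on {a<..<b}. norm (norm (X t)) \<le> norm (1 + norm (X t) powr p)"
    using le_one_plus_powr[OF assms(2)] by (intro AE_I2) (auto simp: add_nonneg_nonneg)
qed

lemma Lp_fun_integrable:
  fixes X :: "real \<Rightarrow> 'b::{banach, second_countable_topology}"
  assumes "Lp_fun p {a<..<b} X" "p \<ge> 1"
  shows "integrable (lebesgue_on {a<..<b}) X"
  using Lp_fun_integrable_norm[OF assms] assms(1)
  by (simp add: integrable_norm_iff Lp_fun_def)

lemma test_function_smooth:
  assumes "test_function a b \<phi>"
  shows "\<phi> \<in> smooth_closure" "continuous_on S \<phi>" "continuous_on S (deriv \<phi>)"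
    "(\<phi> has_real_derivative deriv \<phi> r) (at r)"
proof -
  have *: "smooth_real \<phi>" using assms by (simp add: test_function_def smooth_real_def)
  then show "\<phi> \<in> smooth_closure" by (rule smooth_closure.base)
  show "continuous_on S \<phi>" "continuous_on S (deriv \<phi>)"
    "(\<phi> has_real_derivative deriv \<phi> r) (at r)"
    using smooth_real_continuous_on_deriv[OF *] smooth_real_deriv(2)[OF *] by auto
qed

lemma test_functionI:
  assumes "\<phi> \<in> smooth_closure" "\<And>t. \<phi> t \<noteq> 0 \<Longrightarrow> t \<in> K" "closed K" "K \<subseteq> {a<..<b}"
  shows "test_function a b \<phi>"
proof -
  have "closure {t. \<phi> t \<noteq> 0} \<subseteq> K" using assms by (intro closure_minimal) auto
  then show ?thesis
    using smooth_closure_smooth[OF assms(1)] assms(4) by (auto simp: test_function_def smooth_real_def)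
qed

lemma test_function_zero:
  assumes "test_function a b \<phi>" "r \<notin> {a<..<b}"
  shows "\<phi> r = 0"
proof (rule ccontr)
  assume "\<phi> r \<noteq> 0"
  then have "r \<in> closure {t. \<phi> t \<noteq> 0}" by (intro closure_subset[THEN subsetD]) simp
  with assms show False unfolding test_function_def by blast
qed

lemma bounded_scaleR_integrable:
  fixes X :: "real \<Rightarrow> 'b::{banach, second_countable_topology}"
  assumes "continuous_on {a..b} w" "integrable (lebesgue_on {a<..<b}) X"
  shows "integrable (lebesgue_on {a<..<b}) (\<lambda>t. (w t :: real) *\<^sub>R X t)"
proof -
  obtain C where C: "\<And>t. t \<in> {a..b} \<Longrightarrow> norm (w t) \<le> C"
    using compact_imp_bounded[OF compact_continuous_image[OF assms(1) compact_Icc]]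
    unfolding bounded_iff by blast
  have m: "w \<in> borel_measurable (lebesgue_on {a<..<b})"
    using assms(1) by (intro continuous_imp_measurable_on_sets_lebesgue)
      (auto intro: continuous_on_subset)
  show ?thesis
  proof (rule Bochner_Integration.integrable_bound[where f="\<lambda>t. C *\<^sub>R X t"])
    show "integrable (lebesgue_on {a<..<b}) (\<lambda>t. C *\<^sub>R X t)"
      using assms(2) by simp
    show "(\<lambda>t. w t *\<^sub>R X t) \<in> borel_measurable (lebesgue_on {a<..<b})"
      using m assms(2) by measurable
    show "AE t in lebesgue_on {a<..<b}. norm (w t *\<^sub>R X t) \<le> norm (C *\<^sub>R X t)"
      using C by (intro AE_I2) (auto intro!: mult_right_mono order_trans[OF _ abs_ge_self])
  qed
qed

lemma continuous_on_measurable_open_interval: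
  fixes x :: "real \<Rightarrow> 'b::{banach, second_countable_topology}"
  assumes "continuous_on {a..b} x"
  shows "x \<in> borel_measurable (lebesgue_on {a<..<b})"
  using assms by (intro continuous_imp_measurable_on_sets_lebesgue)
    (auto intro: continuous_on_subset)

text \<open>The embedding is bounded, so it commutes with the integral, and the image of
  \<open>X t\<close> is \<open>x t\<close> almost everywhere. The formula for the generalized
  derivative can thus be written with the continuous path in H, which has values at individual
  times.\<close>

lemma Wpq_test_identity:
  fixes \<iota> :: "'v::{banach, second_countable_topology} \<Rightarrow>\<^sub>L 'h::{real_inner, banach, second_countable_topology}"
  assumes X: "integrable (lebesgue_on {a<..<b}) X"
    and x: "x \<in> borel_measurable (lebesgue_on {a<..<b})" "AE t in lebesgue_on {a<..<b}. x t = blinfun_apply \<iota> (X t)"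
    and w: "continuous_on {a..b} (w :: real \<Rightarrow> real)"
  shows "blinfun_apply \<iota> (integral\<^sup>L (lebesgue_on {a<..<b}) (\<lambda>t. w t *\<^sub>R X t))
      = integral\<^sup>L (lebesgue_on {a<..<b}) (\<lambda>t. (w t :: real) *\<^sub>R x t)"
    and "integrable (lebesgue_on {a<..<b}) (\<lambda>t. w t *\<^sub>R x t)"
proof -
  let ?M = "lebesgue_on {a<..<b}"
  have i: "integrable ?M (\<lambda>t. w t *\<^sub>R X t)" by (rule bounded_scaleR_integrable[OF w X])
  have m: "w \<in> borel_measurable ?M" by (rule continuous_on_measurable_open_interval[OF w])
  have iT: "integrable ?M (\<lambda>t. blinfun_apply \<iota> (w t *\<^sub>R X t))"
    by (rule integrable_bounded_linear[OF blinfun.bounded_linear_right i])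
  have ae: "AE t in ?M. blinfun_apply \<iota> (w t *\<^sub>R X t) = w t *\<^sub>R x t"
    using x(2) by eventually_elim (simp add: blinfun.scaleR_right)
  have mx: "(\<lambda>t. w t *\<^sub>R x t) \<in> borel_measurable ?M" using m x(1) by measurable
  have "blinfun_apply \<iota> (integral\<^sup>L ?M (\<lambda>t. w t *\<^sub>R X t)) = integral\<^sup>L ?M (\<lambda>t. blinfun_apply \<iota> (w t *\<^sub>R X t))"
    by (rule integral_bounded_linear[OF blinfun.bounded_linear_right i, symmetric])
  also have "\<dots> = integral\<^sup>L ?M (\<lambda>t. w t *\<^sub>R x t)"
    by (rule integral_cong_AE[OF borel_measurable_integrable[OF iT] mx ae])
  finally show "blinfun_apply \<iota> (integral\<^sup>L ?M (\<lambda>t. w t *\<^sub>R X t)) = integral\<^sup>L ?M (\<lambda>t. w t *\<^sub>R x t)" .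
  show "integrable ?M (\<lambda>t. w t *\<^sub>R x t)"
    using integrable_cong_AE[OF borel_measurable_integrable[OF iT] mx ae] iT by blast
qed

lemma to_dual_apply [simp]: "blinfun_apply (to_dual \<iota> y) v = inner y (blinfun_apply \<iota> v)"
  by (simp add: to_dual_def)

lemma to_dual_linear: "bounded_linear (to_dual \<iota>)"
  unfolding to_dual_def[abs_def]
  by (rule bounded_linear_compose[OF bounded_bilinear.bounded_linear_left[OF bounded_bilinear_blinfun_compose]
        bounded_linear_blinfun_inner_right])

lemma Lp_fun_apply_integrable:
  fixes X' :: "real \<Rightarrow> ('v::{banach, second_countable_topology} \<Rightarrow>\<^sub>L real)"
  assumes "Lp_fun q {a<..<b} X'" "q \<ge> 1"
  shows "integrable (lebesgue_on {a<..<b}) (\<lambda>t. blinfun_apply (X' t) v)"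
proof (rule Bochner_Integration.integrable_bound)
  show "integrable (lebesgue_on {a<..<b}) (\<lambda>t. norm (X' t) * norm v)"
    using Lp_fun_integrable_norm[OF assms] by simp
  show "(\<lambda>t. blinfun_apply (X' t) v) \<in> borel_measurable (lebesgue_on {a<..<b})"
    using assms(1) unfolding Lp_fun_def
    by (auto intro!: measurable_compose[of X' _ borel "\<lambda>f. blinfun_apply f v"]
        borel_measurable_continuous_onI continuous_intros)
  show "AE t in lebesgue_on {a<..<b}. norm (blinfun_apply (X' t) v) \<le> norm (norm (X' t) * norm v)"
    using norm_blinfun[of "X' _" v] by (intro AE_I2) auto
qed

text \<open>Test with smooth approximations of the indicator of the interval from \<open>s\<close>
  to \<open>t\<close> and evaluate at \<open>v\<close>. The derivatives of these test functions are
  kernels that concentrate at \<open>s\<close> and \<open>t\<close> and pick out the values of the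
  continuous path there, while the functions themselves converge boundedly to the indicator.\<close>

lemma Wpq_weak_identity:
  fixes \<iota> :: "'v::{banach, second_countable_topology} \<Rightarrow>\<^sub>L 'h::{real_inner, banach, second_countable_topology}"
  assumes W: "Wpq \<iota> p q a b X X'" and pq: "p \<ge> 1" "q \<ge> 1"
    and x: "continuous_on {a..b} x" "AE t in lebesgue_on {a<..<b}. x t = blinfun_apply \<iota> (X t)"
    and st: "a < s" "s < t" "t < b"
  shows "integral {s..t} (\<lambda>r. blinfun_apply (X' r) v) = inner (x t - x s) (blinfun_apply \<iota> v)"
proof -
  let ?M = "lebesgue_on {a<..<b}"
  define g where "g r = inner (x r) (blinfun_apply \<iota> v)" for r
  define k where "k r = blinfun_apply (X' r) v" for r
  \<comment> \<open>At most half the distance from \<open>t\<close> to \<open>b\<close>, so that the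
    descent of the cut-off between \<open>t\<close> and \<open>t + d n\<close> stays inside the open
    interval.\<close>
  define d where "d n = (b - t) / (2 * real (Suc n))" for n
  have d: "d n > 0" "t + d n < b" for n
  proof -
    show "d n > 0" using st by (simp add: d_def)
    have "d n \<le> (b - t) / 2" using st unfolding d_def by (intro divide_left_mono) auto
    then show "t + d n < b" using st by (simp add: field_simps)
  qed
  have dlim: "d \<longlonglongrightarrow> 0"
  proof -
    have eq: "d = (\<lambda>n. (b - t) / 2 * inverse (real (Suc n)))"
      by (rule ext) (simp only: d_def divide_inverse inverse_mult_distrib mult.assoc)
    have "(\<lambda>n. (b - t) / 2 * inverse (real (Suc n))) \<longlonglongrightarrow> (b - t) / 2 * 0"
      by (intro tendsto_mult tendsto_const LIMSEQ_inverse_real_of_nat)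
    then show ?thesis unfolding eq by (simp only: mult_zero_right)
  qed
  define \<phi> where "\<phi> n r = step_at s (d n) r + (-1) * step_at t (d n) r" for n r
  have sm: "\<phi> n \<in> smooth_closure" for n
    unfolding \<phi>_def[abs_def]
    by (rule smooth_closure.add[OF step_at_smooth smooth_closure.mult[OF smooth_closure.const step_at_smooth]])
  have test: "test_function a b (\<phi> n)" for n
  proof (rule test_functionI[OF sm])
    show "r \<in> {s..t + d n}" if "\<phi> n r \<noteq> 0" for r
    proof (rule ccontr)
      assume "r \<notin> {s..t + d n}"
      then consider "r \<le> s" | "r \<ge> t + d n" by force
      then have "\<phi> n r = 0"
      proof cases
        case 1
        then show ?thesis using st step_at_0[OF d(1)] by (simp add: \<phi>_def)
      next
        case 2
        then show ?thesis using st step_at_1[OF d(1)] by (simp add: \<phi>_def)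
      qed
      with that show False by simp
    qed
    show "{s..t + d n} \<subseteq> {a<..<b}" using st d(2)[of n] by auto
  qed auto
  have Lp: "Lp_fun p {a<..<b} X" "Lp_fun q {a<..<b} X'" and gd: "generalized_derivative \<iota> a b X X'"
    using W by (auto simp: Wpq_def)
  have iX: "integrable ?M X" by (rule Lp_fun_integrable[OF Lp(1) pq(1)])
  have ik: "integrable ?M k" unfolding k_def by (rule Lp_fun_apply_integrable[OF Lp(2) pq(2)])
  have mx: "x \<in> borel_measurable ?M" by (rule continuous_on_measurable_open_interval[OF x(1)])
  have gc: "continuous_on {a..b} g" unfolding g_def by (intro continuous_intros x)
  have mg: "g \<in> borel_measurable ?M" by (rule continuous_on_measurable_open_interval[OF gc])
  have dphi: "deriv (\<phi> n) r = deriv (step_at s (d n)) r - deriv (step_at t (d n)) r" for n r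
    by (rule DERIV_imp_deriv, unfold \<phi>_def[abs_def])
      (auto intro!: derivative_eq_intros step_at_deriv)
  have eq: "integral\<^sup>L ?M (\<lambda>r. \<phi> n r * k r)
      = integral\<^sup>L ?M (\<lambda>r. deriv (step_at t (d n)) r *\<^sub>R g r) - integral\<^sup>L ?M (\<lambda>r. deriv (step_at s (d n)) r *\<^sub>R g r)" for n
  proof -
    have cd: "continuous_on {a..b} (deriv (step_at c (d n)))" for c
      by (intro smooth_real_continuous_on_deriv(2) smooth_closure_smooth step_at_smooth)
    have ig: "integrable ?M g"
      by (rule integrable_lebesgue_on_subset[OF continuous_imp_integrable_real[OF gc]]) auto
    have "has_bochner_integral ?M (\<lambda>r. blinfun_apply (\<phi> n r *\<^sub>R X' r) v)
        (blinfun_apply (- to_dual \<iota> (blinfun_apply \<iota> (integral\<^sup>L ?M (\<lambda>r. deriv (\<phi> n) r *\<^sub>R X r)))) v)"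
      using gd test[of n] unfolding generalized_derivative_def
      by (intro has_strong_integral_blinfun_apply) blast
    then have "integral\<^sup>L ?M (\<lambda>r. \<phi> n r * k r)
        = - inner (integral\<^sup>L ?M (\<lambda>r. deriv (\<phi> n) r *\<^sub>R x r)) (blinfun_apply \<iota> v)"
      using Wpq_test_identity(1)[OF iX mx x(2) test_function_smooth(3)[OF test[of n]]]
      by (simp add: has_bochner_integral_iff blinfun.minus_left blinfun.scaleR_left k_def)
    also have "\<dots> = - integral\<^sup>L ?M (\<lambda>r. inner (deriv (\<phi> n) r *\<^sub>R x r) (blinfun_apply \<iota> v))"
      by (subst integral_inner_left[OF Wpq_test_identity(2)[OF iX mx x(2) test_function_smooth(3)[OF test[of n]]]]) simp
    also have "\<dots> = - integral\<^sup>L ?M (\<lambda>r. deriv (step_at s (d n)) r *\<^sub>R g r - deriv (step_at t (d n)) r *\<^sub>R g r)"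
      by (simp add: dphi g_def left_diff_distrib)
    finally show ?thesis
      by (simp add: Bochner_Integration.integral_diff[OF bounded_scaleR_integrable[OF cd ig]
            bounded_scaleR_integrable[OF cd ig]] del: real_scaleR_def)
  qed
  have cont_g: "isCont g r" if "r \<in> {a<..<b}" for r
    using gc that continuous_on_interior[of "{a..b}" g r] by simp
  have "(\<lambda>n. integral\<^sup>L ?M (\<lambda>r. deriv (step_at t (d n)) r *\<^sub>R g r) - integral\<^sup>L ?M (\<lambda>r. deriv (step_at s (d n)) r *\<^sub>R g r))
      \<longlonglongrightarrow> g t - g s"
    using st d less_imp_le[OF d(2)] less_trans[OF add_strict_right_mono[OF st(2)] d(2)]
    by (intro tendsto_diff step_at_deriv_tendsto mg cont_g dlim tendsto_const) (auto intro: less_imp_le)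
  then have lim1: "(\<lambda>n. integral\<^sup>L ?M (\<lambda>r. \<phi> n r * k r)) \<longlonglongrightarrow> g t - g s"
    by (simp only: eq)
  have "(\<lambda>n. integral\<^sup>L ?M (\<lambda>r. \<phi> n r * k r)) \<longlonglongrightarrow> integral\<^sup>L ?M (\<lambda>r. indicator {s<..t} r * k r)"
  proof (rule integral_dominated_convergence[where w="\<lambda>r. norm (k r)"])
    show "integrable ?M (\<lambda>r. norm (k r))" using ik by simp
    show "(\<lambda>r. indicator {s<..t} r * k r) \<in> borel_measurable ?M"
    proof (intro borel_measurable_times borel_measurable_integrable[OF ik] borel_measurable_indicator)
      show "{s<..t} \<in> sets ?M" by (subst sets_restrict_space_iff) (use st in auto)
    qed
    show "(\<lambda>r. \<phi> n r * k r) \<in> borel_measurable ?M" for n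
      by (intro borel_measurable_times borel_measurable_integrable[OF ik]
          continuous_on_measurable_open_interval test_function_smooth(2)[OF test])
    show "AE r in ?M. norm (\<phi> n r * k r) \<le> norm (k r)" for n
    proof (rule AE_I2)
      fix r
      have "\<bar>\<phi> n r\<bar> \<le> 1"
        using step_at_bounds[of s "d n" r] step_at_bounds[of t "d n" r] unfolding \<phi>_def by (intro abs_leI) linarith+
      then show "norm (\<phi> n r * k r) \<le> norm (k r)"
        by (simp add: abs_mult mult_left_le_one_le)
    qed
    \<comment> \<open>Each step still vanishes at the left end of its transition. The limit is
      therefore 0 at \<open>s\<close> and 1 at \<open>t\<close>, which explains the half-open
      interval.\<close>
    have "(\<lambda>n. \<phi> n r) \<longlonglongrightarrow> indicator {s<..t} r" for r
    proof -
      have ev: "\<forall>\<^sub>F n in sequentially. step_at c (d n) r = (if r \<le> c then 0 else 1)" for c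
      proof (cases "r \<le> c")
        case True then show ?thesis using step_at_0[OF d(1)] by simp
      next
        case False
        have "\<forall>\<^sub>F n in sequentially. d n < r - c"
          using order_tendstoD(2)[OF dlim, of "r - c"] False by simp
        then show ?thesis
          by eventually_elim (use False step_at_1[OF d(1), of c _ r] in auto)
      qed
      have "\<forall>\<^sub>F n in sequentially. \<phi> n r = indicator {s<..t} r"
        using ev[of s] ev[of t] by eventually_elim (use st in \<open>auto simp: \<phi>_def split: split_indicator\<close>)
      then show ?thesis by (rule tendsto_eventually)
    qed
    then show "AE r in ?M. (\<lambda>n. \<phi> n r * k r) \<longlonglongrightarrow> indicator {s<..t} r * k r"
      by (intro AE_I2 tendsto_mult tendsto_const)
  qed
  then have "integral\<^sup>L ?M (\<lambda>r. indicator {s<..t} r * k r) = g t - g s"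
    using lim1 LIMSEQ_unique by blast
  moreover have "integral\<^sup>L ?M (\<lambda>r. indicator {s<..t} r * k r) = integral\<^sup>L (lebesgue_on {s<..t}) k"
  proof -
    have "(\<lambda>r. indicator {s<..t} r * k r) = (\<lambda>r. if r \<in> {s<..t} then k r else 0)"
      by (auto split: split_indicator)
    moreover have "{s<..t} \<subseteq> {a<..<b}" using st by auto
    ultimately show ?thesis
      using Lebesgue_Measure.integral_restrict[of "{s<..t}" "{a<..<b}" k] by simp
  qed
  moreover have "integral\<^sup>L (lebesgue_on {s<..t}) k = integral {s<..t} k"
    using st by (intro lebesgue_integral_eq_integral integrable_lebesgue_on_subset[OF ik]) auto
  moreover have "integral {s<..t} k = integral {s..t} k"
  proof (rule integral_spike_set)
    show "negligible {r \<in> {s<..t} - {s..t}. k r \<noteq> 0}"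
      by (rule negligible_subset[OF negligible_sing[of s]]) auto
    show "negligible {r \<in> {s..t} - {s<..t}. k r \<noteq> 0}"
      by (rule negligible_subset[OF negligible_sing[of s]]) auto
  qed
  ultimately have "integral {s..t} k = g t - g s" by simp
  then show ?thesis
    unfolding g_def k_def by (simp only: inner_diff_left)
qed

lemma AE_lebesgue_on_join:
  assumes "AE t in lebesgue_on {a<..<c}. P t" "AE t in lebesgue_on {c<..<b}. P t"
  shows "AE t in lebesgue_on {a<..<b::real}. P t"
proof -
  have "AE t in lebesgue. t \<in> {a<..<c} \<longrightarrow> P t" "AE t in lebesgue. t \<in> {c<..<b} \<longrightarrow> P t"
    using assms by (auto simp: AE_restrict_space_iff)
  moreover have "AE t in lebesgue. t \<noteq> c"
    by (intro AE_I'[of "{c}"]) auto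
  ultimately have "AE t in lebesgue. t \<in> {a<..<b} \<longrightarrow> P t"
    by eventually_elim auto
  then show ?thesis by (auto simp: AE_restrict_space_iff)
qed

lemma restrict_lebesgue_on:
  assumes "S \<in> sets lebesgue" "T \<in> sets lebesgue"
  shows "restrict_space (lebesgue_on S) T = lebesgue_on (S \<inter> T)"
  by (rule restrict_restrict_space) (use assms in auto)

lemma measurable_lebesgue_on_join:
  assumes "f \<in> borel_measurable (lebesgue_on {a<..<c})" "f \<in> borel_measurable (lebesgue_on {c<..<b})"
  shows "f \<in> borel_measurable (lebesgue_on {a<..<b::real})"
proof (rule measurable_piecewise_restrict[where C="{{a<..<c} \<inter> {a<..<b}, {c} \<inter> {a<..<b}, {c<..<b} \<inter> {a<..<b}}"])
  have *: "S \<in> sets lebesgue \<Longrightarrow> S \<inter> {a<..<b} \<inter> space (lebesgue_on {a<..<b}) \<in> sets (lebesgue_on {a<..<b})" for S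
    by (subst sets_restrict_space_iff) auto
  show "\<Omega> \<inter> space (lebesgue_on {a<..<b}) \<in> sets (lebesgue_on {a<..<b})"
    if "\<Omega> \<in> {{a<..<c} \<inter> {a<..<b}, {c} \<inter> {a<..<b}, {c<..<b} \<inter> {a<..<b}}" for \<Omega>
    using that *[of "{a<..<c}"] *[of "{c}"] *[of "{c<..<b}"] by auto
  have sub: "f \<in> borel_measurable (restrict_space (lebesgue_on {a<..<b}) (S \<inter> {a<..<b}))"
    if "f \<in> borel_measurable (lebesgue_on S)" "S \<in> sets lebesgue" for S
  proof -
    have "f \<in> borel_measurable (restrict_space (lebesgue_on S) {a<..<b})"
      by (rule measurable_restrict_space1[OF that(1)])
    moreover have "restrict_space (lebesgue_on S) {a<..<b} = restrict_space (lebesgue_on {a<..<b}) (S \<inter> {a<..<b})"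
      using that(2) by (subst (1 2) restrict_lebesgue_on) (auto intro: arg_cong[where f=lebesgue_on])
    ultimately show ?thesis by simp
  qed
  have pt: "f \<in> borel_measurable (lebesgue_on {c})"
    by (rule measurable_cong[where g="\<lambda>_. f c", THEN iffD2]) auto
  show "f \<in> borel_measurable (restrict_space (lebesgue_on {a<..<b}) \<Omega>)"
    if "\<Omega> \<in> {{a<..<c} \<inter> {a<..<b}, {c} \<inter> {a<..<b}, {c<..<b} \<inter> {a<..<b}}" for \<Omega>
    using that sub[OF assms(1)] sub[OF assms(2)] sub[OF pt] by auto
qed auto

lemma integrable_lebesgue_on_join:
  fixes f :: "real \<Rightarrow> 'b::{banach, second_countable_topology}"
  assumes "integrable (lebesgue_on {a<..<c}) f" "integrable (lebesgue_on {c<..<b}) f"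
  shows "integrable (lebesgue_on {a<..<b}) f"
proof -
  have "set_integrable lebesgue ({a<..<c} \<union> {c<..<b}) f"
    using assms by (intro set_integrable_Un) (auto simp: integrable_lebesgue_on_iff)
  then have "integrable lebesgue (\<lambda>x. indicator ({a<..<c} \<union> {c<..<b}) x *\<^sub>R f x)"
    by (simp add: set_integrable_def)
  then have "integrable lebesgue (\<lambda>x. indicator (({a<..<c} \<union> {c<..<b}) \<inter> {a<..<b}) x *\<^sub>R f x)"
    using integrable_mult_indicator[of "{a<..<b}" lebesgue] by (fastforce simp: indicator_inter_arith mult.commute)
  moreover have "integrable lebesgue (\<lambda>x. indicator (({a<..<c} \<union> {c<..<b}) \<inter> {a<..<b}) x *\<^sub>R f x)
      \<longleftrightarrow> integrable lebesgue (\<lambda>x. indicator {a<..<b} x *\<^sub>R f x)"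
    by (rule integrable_discrete_difference[where X="{c}"]) (auto split: split_indicator)
  ultimately show ?thesis by (simp add: integrable_lebesgue_on_iff set_integrable_def)
qed

lemma Lp_fun_join:
  assumes "Lp_fun p {a<..<c} f" "Lp_fun p {c<..<b} g"
  shows "Lp_fun p {a<..<b} (\<lambda>s. if s < c then f s else g s)"
proof -
  let ?h = "\<lambda>s. if s < c then f s else g s"
  have m: "?h \<in> borel_measurable (lebesgue_on {a<..<c})" "?h \<in> borel_measurable (lebesgue_on {c<..<b})"
    using assms measurable_cong[of "lebesgue_on {a<..<c}" ?h f borel] measurable_cong[of "lebesgue_on {c<..<b}" ?h g borel]
    unfolding Lp_fun_def by simp_all
  have i: "integrable (lebesgue_on {a<..<c}) (\<lambda>t. norm (?h t) powr p)"
    "integrable (lebesgue_on {c<..<b}) (\<lambda>t. norm (?h t) powr p)"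
    using assms Bochner_Integration.integrable_cong[of "lebesgue_on {a<..<c}" "lebesgue_on {a<..<c}" "\<lambda>t. norm (?h t) powr p" "\<lambda>t. norm (f t) powr p"]
      Bochner_Integration.integrable_cong[of "lebesgue_on {c<..<b}" "lebesgue_on {c<..<b}" "\<lambda>t. norm (?h t) powr p" "\<lambda>t. norm (g t) powr p"]
    unfolding Lp_fun_def by simp_all
  show ?thesis
    unfolding Lp_fun_def
    using measurable_lebesgue_on_join[OF m] integrable_lebesgue_on_join[OF i] by blast
qed

lemma integral_lebesgue_on_eq_superset:
  fixes f :: "real \<Rightarrow> 'b::{banach, second_countable_topology}"
  assumes "S \<subseteq> S'" "S \<in> sets lebesgue" "S' \<in> sets lebesgue" "\<And>r. r \<in> S' - S \<Longrightarrow> f r = 0"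
  shows "integral\<^sup>L (lebesgue_on S) f = integral\<^sup>L (lebesgue_on S') f"
proof -
  have eq: "(\<lambda>r. indicator S r *\<^sub>R f r) = (\<lambda>r. indicator S' r *\<^sub>R f r)"
  proof
    fix r
    show "indicator S r *\<^sub>R f r = indicator S' r *\<^sub>R f r"
      using assms(1) assms(4)[of r] by (cases "r \<in> S"; cases "r \<in> S'") auto
  qed
  have "integral\<^sup>L (lebesgue_on A) f = integral\<^sup>L lebesgue (\<lambda>r. indicator A r *\<^sub>R f r)"
    if "A \<in> sets lebesgue" for A
    using that by (intro integral_restrict_space) simp
  from this[OF assms(2)] this[OF assms(3)] show ?thesis
    unfolding eq by simp
qed

lemma Lp_fun_subset:
  assumes "Lp_fun p S f" "T \<subseteq> S" "S \<in> sets lebesgue" "T \<in> sets lebesgue"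
  shows "Lp_fun p T f"
proof -
  have "f \<in> borel_measurable (restrict_space (lebesgue_on S) T)"
    by (rule measurable_restrict_space1) (use assms(1) in \<open>simp add: Lp_fun_def\<close>)
  then have "f \<in> borel_measurable (lebesgue_on T)"
    using assms(2) by (simp add: restrict_lebesgue_on[OF assms(3,4)] Int_absorb1)
  moreover have "integrable (lebesgue_on T) (\<lambda>t. norm (f t) powr p)"
    by (rule integrable_lebesgue_on_subset[OF _ assms(2,3,4)]) (use assms(1) in \<open>simp add: Lp_fun_def\<close>)
  ultimately show ?thesis by (simp add: Lp_fun_def)
qed

lemma test_function_deriv_zero:
  assumes \<psi>: "test_function a b \<psi>" and r: "r \<notin> {a<..<b}"
  shows "deriv \<psi> r = 0"
proof -
  have "r \<in> - closure {t. \<psi> t \<noteq> 0}"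
    using r \<psi> unfolding test_function_def by blast
  then have "\<forall>\<^sub>F y in nhds r. y \<in> - closure {t. \<psi> t \<noteq> 0}"
    by (intro eventually_nhds_in_open) auto
  then have "\<forall>\<^sub>F y in nhds r. \<psi> y = 0"
    by eventually_elim (use closure_subset[of "{t. \<psi> t \<noteq> 0}"] in auto)
  then have "deriv \<psi> r = deriv (\<lambda>_. 0) r" by (rule deriv_cong_ev) simp
  then show ?thesis by simp
qed

text \<open>A test function of the smaller interval vanishes outside it together with its
  derivative. Both integrals can be extended by zero, and \<open>X'\<close> may be replaced by any
  function that agrees with it where the test function is nonzero. This transfers the identity of
  one piece to the whole interval.\<close>

lemma generalized_derivative_cut_test:
  fixes \<iota> :: "'v::{banach, second_countable_topology} \<Rightarrow>\<^sub>L 'h::{real_inner, banach, second_countable_topology}"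
  assumes W: "Wpq \<iota> p q a' b' X X'" and pq: "p \<ge> 1" "q \<ge> 1"
    and sub: "{a'<..<b'} \<subseteq> {a<..<b}"
    and x: "continuous_on {a'..b'} x" "AE t in lebesgue_on {a'<..<b'}. x t = blinfun_apply \<iota> (X t)"
    and \<psi>: "test_function a' b' \<psi>"
    and Y: "\<And>r. \<psi> r \<noteq> 0 \<Longrightarrow> Y r = X' r"
  shows "has_strong_integral (lebesgue_on {a<..<b}) (\<lambda>r. \<psi> r *\<^sub>R Y r)
      (- to_dual \<iota> (integral\<^sup>L (lebesgue_on {a<..<b}) (\<lambda>r. deriv \<psi> r *\<^sub>R x r)))"
proof -
  let ?N = "lebesgue_on {a'<..<b'}" and ?M = "lebesgue_on {a<..<b}"
  have N: "?N = restrict_space ?M {a'<..<b'}"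
    by (subst restrict_lebesgue_on) (simp_all only: lborelD_Collect Int_absorb1[OF sub], auto)
  have iX: "integrable ?N X" using W pq Lp_fun_integrable unfolding Wpq_def by blast
  have "has_strong_integral ?N (\<lambda>r. \<psi> r *\<^sub>R X' r)
      (- to_dual \<iota> (integral\<^sup>L ?N (\<lambda>r. deriv \<psi> r *\<^sub>R x r)))"
    using W \<psi> unfolding Wpq_def generalized_derivative_def
    by (simp flip: Wpq_test_identity(1)[OF iX continuous_on_measurable_open_interval[OF x(1)] x(2)
          test_function_smooth(3)[OF \<psi>]])
  then have "has_strong_integral ?M (\<lambda>r. indicator {a'<..<b'} r *\<^sub>R \<psi> r *\<^sub>R X' r)
      (- to_dual \<iota> (integral\<^sup>L ?N (\<lambda>r. deriv \<psi> r *\<^sub>R x r)))"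
    unfolding N using sub
    by (intro has_strong_integral_restrict_space) (auto simp: sets_restrict_space_iff)
  moreover have "(\<lambda>r. indicator {a'<..<b'} r *\<^sub>R \<psi> r *\<^sub>R X' r) = (\<lambda>r. \<psi> r *\<^sub>R Y r)"
  proof
    fix r
    show "indicator {a'<..<b'} r *\<^sub>R \<psi> r *\<^sub>R X' r = \<psi> r *\<^sub>R Y r"
      using test_function_zero[OF \<psi>, of r] Y[of r] by (cases "\<psi> r = 0"; cases "r \<in> {a'<..<b'}") auto
  qed
  moreover have "integral\<^sup>L ?N (\<lambda>r. deriv \<psi> r *\<^sub>R x r) = integral\<^sup>L ?M (\<lambda>r. deriv \<psi> r *\<^sub>R x r)"
  proof (rule integral_lebesgue_on_eq_superset[OF sub])
    fix r assume r: "r \<in> {a<..<b} - {a'<..<b'}"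
    have "deriv \<psi> r = 0" using r by (intro test_function_deriv_zero[OF \<psi>]) auto
    then show "deriv \<psi> r *\<^sub>R x r = 0" by simp
  qed auto
  ultimately show ?thesis by simp
qed

text \<open>A test function on the whole interval need not vanish at the joint \<open>c\<close>, so
  it is cut off on both sides of \<open>c\<close>, and each product is a test function for one
  piece. Differentiating the cut-offs produces two kernels, one on each side of \<open>c\<close>;
  both yield \<phi>(c) x(c) in the limit, with opposite signs, and cancel because \<open>x\<close>
  is continuous at \<open>c\<close>. The part of the test function lost near \<open>c\<close>
  disappears by dominated convergence.\<close>

lemma Wpq_join:
  fixes \<iota> :: "'v::{banach, second_countable_topology} \<Rightarrow>\<^sub>L 'h::{real_inner, banach, second_countable_topology}"
  assumes W1: "Wpq \<iota> p q a b X1 X1'" and W2: "Wpq \<iota> p q c b X2 X2'" and pq: "p \<ge> 1" "q \<ge> 1"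
    and abc: "a < c" "c < b"
    and x1: "continuous_on {a..b} x1" "AE t in lebesgue_on {a<..<b}. x1 t = blinfun_apply \<iota> (X1 t)"
    and x: "continuous_on {a..b} x" "\<And>t. t \<in> {a..c} \<Longrightarrow> x t = x1 t"
      "AE t in lebesgue_on {c<..<b}. x t = blinfun_apply \<iota> (X2 t)"
  shows "Wpq \<iota> p q a b (\<lambda>s. if s < c then X1 s else X2 s) (\<lambda>s. if s < c then X1' s else X2' s)"
proof -
  let ?M = "lebesgue_on {a<..<b}"
  define X where "X s = (if s < c then X1 s else X2 s)" for s
  define X' where "X' s = (if s < c then X1' s else X2' s)" for s
  have Lp: "Lp_fun p {a<..<b} X" "Lp_fun q {a<..<b} X'"
    using W1 W2 abc unfolding Wpq_def X_def[abs_def] X'_def[abs_def]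
    by (auto intro!: Lp_fun_join intro: Lp_fun_subset[of _ "{a<..<b}"])
  have aex: "AE t in ?M. x t = blinfun_apply \<iota> (X t)"
  proof (rule AE_lebesgue_on_join)
    show "AE t in lebesgue_on {a<..<c}. x t = blinfun_apply \<iota> (X t)"
    proof -
      have "AE t in lebesgue_on {a<..<c}. x1 t = blinfun_apply \<iota> (X1 t)"
        by (rule AE_lebesgue_on_subset[OF x1(2)]) (use abc in auto)
      then show ?thesis
        using AE_space by eventually_elim (auto simp: X_def x(2))
    qed
    show "AE t in lebesgue_on {c<..<b}. x t = blinfun_apply \<iota> (X t)"
      using x(3) AE_space by eventually_elim (auto simp: X_def)
  qed
  have mx: "x \<in> borel_measurable ?M" by (rule continuous_on_measurable_open_interval[OF x(1)])
  have mX': "X' \<in> borel_measurable ?M" using Lp(2) by (simp add: Lp_fun_def)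
  have iX: "integrable ?M X" by (rule Lp_fun_integrable[OF Lp(1) pq(1)])
  have ix: "integrable ?M x"
  proof -
    have "integrable ?M (\<lambda>t. blinfun_apply \<iota> (X t))"
      by (rule integrable_bounded_linear[OF blinfun.bounded_linear_right iX])
    then show ?thesis
      using integrable_cong_AE[OF mx borel_measurable_integrable aex] by blast
  qed
  have inX': "integrable ?M (\<lambda>t. norm (X' t))" by (rule Lp_fun_integrable_norm[OF Lp(2) pq(2)])
  have "generalized_derivative \<iota> a b X X'"
    unfolding generalized_derivative_def
  proof (intro allI impI)
    fix \<phi> assume test: "test_function a b \<phi>"
    \<comment> \<open>At most a quarter of the shorter side, so that the transitions from
      \<open>c - 2 * d n\<close> to \<open>c - d n\<close> and from \<open>c + d n\<close> to
      \<open>c + 2 * d n\<close> both fit.\<close>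
    define d where "d n = min (c - a) (b - c) / (4 * real (Suc n))" for n
    have d: "d n > 0" "a < c - 2 * d n" "c + 2 * d n < b" for n
    proof -
      have m0: "min (c - a) (b - c) > 0" using abc by simp
      then show "d n > 0" by (simp add: d_def)
      have "d n \<le> min (c - a) (b - c) / 4"
        using m0 unfolding d_def by (intro divide_left_mono) auto
      then show "a < c - 2 * d n" "c + 2 * d n < b" using abc by (auto simp: min_def split: if_splits)
    qed
    have dlim: "d \<longlonglongrightarrow> 0"
    proof -
      have eq: "d = (\<lambda>n. min (c - a) (b - c) / 4 * inverse (real (Suc n)))"
        by (rule ext) (simp only: d_def divide_inverse inverse_mult_distrib mult.assoc)
      have "(\<lambda>n. min (c - a) (b - c) / 4 * inverse (real (Suc n))) \<longlonglongrightarrow> min (c - a) (b - c) / 4 * 0"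
        by (intro tendsto_mult tendsto_const LIMSEQ_inverse_real_of_nat)
      then show ?thesis unfolding eq by (simp only: mult_zero_right)
    qed
    define S1 where "S1 n = step_at (c - 2 * d n) (d n)" for n
    define S2 where "S2 n = step_at (c + d n) (d n)" for n
    define \<phi>1 where "\<phi>1 n r = \<phi> r * (1 + (-1) * S1 n r)" for n r
    define \<phi>2 where "\<phi>2 n r = \<phi> r * S2 n r" for n r
    have Sb: "0 \<le> S1 n r" "S1 n r \<le> 1" "0 \<le> S2 n r" "S2 n r \<le> 1" for n r
      unfolding S1_def S2_def by (auto simp: step_at_bounds)
    have S1_1: "S1 n r = 1" if "r \<ge> c - d n" for n r
      unfolding S1_def using that by (intro step_at_1 d) simp
    have S2_0: "S2 n r = 0" if "r \<le> c + d n" for n r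
      unfolding S2_def using that by (intro step_at_0 d)
    have Sm: "S1 n \<in> smooth_closure" "S2 n \<in> smooth_closure" for n
      unfolding S1_def S2_def by (rule step_at_smooth)+
    have K: "closure {t. \<phi> t \<noteq> 0} \<subseteq> {a<..<b}" using test by (simp add: test_function_def)
    have inK: "r \<in> closure {t. \<phi> t \<noteq> 0}" if "\<phi> r \<noteq> 0" for r
      using that by (intro closure_subset[THEN subsetD]) simp
    have t1: "test_function a c (\<phi>1 n)" for n
    proof (rule test_functionI[where K="closure {t. \<phi> t \<noteq> 0} \<inter> {..c - d n}"])
      show "\<phi>1 n \<in> smooth_closure"
        unfolding \<phi>1_def[abs_def]
        by (rule smooth_closure.mult[OF test_function_smooth(1)[OF test] smooth_closure.add[OF smooth_closure.const
              smooth_closure.mult[OF smooth_closure.const Sm(1)]]])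
      show "r \<in> closure {t. \<phi> t \<noteq> 0} \<inter> {..c - d n}" if "\<phi>1 n r \<noteq> 0" for r
        using that S1_1[of n r] inK[of r] unfolding \<phi>1_def by (cases "r \<le> c - d n") auto
      show "closure {t. \<phi> t \<noteq> 0} \<inter> {..c - d n} \<subseteq> {a<..<c}"
        using K d(1)[of n] by force
    qed auto
    have t2: "test_function c b (\<phi>2 n)" for n
    proof (rule test_functionI[where K="closure {t. \<phi> t \<noteq> 0} \<inter> {c + d n..}"])
      show "\<phi>2 n \<in> smooth_closure"
        unfolding \<phi>2_def[abs_def]
        by (rule smooth_closure.mult[OF test_function_smooth(1)[OF test] Sm(2)])
      show "r \<in> closure {t. \<phi> t \<noteq> 0} \<inter> {c + d n..}" if "\<phi>2 n r \<noteq> 0" for r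
        using that S2_0[of r n] inK[of r] unfolding \<phi>2_def by (cases "r \<ge> c + d n") auto
      show "closure {t. \<phi> t \<noteq> 0} \<inter> {c + d n..} \<subseteq> {c<..<b}"
        using K d(1)[of n] by force
    qed auto
    have s1: "has_strong_integral ?M (\<lambda>r. \<phi>1 n r *\<^sub>R X' r)
        (- to_dual \<iota> (integral\<^sup>L ?M (\<lambda>r. deriv (\<phi>1 n) r *\<^sub>R x r)))" for n
    proof -
      have nz: "r < c" if "\<phi>1 n r \<noteq> 0" for r
        using test_function_zero[OF t1[of n], of r] that by force
      have t1': "test_function a b (\<phi>1 n)"
        using t1[of n] abc unfolding test_function_def by force
      have "has_strong_integral ?M (\<lambda>r. \<phi>1 n r *\<^sub>R X' r)
        (- to_dual \<iota> (integral\<^sup>L ?M (\<lambda>r. deriv (\<phi>1 n) r *\<^sub>R x1 r)))"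
        by (rule generalized_derivative_cut_test[OF W1 pq order_refl x1 t1']) (simp add: X'_def nz)
      moreover have "deriv (\<phi>1 n) r *\<^sub>R x1 r = deriv (\<phi>1 n) r *\<^sub>R x r" for r
        using test_function_deriv_zero[OF t1[of n], of r] x(2)[of r] by (cases "r \<in> {a<..<c}") auto
      ultimately show ?thesis by simp
    qed
    have s2: "has_strong_integral ?M (\<lambda>r. \<phi>2 n r *\<^sub>R X' r)
        (- to_dual \<iota> (integral\<^sup>L ?M (\<lambda>r. deriv (\<phi>2 n) r *\<^sub>R x r)))" for n
    proof -
      have nz: "c < r" if "\<phi>2 n r \<noteq> 0" for r
        using test_function_zero[OF t2[of n], of r] that by force
      show ?thesis
        using abc x(1) by (intro generalized_derivative_cut_test[OF W2 pq _ _ x(3) t2])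
          (auto simp: X'_def dest: nz intro: continuous_on_subset)
    qed
    define f where "f n r = \<phi>1 n r *\<^sub>R X' r + \<phi>2 n r *\<^sub>R X' r" for n r
    define J where "J n = - to_dual \<iota> (integral\<^sup>L ?M (\<lambda>r. deriv (\<phi>1 n) r *\<^sub>R x r))
        + - to_dual \<iota> (integral\<^sup>L ?M (\<lambda>r. deriv (\<phi>2 n) r *\<^sub>R x r))" for n
    define I where "I = - to_dual \<iota> (integral\<^sup>L ?M (\<lambda>r. deriv \<phi> r *\<^sub>R x r))"
    \<comment> \<open>The weight that the two cut-offs leave on the test function: it is 0 at
      distance at most \<open>d n\<close> from \<open>c\<close> and 1 at distance at least
      \<open>2 * d n\<close>.\<close>
    define \<rho> where "\<rho> n r = 1 - S1 n r + S2 n r" for n r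
    have feq: "f n r = (\<phi> r * \<rho> n r) *\<^sub>R X' r" for n r
    proof -
      have "\<phi>1 n r + \<phi>2 n r = \<phi> r * \<rho> n r"
        by (simp add: \<phi>1_def \<phi>2_def \<rho>_def algebra_simps)
      then show ?thesis unfolding f_def by (simp only: scaleR_left_distrib[symmetric])
    qed
    have mS: "S1 n \<in> borel_measurable ?M" "S2 n \<in> borel_measurable ?M" for n
      using Sm by (auto intro!: continuous_on_measurable_open_interval smooth_real_continuous_on_deriv(1) smooth_closure_smooth)
    have m\<rho>: "\<rho> n \<in> borel_measurable ?M" for n
      unfolding \<rho>_def[abs_def] using mS by measurable
    have m\<phi>: "\<phi> \<in> borel_measurable ?M" "deriv \<phi> \<in> borel_measurable ?M"
      by (auto intro!: continuous_on_measurable_open_interval test_function_smooth[OF test])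
    \<comment> \<open>The values lie in the dual, whose type carries no countable base, so
      measurability of a product with a scalar function is obtained by approximating the scalar by
      simple functions, that is, by finitely many fixed factors at a time.\<close>
    have mscale: "(\<lambda>r. w r *\<^sub>R X' r) \<in> borel_measurable ?M" if mw: "w \<in> borel_measurable ?M" for w :: "real \<Rightarrow> real"
    proof -
      obtain w' where w': "\<And>n. simple_function ?M (w' n)" "\<And>r. r \<in> space ?M \<Longrightarrow> (\<lambda>n. w' n r) \<longlonglongrightarrow> w r"
        using borel_measurable_implies_sequence_metric[OF mw, of 0] by metis
      show ?thesis
      proof (rule borel_measurable_LIMSEQ_metric[where f="\<lambda>n r. w' n r *\<^sub>R X' r"])
        show "(\<lambda>r. w' n r *\<^sub>R X' r) \<in> borel_measurable ?M" for n
        proof (rule measurable_compose_countable'[where f="\<lambda>i r. i *\<^sub>R X' r" and I="w' n ` space ?M"])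
          show "(\<lambda>r. i *\<^sub>R X' r) \<in> borel_measurable ?M" for i
            using mX' by (rule measurable_compose) (intro borel_measurable_continuous_onI continuous_intros)
          show "w' n \<in> ?M \<rightarrow>\<^sub>M count_space (w' n ` space ?M)"
            using w'(1)[of n] by (subst measurable_count_space_eq2) (auto simp: simple_function_def)
          show "countable (w' n ` space ?M)"
            using w'(1)[of n] by (simp add: simple_function_def countable_finite)
        qed
        show "(\<lambda>n. w' n r *\<^sub>R X' r) \<longlonglongrightarrow> w r *\<^sub>R X' r" if "r \<in> space ?M" for r
          using that by (intro tendsto_scaleR w'(2) tendsto_const)
      qed
    qed
    have mf: "f n \<in> borel_measurable ?M" for n
      unfolding feq[abs_def] by (intro mscale borel_measurable_times m\<rho> m\<phi>)
    have sf: "has_strong_integral ?M (f n) (J n)" for n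
      using has_strong_integral_add[OF s1[of n] s2[of n]] mf[of n] unfolding f_def[abs_def] J_def by blast
    have \<rho>b: "0 \<le> \<rho> n r" "\<rho> n r \<le> 1" for n r
    proof -
      have "S2 n r \<le> S1 n r"
        using S1_1[of n r] S2_0[of r n] Sb[of n r] d(1)[of n] by (cases "r \<le> c + d n") auto
      then show "0 \<le> \<rho> n r" "\<rho> n r \<le> 1" using Sb[of n r] by (auto simp: \<rho>_def)
    qed
    have \<rho>lim: "\<forall>\<^sub>F n in sequentially. \<rho> n r = 1" if "r \<noteq> c" for r
    proof -
      have "\<forall>\<^sub>F n in sequentially. d n < \<bar>r - c\<bar> / 2"
        using order_tendstoD(2)[OF dlim, of "\<bar>r - c\<bar> / 2"] that by simp
      then show ?thesis
      proof eventually_elim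
        case (elim n)
        show ?case
        proof (cases "r < c")
          case True
          with elim have elim: "r \<le> c - 2 * d n" by simp
          have "S1 n r = 0" unfolding S1_def using elim by (intro step_at_0 d) linarith
          moreover have "S2 n r = 0" using True d(1)[of n] by (intro S2_0) linarith
          ultimately show ?thesis by (simp add: \<rho>_def)
        next
          case False
          with elim have elim: "r \<ge> c + d n + d n" by simp
          have "S2 n r = 1" unfolding S2_def using elim by (intro step_at_1 d) linarith
          moreover have "S1 n r = 1" using False d(1)[of n] by (intro S1_1) linarith
          ultimately show ?thesis by (simp add: \<rho>_def)
        qed
      qed
    qed
    have aec: "AE r in ?M. r \<noteq> c"
    proof -
      have "AE r in lebesgue. r \<noteq> c" by (intro AE_I'[of "{c}"]) auto
      then show ?thesis by (simp add: AE_restrict_space_iff eventually_mono)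
    qed
    have i\<phi>X': "integrable ?M (\<lambda>r. \<bar>\<phi> r\<bar> * norm (X' r))"
      using bounded_scaleR_integrable[OF _ inX', of "\<lambda>r. \<bar>\<phi> r\<bar>"] test_function_smooth(2)[OF test, of "{a..b}"]
      by (simp add: continuous_on_rabs)
    have lim1: "(\<lambda>n. integral\<^sup>L ?M (\<lambda>r. norm (\<phi> r *\<^sub>R X' r - f n r))) \<longlonglongrightarrow> integral\<^sup>L ?M (\<lambda>r. 0)"
      and int1: "integrable ?M (\<lambda>r. norm (\<phi> r *\<^sub>R X' r - f n r))" for n
    proof -
      have eq: "norm (\<phi> r *\<^sub>R X' r - f n r) = (1 - \<rho> n r) * (\<bar>\<phi> r\<bar> * norm (X' r))" for n r
      proof -
        have "\<phi> r *\<^sub>R X' r - f n r = ((1 - \<rho> n r) * \<phi> r) *\<^sub>R X' r"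
          by (simp only: feq scaleR_left_diff_distrib[symmetric]) (simp add: algebra_simps)
        then show ?thesis using \<rho>b[of n r] by (simp add: abs_mult)
      qed
      have m: "(\<lambda>r. (1 - \<rho> n r) * (\<bar>\<phi> r\<bar> * norm (X' r))) \<in> borel_measurable ?M" for n
        using m\<rho>[of n] borel_measurable_integrable[OF i\<phi>X'] by measurable
      have le: "norm ((1 - \<rho> n r) * (\<bar>\<phi> r\<bar> * norm (X' r))) \<le> \<bar>\<phi> r\<bar> * norm (X' r)" for n r
        using \<rho>b[of n r] by (simp add: abs_mult mult_left_le_one_le)
      have ae: "AE r in ?M. (\<lambda>n. (1 - \<rho> n r) * (\<bar>\<phi> r\<bar> * norm (X' r))) \<longlonglongrightarrow> 0"
        using aec
      proof eventually_elim
        case (elim r)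
        have "\<forall>\<^sub>F n in sequentially. (1 - \<rho> n r) * (\<bar>\<phi> r\<bar> * norm (X' r)) = 0"
          using \<rho>lim[OF elim] by eventually_elim simp
        then show ?case by (rule tendsto_eventually)
      qed
      show "(\<lambda>n. integral\<^sup>L ?M (\<lambda>r. norm (\<phi> r *\<^sub>R X' r - f n r))) \<longlonglongrightarrow> integral\<^sup>L ?M (\<lambda>r. 0)"
        unfolding eq
        by (rule integral_dominated_convergence[OF borel_measurable_const m i\<phi>X' ae]) (rule AE_I2, rule le)
      show "integrable ?M (\<lambda>r. norm (\<phi> r *\<^sub>R X' r - f n r))"
        unfolding eq by (rule Bochner_Integration.integrable_bound[OF i\<phi>X' m])
          (intro AE_I2 order_trans[OF le], simp)
    qed
    have lim2: "J \<longlonglongrightarrow> I"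
    proof -
      have isC: "isCont (\<lambda>r. \<phi> r *\<^sub>R x r) c"
        using continuous_on_interior[of "{a..b}" "\<lambda>r. \<phi> r *\<^sub>R x r" c] abc x(1)
          test_function_smooth(2)[OF test, of "{a..b}"] by (simp add: continuous_intros)
      have m\<phi>x: "(\<lambda>r. \<phi> r *\<^sub>R x r) \<in> borel_measurable ?M" using m\<phi>(1) mx by measurable
      have i\<phi>x: "integrable ?M (\<lambda>r. \<phi> r *\<^sub>R x r)"
        by (rule bounded_scaleR_integrable[OF test_function_smooth(2)[OF test] ix])
      have i\<phi>'x: "integrable ?M (\<lambda>r. deriv \<phi> r *\<^sub>R x r)"
        by (rule bounded_scaleR_integrable[OF test_function_smooth(3)[OF test] ix])
      have cD: "continuous_on {a..b} (deriv (S1 n))" "continuous_on {a..b} (deriv (S2 n))"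
        "continuous_on {a..b} (S1 n)" "continuous_on {a..b} (S2 n)" for n
        using smooth_real_continuous_on_deriv smooth_closure_smooth Sm by blast+
      have iD: "integrable ?M (\<lambda>r. deriv (S1 n) r *\<^sub>R \<phi> r *\<^sub>R x r)" "integrable ?M (\<lambda>r. deriv (S2 n) r *\<^sub>R \<phi> r *\<^sub>R x r)" for n
        by (rule bounded_scaleR_integrable[OF cD(1) i\<phi>x], rule bounded_scaleR_integrable[OF cD(2) i\<phi>x])
      have ir: "integrable ?M (\<lambda>r. (1 - S1 n r) *\<^sub>R deriv \<phi> r *\<^sub>R x r)" "integrable ?M (\<lambda>r. S2 n r *\<^sub>R deriv \<phi> r *\<^sub>R x r)" for n
        by (rule bounded_scaleR_integrable[OF _ i\<phi>'x], intro continuous_intros cD)+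
      have dS: "(S1 n has_real_derivative deriv (S1 n) r) (at r)" "(S2 n has_real_derivative deriv (S2 n) r) (at r)" for n r
        unfolding S1_def S2_def by (rule step_at_deriv)+
      have d\<phi>: "deriv (\<phi>1 n) r = deriv \<phi> r * (1 - S1 n r) - \<phi> r * deriv (S1 n) r"
        "deriv (\<phi>2 n) r = deriv \<phi> r * S2 n r + \<phi> r * deriv (S2 n) r" for n r
        unfolding \<phi>1_def[abs_def] \<phi>2_def[abs_def]
        by (rule DERIV_imp_deriv, auto intro!: derivative_eq_intros dS test_function_smooth(4)[OF test])+
      have J1: "integral\<^sup>L ?M (\<lambda>r. deriv (\<phi>1 n) r *\<^sub>R x r) = integral\<^sup>L ?M (\<lambda>r. (1 - S1 n r) *\<^sub>R deriv \<phi> r *\<^sub>R x r)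
          - integral\<^sup>L ?M (\<lambda>r. deriv (S1 n) r *\<^sub>R \<phi> r *\<^sub>R x r)" for n
        by (subst Bochner_Integration.integral_diff[OF ir(1) iD(1), symmetric])
          (intro Bochner_Integration.integral_cong refl, simp add: d\<phi> algebra_simps)
      have J2: "integral\<^sup>L ?M (\<lambda>r. deriv (\<phi>2 n) r *\<^sub>R x r) = integral\<^sup>L ?M (\<lambda>r. S2 n r *\<^sub>R deriv \<phi> r *\<^sub>R x r)
          + integral\<^sup>L ?M (\<lambda>r. deriv (S2 n) r *\<^sub>R \<phi> r *\<^sub>R x r)" for n
        by (subst Bochner_Integration.integral_add[OF ir(2) iD(2), symmetric])
          (intro Bochner_Integration.integral_cong refl, simp add: d\<phi> algebra_simps)
      have J3: "integral\<^sup>L ?M (\<lambda>r. (1 - S1 n r) *\<^sub>R deriv \<phi> r *\<^sub>R x r) + integral\<^sup>L ?M (\<lambda>r. S2 n r *\<^sub>R deriv \<phi> r *\<^sub>R x r)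
          = integral\<^sup>L ?M (\<lambda>r. \<rho> n r *\<^sub>R deriv \<phi> r *\<^sub>R x r)" for n
        by (subst Bochner_Integration.integral_add[OF ir, symmetric])
          (intro Bochner_Integration.integral_cong refl, simp add: \<rho>_def algebra_simps)
      have L1: "(\<lambda>n. integral\<^sup>L ?M (\<lambda>r. deriv (S1 n) r *\<^sub>R \<phi> r *\<^sub>R x r)) \<longlonglongrightarrow> \<phi> c *\<^sub>R x c"
        unfolding S1_def
      proof (rule step_at_deriv_tendsto[OF d(1) _ _ dlim _ m\<phi>x isC])
        show "a \<le> c - 2 * d n" "c - 2 * d n + d n \<le> b" for n using d[of n] by auto
        show "(\<lambda>n. c - 2 * d n) \<longlonglongrightarrow> c" using tendsto_diff[OF tendsto_const tendsto_mult[OF tendsto_const dlim]] by simp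
      qed
      have L2: "(\<lambda>n. integral\<^sup>L ?M (\<lambda>r. deriv (S2 n) r *\<^sub>R \<phi> r *\<^sub>R x r)) \<longlonglongrightarrow> \<phi> c *\<^sub>R x c"
        unfolding S2_def
      proof (rule step_at_deriv_tendsto[OF d(1) _ _ dlim _ m\<phi>x isC])
        show "a \<le> c + d n" "c + d n + d n \<le> b" for n using d[of n] by auto
        show "(\<lambda>n. c + d n) \<longlonglongrightarrow> c" using tendsto_add[OF tendsto_const dlim, of c] by simp
      qed
      have L3: "(\<lambda>n. integral\<^sup>L ?M (\<lambda>r. \<rho> n r *\<^sub>R deriv \<phi> r *\<^sub>R x r)) \<longlonglongrightarrow> integral\<^sup>L ?M (\<lambda>r. deriv \<phi> r *\<^sub>R x r)"
      proof (rule integral_dominated_convergence[OF borel_measurable_integrable[OF i\<phi>'x] _ integrable_norm[OF i\<phi>'x]])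
        show "(\<lambda>r. \<rho> n r *\<^sub>R deriv \<phi> r *\<^sub>R x r) \<in> borel_measurable ?M" for n
          by (intro borel_measurable_scaleR m\<rho> m\<phi> mx)
        show "AE r in ?M. (\<lambda>n. \<rho> n r *\<^sub>R deriv \<phi> r *\<^sub>R x r) \<longlonglongrightarrow> deriv \<phi> r *\<^sub>R x r"
          using aec
        proof eventually_elim
          case (elim r)
          have "\<forall>\<^sub>F n in sequentially. \<rho> n r *\<^sub>R deriv \<phi> r *\<^sub>R x r = deriv \<phi> r *\<^sub>R x r"
            using \<rho>lim[OF elim] by eventually_elim simp
          then show ?case by (rule tendsto_eventually)
        qed
        show "AE r in ?M. norm (\<rho> n r *\<^sub>R deriv \<phi> r *\<^sub>R x r) \<le> norm (deriv \<phi> r *\<^sub>R x r)" for n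
        proof (rule AE_I2)
          fix r
          show "norm (\<rho> n r *\<^sub>R deriv \<phi> r *\<^sub>R x r) \<le> norm (deriv \<phi> r *\<^sub>R x r)"
            unfolding norm_scaleR[of "\<rho> n r"] using \<rho>b[of n r] by (intro mult_left_le_one_le) auto
        qed
      qed
      have Jeq: "J n = - to_dual \<iota> (integral\<^sup>L ?M (\<lambda>r. \<rho> n r *\<^sub>R deriv \<phi> r *\<^sub>R x r)
          - integral\<^sup>L ?M (\<lambda>r. deriv (S1 n) r *\<^sub>R \<phi> r *\<^sub>R x r) + integral\<^sup>L ?M (\<lambda>r. deriv (S2 n) r *\<^sub>R \<phi> r *\<^sub>R x r))" for n
      proof -
        interpret D: bounded_linear "to_dual \<iota>" by (rule to_dual_linear)
        show ?thesis unfolding J_def J1 J2 J3[symmetric] by (simp add: D.add D.diff)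
      qed
      have "(\<lambda>n. - to_dual \<iota> (integral\<^sup>L ?M (\<lambda>r. \<rho> n r *\<^sub>R deriv \<phi> r *\<^sub>R x r)
          - integral\<^sup>L ?M (\<lambda>r. deriv (S1 n) r *\<^sub>R \<phi> r *\<^sub>R x r) + integral\<^sup>L ?M (\<lambda>r. deriv (S2 n) r *\<^sub>R \<phi> r *\<^sub>R x r)))
          \<longlonglongrightarrow> - to_dual \<iota> (integral\<^sup>L ?M (\<lambda>r. deriv \<phi> r *\<^sub>R x r) - \<phi> c *\<^sub>R x c + \<phi> c *\<^sub>R x c)"
        by (intro tendsto_minus bounded_linear.tendsto[OF to_dual_linear] tendsto_add tendsto_diff L1 L2 L3)
      then show ?thesis unfolding Jeq[abs_def] I_def by simp
    qed
    have "has_strong_integral ?M (\<lambda>r. \<phi> r *\<^sub>R X' r) I"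
    proof (rule has_strong_integral_limit)
      show "(\<lambda>r. \<phi> r *\<^sub>R X' r) \<in> borel_measurable ?M" by (rule mscale[OF m\<phi>(1)])
      fix e :: real assume "e > 0"
      have "\<forall>\<^sub>F n in sequentially. integral\<^sup>L ?M (\<lambda>r. norm (\<phi> r *\<^sub>R X' r - f n r)) < e"
        using order_tendstoD(2)[OF lim1, of e] \<open>e > 0\<close> by simp
      moreover have "\<forall>\<^sub>F n in sequentially. norm (J n - I) < e"
        using tendstoD[OF lim2 \<open>e > 0\<close>] by (simp add: dist_norm)
      ultimately have "\<forall>\<^sub>F n in sequentially. integral\<^sup>L ?M (\<lambda>r. norm (\<phi> r *\<^sub>R X' r - f n r)) < e \<and> norm (J n - I) < e"
        by eventually_elim simp
      then obtain n where n: "integral\<^sup>L ?M (\<lambda>r. norm (\<phi> r *\<^sub>R X' r - f n r)) < e" "norm (J n - I) < e"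
        using eventually_happens'[OF sequentially_bot] by blast
      have "(\<integral>\<^sup>+r. ennreal (norm (\<phi> r *\<^sub>R X' r - f n r)) \<partial>?M) = ennreal (integral\<^sup>L ?M (\<lambda>r. norm (\<phi> r *\<^sub>R X' r - f n r)))"
        by (rule nn_integral_eq_integral[OF int1]) simp
      then have "(\<integral>\<^sup>+r. ennreal (norm (\<phi> r *\<^sub>R X' r - f n r)) \<partial>?M) \<le> ennreal e"
        using n(1) by (simp add: ennreal_leI)
      then show "\<exists>g J. has_strong_integral ?M g J \<and> (\<lambda>r. norm (\<phi> r *\<^sub>R X' r - g r)) \<in> borel_measurable ?M \<and>
          (\<integral>\<^sup>+r. ennreal (norm (\<phi> r *\<^sub>R X' r - g r)) \<partial>?M) \<le> ennreal e \<and> norm (J - I) \<le> e"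
        using sf[of n] n(2) borel_measurable_integrable[OF int1[of n]] by (intro exI[of _ "f n"] exI[of _ "J n"]) auto
    qed
    then show "has_strong_integral ?M (\<lambda>t. \<phi> t *\<^sub>R X' t)
        (- to_dual \<iota> (blinfun_apply \<iota> (integral\<^sup>L ?M (\<lambda>t. deriv \<phi> t *\<^sub>R X t))))"
      unfolding I_def Wpq_test_identity(1)[OF iX mx aex test_function_smooth(3)[OF test]] .
  qed
  with Lp show ?thesis unfolding Wpq_def X_def[abs_def] X'_def[abs_def] by blast
qed

section \<open>The energy inequality\<close>

lemma sigma_finite_lebesgue: "sigma_finite_measure (lebesgue :: real measure)"
proof -
  obtain A :: "real set set" where A: "countable A" "A \<subseteq> sets lborel" "\<Union>A = space lborel" "\<forall>a\<in>A. emeasure lborel a \<noteq> \<infinity>"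
    using lborel.sigma_finite_countable by blast
  show ?thesis
    by (rule sigma_finite_measure.intro, intro exI[of _ A] conjI)
      (use A in \<open>auto simp: subset_iff\<close>)
qed

lemma pair_sigma_finite_lebesgue: "pair_sigma_finite (lebesgue :: real measure) (lebesgue :: real measure)"
  using sigma_finite_lebesgue by (simp add: pair_sigma_finite_def)

lemma borel_measurable_lebesgue_ident [measurable]: "(\<lambda>x. x) \<in> borel_measurable lebesgue"
  by (rule measurable_completion) simp

lemma strip_measurable:
  "{z \<in> space (lebesgue \<Otimes>\<^sub>M lebesgue). fst z - h < snd z \<and> snd z < (fst z :: real)} \<in> sets (lebesgue \<Otimes>\<^sub>M lebesgue)"
proof -
  have [measurable]: "fst \<in> borel_measurable (lebesgue \<Otimes>\<^sub>M (lebesgue :: real measure))"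
    "snd \<in> borel_measurable ((lebesgue :: real measure) \<Otimes>\<^sub>M lebesgue)"
    using measurable_compose[OF measurable_fst borel_measurable_lebesgue_ident]
      measurable_compose[OF measurable_snd borel_measurable_lebesgue_ident] by simp_all
  show ?thesis by measurable
qed

lemma strip_indicator_measurable:
  "(\<lambda>(t, \<rho>). indicator {t - h<..<t} \<rho> :: ennreal) \<in> borel_measurable (lebesgue \<Otimes>\<^sub>M (lebesgue :: real measure))"
proof -
  have "(\<lambda>(t, \<rho>). indicator {t - h<..<t} \<rho> :: ennreal)
      = indicator {z \<in> space (lebesgue \<Otimes>\<^sub>M lebesgue). fst z - h < snd z \<and> snd z < (fst z :: real)}"
    by (auto simp: fun_eq_iff space_pair_measure split: split_indicator)
  then show ?thesis using strip_measurable by (simp add: borel_measurable_indicator)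
qed

lemma strip_integral_measurable:
  fixes f :: "real \<Rightarrow> real \<Rightarrow> ennreal"
  assumes "(\<lambda>(t, \<rho>). f t \<rho>) \<in> borel_measurable (lebesgue \<Otimes>\<^sub>M lebesgue)"
  shows "(\<lambda>t. \<integral>\<^sup>+\<rho>. f t \<rho> * indicator {t - h<..<t} \<rho> \<partial>lebesgue) \<in> borel_measurable lebesgue"
proof -
  have "(\<lambda>z. (case z of (t, \<rho>) \<Rightarrow> f t \<rho>) * (case z of (t, \<rho>) \<Rightarrow> indicator {t - h<..<t} \<rho>))
      \<in> borel_measurable (lebesgue \<Otimes>\<^sub>M lebesgue)"
    by (rule borel_measurable_times_ennreal[OF assms strip_indicator_measurable])
  from sigma_finite_measure.borel_measurable_nn_integral_fst[OF sigma_finite_lebesgue this]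
  show ?thesis by simp
qed

lemma strip_integral_outer:
  fixes g :: "real \<Rightarrow> ennreal"
  assumes "h > 0" and [measurable]: "g \<in> borel_measurable lebesgue"
  shows "(\<integral>\<^sup>+t. \<integral>\<^sup>+\<rho>. g t * indicator {t - h<..<t} \<rho> \<partial>lebesgue \<partial>lebesgue) = ennreal h * (\<integral>\<^sup>+t. g t \<partial>lebesgue)"
proof -
  have "(\<integral>\<^sup>+\<rho>. g t * indicator {t - h<..<t} \<rho> \<partial>lebesgue) = ennreal h * g t" for t
    using assms by (subst nn_integral_cmult_indicator) (auto simp: mult.commute)
  then show ?thesis by (simp add: nn_integral_cmult)
qed

text \<open>After exchanging the integrals, the section of the strip at a fixed \<rho> is the
  interval from \<rho> to \<rho> + h, which again has length h.\<close>

lemma strip_integral_inner: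
  fixes g :: "real \<Rightarrow> ennreal"
  assumes "h > 0" and [measurable]: "g \<in> borel_measurable lebesgue"
  shows "(\<integral>\<^sup>+t. \<integral>\<^sup>+\<rho>. g \<rho> * indicator {t - h<..<t} \<rho> \<partial>lebesgue \<partial>lebesgue) = ennreal h * (\<integral>\<^sup>+t. g t \<partial>lebesgue)"
proof -
  interpret pair_sigma_finite "lebesgue :: real measure" "lebesgue :: real measure"
    by (rule pair_sigma_finite_lebesgue)
  have m: "(\<lambda>(t, \<rho>). g \<rho> * indicator {t - h<..<t} \<rho>) \<in> borel_measurable (lebesgue \<Otimes>\<^sub>M lebesgue)"
    using strip_indicator_measurable[of h] by (simp add: case_prod_unfold)
  have "(\<integral>\<^sup>+t. \<integral>\<^sup>+\<rho>. g \<rho> * indicator {t - h<..<t} \<rho> \<partial>lebesgue \<partial>lebesgue)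
      = (\<integral>\<^sup>+\<rho>. \<integral>\<^sup>+t. g \<rho> * indicator {t - h<..<t} \<rho> \<partial>lebesgue \<partial>lebesgue)"
    using Fubini[OF m] by simp
  also have "\<dots> = (\<integral>\<^sup>+\<rho>. \<integral>\<^sup>+t. g \<rho> * indicator {\<rho><..<\<rho> + h} t \<partial>lebesgue \<partial>lebesgue)"
    by (intro nn_integral_cong) (auto split: split_indicator)
  also have "\<dots> = (\<integral>\<^sup>+\<rho>. ennreal h * g \<rho> \<partial>lebesgue)"
    using assms(1) by (intro nn_integral_cong, subst nn_integral_cmult_indicator) (auto simp: mult.commute)
  finally show ?thesis by (simp add: nn_integral_cmult)
qed

text \<open>By regularity, \<open>E\<close> is squeezed between a compact \<open>K\<close> and an
  open \<open>U\<close> with \<open>U - K\<close> of measure at most \<open>e / 2\<close>. Two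
  points closer than the distance from \<open>K\<close> to the complement of \<open>U\<close>,
  exactly one of them in \<open>E\<close>, cannot both avoid \<open>U - K\<close>. Each of the two
  coordinates then contributes \<open>h\<close> times that measure.\<close>

lemma strip_indicator_small:
  fixes E :: "real set"
  assumes E: "E \<in> sets lebesgue" "bounded E" and e: "e > 0"
  shows "\<exists>h0>0. \<forall>h. 0 < h \<longrightarrow> h < h0 \<longrightarrow>
    (\<integral>\<^sup>+t. \<integral>\<^sup>+\<rho>. of_bool ((t \<in> E) \<noteq> (\<rho> \<in> E)) * indicator {t - h<..<t} \<rho> \<partial>lebesgue \<partial>lebesgue) \<le> ennreal (e * h)"
proof -
  have e4: "e / 4 > 0" using e by simp
  obtain U where U: "open U" "E \<subseteq> U" "U - E \<in> lmeasurable" "emeasure lebesgue (U - E) < ennreal (e / 4)"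
    by (rule sets_lebesgue_outer_open[OF E(1) e4])
  obtain K where K: "closed K" "K \<subseteq> E" "E - K \<in> lmeasurable" "emeasure lebesgue (E - K) < ennreal (e / 4)"
    by (rule sets_lebesgue_inner_closed[OF E(1) e4])
  have D: "U - K = (U - E) \<union> (E - K)" using U K by auto
  have Dm: "U - K \<in> sets lebesgue" unfolding D using U(3) K(3) by auto
  have "emeasure lebesgue (U - K) \<le> emeasure lebesgue (U - E) + emeasure lebesgue (E - K)"
    unfolding D using U(3) K(3) by (intro emeasure_subadditive) auto
  also have "\<dots> \<le> ennreal (e / 4) + ennreal (e / 4)" using U(4) K(4) by (intro add_mono) auto
  also have "\<dots> = ennreal (e / 2)" using e by (simp flip: ennreal_plus)
  finally have Dle: "emeasure lebesgue (U - K) \<le> ennreal (e / 2)" .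
  have "compact K" using K(1,2) E(2) by (meson bounded_subset compact_eq_bounded_closed)
  moreover have "closed (- U)" using U(1) by (simp add: closed_Compl)
  ultimately obtain d where d: "d > 0" "\<And>x y. x \<in> K \<Longrightarrow> y \<in> - U \<Longrightarrow> d \<le> dist x y"
    using separate_compact_closed[of K "- U"] U(2) K(2) by blast
  show ?thesis
  proof (intro exI[of _ d] conjI allI impI d(1))
    fix h assume h: "0 < h" "h < d"
    have pt: "of_bool ((t \<in> E) \<noteq> (\<rho> \<in> E)) * indicator {t - h<..<t} \<rho>
        \<le> indicator (U - K) t * indicator {t - h<..<t} \<rho> + (indicator (U - K) \<rho> * indicator {t - h<..<t} \<rho> :: ennreal)" for t \<rho>
    proof (cases "\<rho> \<in> {t - h<..<t} \<and> (t \<in> E) \<noteq> (\<rho> \<in> E)")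
      case True
      then have dd: "dist t \<rho> < d" "dist \<rho> t < d" using h by (auto simp: dist_real_def)
      have "t \<in> U - K \<or> \<rho> \<in> U - K"
      proof (cases "t \<in> E")
        case True
        then show ?thesis using d(2)[of t \<rho>] dd \<open>_ \<and> _\<close> U K by force
      next
        case False
        then show ?thesis using d(2)[of \<rho> t] dd \<open>_ \<and> _\<close> U K by force
      qed
      then show ?thesis using True by (auto split: split_indicator)
    next
      case False
      then show ?thesis by (auto split: split_indicator)
    qed
    have "(\<integral>\<^sup>+t. \<integral>\<^sup>+\<rho>. of_bool ((t \<in> E) \<noteq> (\<rho> \<in> E)) * indicator {t - h<..<t} \<rho> \<partial>lebesgue \<partial>lebesgue)
        \<le> (\<integral>\<^sup>+t. \<integral>\<^sup>+\<rho>. indicator (U - K) t * indicator {t - h<..<t} \<rho> + indicator (U - K) \<rho> * indicator {t - h<..<t} \<rho> \<partial>lebesgue \<partial>lebesgue)"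
      by (intro nn_integral_mono pt)
    also have "\<dots> = (\<integral>\<^sup>+t. (\<integral>\<^sup>+\<rho>. indicator (U - K) t * indicator {t - h<..<t} \<rho> \<partial>lebesgue)
        + (\<integral>\<^sup>+\<rho>. indicator (U - K) \<rho> * indicator {t - h<..<t} \<rho> \<partial>lebesgue) \<partial>lebesgue)"
      using Dm by (intro nn_integral_cong nn_integral_add) auto
    also have "\<dots> = ennreal h * (\<integral>\<^sup>+t. indicator (U - K) t \<partial>lebesgue) + ennreal h * (\<integral>\<^sup>+t. indicator (U - K) t \<partial>lebesgue)"
    proof -
      have m: "(\<lambda>t. indicator (U - K) t :: ennreal) \<in> borel_measurable lebesgue" using Dm by simp
      have m1: "(\<lambda>(t, \<rho>). indicator (U - K) t :: ennreal) \<in> borel_measurable (lebesgue \<Otimes>\<^sub>M (lebesgue :: real measure))"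
        and m2: "(\<lambda>(t, \<rho>). indicator (U - K) \<rho> :: ennreal) \<in> borel_measurable ((lebesgue :: real measure) \<Otimes>\<^sub>M lebesgue)"
        using measurable_compose[OF measurable_fst m] measurable_compose[OF measurable_snd m]
        by (simp_all add: case_prod_unfold)
      show ?thesis
        by (subst nn_integral_add[OF strip_integral_measurable[OF m1] strip_integral_measurable[OF m2]])
          (simp add: strip_integral_outer[OF h(1) m] strip_integral_inner[OF h(1) m])
    qed
    also have "\<dots> = ennreal h * (emeasure lebesgue (U - K) + emeasure lebesgue (U - K))"
      using Dm by (simp add: distrib_left)
    also have "\<dots> \<le> ennreal h * (ennreal (e / 2) + ennreal (e / 2))"
      using Dle by (intro mult_left_mono add_mono) auto
    also have "\<dots> = ennreal (e * h)" using e h(1) by (simp flip: ennreal_plus ennreal_mult add: mult.commute)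
    finally show "(\<integral>\<^sup>+t. \<integral>\<^sup>+\<rho>. of_bool ((t \<in> E) \<noteq> (\<rho> \<in> E)) * indicator {t - h<..<t} \<rho> \<partial>lebesgue \<partial>lebesgue) \<le> ennreal (e * h)" .
  qed
qed

text \<open>The sum is at most three times the largest of the three norms. The crude constant holds
  for every positive exponent.\<close>

lemma norm_powr_triangle3:
  fixes a b c :: "'b::real_normed_vector"
  assumes "p > 0"
  shows "norm (a + b + c) powr p \<le> 3 powr p * (norm a powr p + norm b powr p + norm c powr p)"
proof -
  define m where "m = max (norm a) (max (norm b) (norm c))"
  have m: "norm a \<le> m" "norm b \<le> m" "norm c \<le> m" "m \<ge> 0" by (auto simp: m_def le_max_iff_disj)
  have "norm (a + b + c) \<le> norm a + norm b + norm c"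
    by (meson add_right_mono norm_triangle_ineq order_trans)
  then have "norm (a + b + c) \<le> 3 * m" using m by linarith
  then have "norm (a + b + c) powr p \<le> (3 * m) powr p"
    using assms by (intro powr_mono2) auto
  also have "\<dots> = 3 powr p * m powr p" using m(4) by (simp add: powr_mult)
  also have "m powr p \<le> norm a powr p + norm b powr p + norm c powr p"
    unfolding m_def max_def by auto
  finally show ?thesis by simp
qed

lemma nn_integral_cmult_sum:
  fixes f :: "'i \<Rightarrow> 'a \<Rightarrow> ennreal"
  assumes "\<And>i. f i \<in> borel_measurable M"
  shows "(\<integral>\<^sup>+x. (\<Sum>i\<in>I. c * f i x) \<partial>M) = (\<Sum>i\<in>I. c * (\<integral>\<^sup>+x. f i x \<partial>M))"
  using assms by (simp add: nn_integral_sum nn_integral_cmult)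

text \<open>If \<open>S t\<close> and \<open>S \<rho>\<close> differ, some nonzero value is attained
  at exactly one of the two points, so the integrand is dominated by a finite sum of indicator
  differences of level sets. The value 0 is left out because its level set is unbounded.\<close>

lemma strip_small_simple:
  fixes S :: "real \<Rightarrow> 'b::real_normed_vector"
  assumes S: "simple_function lebesgue S" "bounded {t. S t \<noteq> 0}" and p: "p > 0" and e: "e > 0"
  shows "\<exists>h0>0. \<forall>h. 0 < h \<longrightarrow> h < h0 \<longrightarrow>
    (\<integral>\<^sup>+t. \<integral>\<^sup>+\<rho>. ennreal (norm (S t - S \<rho>) powr p) * indicator {t - h<..<t} \<rho> \<partial>lebesgue \<partial>lebesgue) \<le> ennreal (e * h)"
proof -
  define R where "R = range S - {0}"
  have fin: "finite R" using S(1) by (simp add: simple_function_def R_def)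
  define M where "M = (\<Sum>v\<in>R. 2 * norm v)"
  have M0: "M \<ge> 0" unfolding M_def by (intro sum_nonneg) auto
  have SM: "norm (S t) \<le> M / 2" for t
  proof (cases "S t = 0")
    case False
    then have "2 * norm (S t) \<le> M"
      unfolding M_def using fin by (intro member_le_sum) (auto simp: R_def)
    then show ?thesis by simp
  qed (use M0 in simp)
  define E where "E v = {t. S t = v}" for v
  have E: "E v \<in> sets lebesgue" "v \<in> R \<Longrightarrow> bounded (E v)" for v
  proof -
    show "E v \<in> sets lebesgue" using simple_functionD(2)[OF S(1), of "{v}"] by (simp add: E_def vimage_def)
    show "v \<in> R \<Longrightarrow> bounded (E v)" unfolding E_def R_def
      by (rule bounded_subset[OF S(2)]) auto
  qed
  \<comment> \<open>There are \<open>card R\<close> terms of weight \<open>M powr p\<close> each,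
    and this choice keeps their total below \<open>e * h\<close>; the added ones keep the
    denominator positive.\<close>
  define e' where "e' = e / (1 + M powr p * (1 + card R))"
  have den: "1 + M powr p * (1 + card R) > 0" by (simp add: add_pos_nonneg)
  have e': "e' > 0" using e den by (simp add: e'_def)
  have "\<forall>v\<in>R. \<exists>h0>0. \<forall>h. 0 < h \<longrightarrow> h < h0 \<longrightarrow>
    (\<integral>\<^sup>+t. \<integral>\<^sup>+\<rho>. of_bool ((t \<in> E v) \<noteq> (\<rho> \<in> E v)) * indicator {t - h<..<t} \<rho> \<partial>lebesgue \<partial>lebesgue) \<le> ennreal (e' * h)"
    using strip_indicator_small[OF E(1) E(2) e'] by blast
  from bchoice[OF this] obtain H where H: "\<And>v. v \<in> R \<Longrightarrow> H v > 0" "\<And>v h. v \<in> R \<Longrightarrow> 0 < h \<Longrightarrow> h < H v \<Longrightarrow>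
    (\<integral>\<^sup>+t. \<integral>\<^sup>+\<rho>. of_bool ((t \<in> E v) \<noteq> (\<rho> \<in> E v)) * indicator {t - h<..<t} \<rho> \<partial>lebesgue \<partial>lebesgue) \<le> ennreal (e' * h)"
    by blast
  show ?thesis
  proof (intro exI[of _ "Min (insert 1 (H ` R))"] conjI allI impI)
    have "Min (insert 1 (H ` R)) \<in> insert 1 (H ` R)" using fin by (intro Min_in) auto
    then show "0 < Min (insert 1 (H ` R))" by (elim insertE imageE) (simp_all only: H(1) zero_less_one)
    fix h assume h: "0 < h" "h < Min (insert 1 (H ` R))"
    have hH: "h < H v" if "v \<in> R" for v
    proof -
      have "Min (insert 1 (H ` R)) \<le> H v" using fin that by (intro Min_le) auto
      with h(2) show ?thesis by linarith
    qed
    define D where "D v t \<rho> = (of_bool ((t \<in> E v) \<noteq> (\<rho> \<in> E v)) :: ennreal)" for v t \<rho>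
    have mD: "(\<lambda>(t, \<rho>). D v t \<rho>) \<in> borel_measurable (lebesgue \<Otimes>\<^sub>M lebesgue)" for v
    proof -
      have "(\<lambda>(t, \<rho>). D v t \<rho>) = indicator ((E v \<times> (- E v)) \<union> ((- E v) \<times> E v))"
        by (auto simp: D_def fun_eq_iff split: split_indicator)
      moreover have "(E v \<times> (- E v)) \<union> ((- E v) \<times> E v) \<in> sets (lebesgue \<Otimes>\<^sub>M lebesgue)"
        using E(1)[of v] Compl_in_sets_lebesgue[of "E v"] by (intro sets.Un pair_measureI) auto
      ultimately show ?thesis by simp
    qed
    have pt: "ennreal (norm (S t - S \<rho>) powr p) * indicator {t - h<..<t} \<rho>
        \<le> (\<Sum>v\<in>R. ennreal (M powr p) * D v t \<rho>) * indicator {t - h<..<t} \<rho>" for t \<rho>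
    proof (cases "S t = S \<rho>")
      case False
      have "norm (S t - S \<rho>) \<le> M"
        using SM[of t] SM[of \<rho>] norm_triangle_ineq4[of "S t" "S \<rho>"] by linarith
      then have "norm (S t - S \<rho>) powr p \<le> M powr p" using p by (intro powr_mono2) auto
      moreover obtain v where "v \<in> R" "D v t \<rho> = 1"
      proof (cases "S t = 0")
        case True
        then show ?thesis using False that[of "S \<rho>"] by (simp add: R_def D_def E_def)
      next
        case nz: False
        then show ?thesis using False that[of "S t"] by (auto simp: R_def D_def E_def)
      qed
      moreover have "ennreal (M powr p) * D v t \<rho> \<le> (\<Sum>v\<in>R. ennreal (M powr p) * D v t \<rho>)" if "v \<in> R" for v
        using fin that by (intro member_le_sum) auto
      ultimately have "ennreal (norm (S t - S \<rho>) powr p) \<le> (\<Sum>v\<in>R. ennreal (M powr p) * D v t \<rho>)"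
        by (metis ennreal_leI mult.right_neutral order_trans)
      then show ?thesis by (intro mult_right_mono) auto
    qed (use p in simp)
    have mM: "(\<lambda>(t, \<rho>). ennreal (M powr p) * D v t \<rho>) \<in> borel_measurable (lebesgue \<Otimes>\<^sub>M lebesgue)" for v
      using mD[of v] by (simp add: case_prod_unfold)
    have mInner: "(\<lambda>\<rho>. D v t \<rho> * indicator {t - h<..<t} \<rho>) \<in> borel_measurable lebesgue" for v t
      using E(1)[of v] by (auto simp: D_def intro!: borel_measurable_times_ennreal) measurable
    have "(\<integral>\<^sup>+t. \<integral>\<^sup>+\<rho>. ennreal (norm (S t - S \<rho>) powr p) * indicator {t - h<..<t} \<rho> \<partial>lebesgue \<partial>lebesgue)
       \<le> (\<integral>\<^sup>+t. \<integral>\<^sup>+\<rho>. (\<Sum>v\<in>R. ennreal (M powr p) * (D v t \<rho> * indicator {t - h<..<t} \<rho>)) \<partial>lebesgue \<partial>lebesgue)"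
      using pt by (intro nn_integral_mono) (simp add: sum_distrib_right mult.assoc)
    also have "\<dots> = (\<integral>\<^sup>+t. (\<Sum>v\<in>R. ennreal (M powr p) * (\<integral>\<^sup>+\<rho>. D v t \<rho> * indicator {t - h<..<t} \<rho> \<partial>lebesgue)) \<partial>lebesgue)"
      by (intro nn_integral_cong nn_integral_cmult_sum mInner)
    also have "\<dots> = (\<Sum>v\<in>R. ennreal (M powr p) * (\<integral>\<^sup>+t. \<integral>\<^sup>+\<rho>. D v t \<rho> * indicator {t - h<..<t} \<rho> \<partial>lebesgue \<partial>lebesgue))"
      by (rule nn_integral_cmult_sum) (rule strip_integral_measurable[OF mD])
    also have "\<dots> \<le> (\<Sum>v\<in>R. ennreal (M powr p) * ennreal (e' * h))"
      using H(2)[OF _ h(1) hH] unfolding D_def by (intro sum_mono mult_left_mono) auto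
    also have "\<dots> = ennreal (card R * (M powr p * (e' * h)))"
      using e' h(1) by (simp add: ennreal_mult[symmetric] ennreal_of_nat_eq_real_of_nat)
    also have "\<dots> \<le> ennreal (e * h)"
    proof (rule ennreal_leI)
      have "card R * M powr p \<le> 1 + M powr p * (1 + card R)" by (simp add: algebra_simps)
      then have "(card R * M powr p) * e' \<le> (1 + M powr p * (1 + card R)) * e'"
        using e' by (intro mult_right_mono) auto
      also have "\<dots> = e" using den by (simp add: e'_def)
      finally have "(card R * M powr p) * e' * h \<le> e * h" using h(1) by (intro mult_right_mono) auto
      then show "card R * (M powr p * (e' * h)) \<le> e * h" by (simp add: mult.assoc)
    qed
    finally show "(\<integral>\<^sup>+t. \<integral>\<^sup>+\<rho>. ennreal (norm (S t - S \<rho>) powr p) * indicator {t - h<..<t} \<rho> \<partial>lebesgue \<partial>lebesgue) \<le> ennreal (e * h)" .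
  qed
qed

text \<open>Approximants of norm at most twice that of \<open>W\<close> make dominated convergence
  applicable with the bound \<open>(3 * norm (W t)) powr p\<close>. They also vanish wherever
  \<open>W\<close> does, so that a bounded support is inherited.\<close>

lemma simple_approx_Lp:
  fixes W :: "real \<Rightarrow> 'b::{real_normed_vector, second_countable_topology}"
  assumes W: "W \<in> borel_measurable lebesgue" "(\<integral>\<^sup>+t. ennreal (norm (W t) powr p) \<partial>lebesgue) < \<infinity>" and p: "p > 0" and e: "e > 0"
  obtains S where "simple_function lebesgue S" "\<And>t. W t = 0 \<Longrightarrow> S t = 0"
    "(\<integral>\<^sup>+t. ennreal (norm (W t - S t) powr p) \<partial>lebesgue) < ennreal e"
proof -
  obtain S where S: "\<And>n::nat. simple_function lebesgue (S n)" "\<And>t. (\<lambda>n. S n t) \<longlonglongrightarrow> W t"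
    "\<And>n t. norm (S n t) \<le> 2 * norm (W t)"
    using borel_measurable_implies_sequence_metric[OF W(1), of 0] by auto
  have [measurable]: "(\<lambda>t. norm (W t - S n t)) \<in> borel_measurable lebesgue" for n
    by (rule measurable_diff_simple[OF W(1) S(1)])
  have [measurable]: "(\<lambda>t. norm (W t)) \<in> borel_measurable lebesgue"
    using W(1) by measurable
  have "(\<lambda>n. \<integral>\<^sup>+t. ennreal (norm (W t - S n t) powr p) \<partial>lebesgue) \<longlonglongrightarrow> (\<integral>\<^sup>+(t::real). 0 \<partial>lebesgue)"
  proof (rule nn_integral_dominated_convergence[where w="\<lambda>t. ennreal (3 powr p) * ennreal (norm (W t) powr p)"])
    show "AE t in lebesgue. ennreal (norm (W t - S n t) powr p) \<le> ennreal (3 powr p) * ennreal (norm (W t) powr p)" for n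
    proof (rule AE_I2)
      fix t
      have "norm (W t - S n t) \<le> 3 * norm (W t)"
        using norm_triangle_ineq4[of "W t" "S n t"] S(3)[of n t] by linarith
      then have "norm (W t - S n t) powr p \<le> (3 * norm (W t)) powr p" using p by (intro powr_mono2) auto
      then show "ennreal (norm (W t - S n t) powr p) \<le> ennreal (3 powr p) * ennreal (norm (W t) powr p)"
        by (simp add: powr_mult ennreal_mult[symmetric] ennreal_leI)
    qed
    show "(\<integral>\<^sup>+t. ennreal (3 powr p) * ennreal (norm (W t) powr p) \<partial>lebesgue) < \<infinity>"
      using W(2) by (subst nn_integral_cmult) (auto simp: ennreal_mult_less_top)
    show "AE t in lebesgue. (\<lambda>n. ennreal (norm (W t - S n t) powr p)) \<longlonglongrightarrow> 0"
    proof (rule AE_I2)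
      fix t
      have "(\<lambda>n. norm (W t - S n t)) \<longlonglongrightarrow> norm (W t - W t)"
        by (intro tendsto_norm tendsto_diff tendsto_const S(2))
      then have "(\<lambda>n. norm (W t - S n t) powr p) \<longlonglongrightarrow> 0 powr p"
        using p by (intro tendsto_powr') auto
      then show "(\<lambda>n. ennreal (norm (W t - S n t) powr p)) \<longlonglongrightarrow> 0"
        using tendsto_ennrealI by fastforce
    qed
  qed auto
  then have "\<forall>\<^sub>F n in sequentially. (\<integral>\<^sup>+t. ennreal (norm (W t - S n t) powr p) \<partial>lebesgue) < ennreal e"
    using order_tendstoD(2) e by fastforce
  then obtain n where "(\<integral>\<^sup>+t. ennreal (norm (W t - S n t) powr p) \<partial>lebesgue) < ennreal e"
    using eventually_happens'[OF sequentially_bot] by blast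
  moreover have "S n t = 0" if "W t = 0" for t using S(3)[of n t] that by simp
  ultimately show ?thesis using that S(1) by blast
qed

text \<open>Insert a simple approximant \<open>S\<close> and split the difference into W t - S t, S
  t - S \<rho> and S \<rho> - W \<rho>. The outer terms depend on one variable only, so their strip
  integrals are exactly \<open>h\<close> times an arbitrarily small number; the middle term is the
  simple case. The factor \<open>3 * C\<close> in \<open>e'\<close> accounts for the three terms and
  the constant of the triangle inequality.\<close>

lemma strip_small:
  fixes W :: "real \<Rightarrow> 'b::{real_normed_vector, second_countable_topology}"
  assumes W: "W \<in> borel_measurable lebesgue" "(\<integral>\<^sup>+t. ennreal (norm (W t) powr p) \<partial>lebesgue) < \<infinity>"
    "bounded {t. W t \<noteq> 0}" and p: "p > 0" and e: "e > 0"
  shows "\<exists>h0>0. \<forall>h. 0 < h \<longrightarrow> h < h0 \<longrightarrow>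
    (\<integral>\<^sup>+t. \<integral>\<^sup>+\<rho>. ennreal (norm (W t - W \<rho>) powr p) * indicator {t - h<..<t} \<rho> \<partial>lebesgue \<partial>lebesgue) \<le> ennreal (e * h)"
proof -
  define C where "C = (3::real) powr p"
  have C: "C > 0" by (simp add: C_def)
  define e' where "e' = e / (3 * C)"
  have e': "e' > 0" "3 * C * e' = e" using e C by (auto simp: e'_def)
  obtain S where S: "simple_function lebesgue S" "\<And>t. W t = 0 \<Longrightarrow> S t = 0"
    "(\<integral>\<^sup>+t. ennreal (norm (W t - S t) powr p) \<partial>lebesgue) < ennreal e'"
    using simple_approx_Lp[OF W(1,2) p e'(1)] by blast
  have bS: "bounded {t. S t \<noteq> 0}" by (rule bounded_subset[OF W(3)]) (use S(2) in auto)
  obtain h0 where h0: "h0 > 0" "\<And>h. 0 < h \<Longrightarrow> h < h0 \<Longrightarrow>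
    (\<integral>\<^sup>+t. \<integral>\<^sup>+\<rho>. ennreal (norm (S t - S \<rho>) powr p) * indicator {t - h<..<t} \<rho> \<partial>lebesgue \<partial>lebesgue) \<le> ennreal (e' * h)"
    using strip_small_simple[OF S(1) bS p e'(1)] by blast
  define g where "g t = ennreal (norm (W t - S t) powr p)" for t
  have mg: "g \<in> borel_measurable lebesgue"
    unfolding g_def using measurable_diff_simple[OF W(1) S(1)] by measurable
  define f where "f t \<rho> = ennreal (norm (S t - S \<rho>) powr p)" for t \<rho>
  have mS: "S \<in> borel_measurable lebesgue" by (rule borel_measurable_simple_function[OF S(1)])
  have mf: "(\<lambda>(t, \<rho>). f t \<rho>) \<in> borel_measurable (lebesgue \<Otimes>\<^sub>M lebesgue)"
  proof -
    have [measurable]: "(\<lambda>z. S (fst z)) \<in> borel_measurable (lebesgue \<Otimes>\<^sub>M (lebesgue :: real measure))"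
      "(\<lambda>z. S (snd z)) \<in> borel_measurable ((lebesgue :: real measure) \<Otimes>\<^sub>M lebesgue)"
      by (rule measurable_compose[OF measurable_fst mS], rule measurable_compose[OF measurable_snd mS])
    show ?thesis unfolding f_def case_prod_unfold by measurable
  qed
  have mgs: "(\<lambda>(t, \<rho>). g t) \<in> borel_measurable (lebesgue \<Otimes>\<^sub>M (lebesgue :: real measure))"
    "(\<lambda>(t, \<rho>). g \<rho>) \<in> borel_measurable ((lebesgue :: real measure) \<Otimes>\<^sub>M lebesgue)"
    unfolding case_prod_unfold
    by (rule measurable_compose[OF measurable_fst mg], rule measurable_compose[OF measurable_snd mg])
  show ?thesis
  proof (intro exI[of _ h0] conjI allI impI h0(1))
    fix h assume h: "0 < h" "h < h0"
    let ?i = "\<lambda>t \<rho>. indicator {t - h<..<t} \<rho> :: ennreal"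
    have pt: "ennreal (norm (W t - W \<rho>) powr p) * ?i t \<rho>
        \<le> ennreal C * (g t * ?i t \<rho>) + ennreal C * (f t \<rho> * ?i t \<rho>) + ennreal C * (g \<rho> * ?i t \<rho>)" for t \<rho>
    proof -
      have "norm (W t - W \<rho>) powr p \<le> C * (norm (W t - S t) powr p + norm (S t - S \<rho>) powr p + norm (W \<rho> - S \<rho>) powr p)"
        using norm_powr_triangle3[OF p, of "W t - S t" "S t - S \<rho>" "S \<rho> - W \<rho>"]
        by (simp add: C_def norm_minus_commute)
      then have "ennreal (norm (W t - W \<rho>) powr p) \<le> ennreal C * (g t + f t \<rho> + g \<rho>)"
        using C unfolding g_def f_def by (simp flip: ennreal_plus ennreal_mult add: ennreal_leI)
      then show ?thesis by (simp split: split_indicator add: distrib_left)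
    qed
    have m1: "(\<lambda>\<rho>. g \<rho> * ?i t \<rho>) \<in> borel_measurable lebesgue" "(\<lambda>\<rho>. g t * ?i t \<rho>) \<in> borel_measurable lebesgue"
      "(\<lambda>\<rho>. f t \<rho> * ?i t \<rho>) \<in> borel_measurable lebesgue" for t
    proof -
      show "(\<lambda>\<rho>. g \<rho> * ?i t \<rho>) \<in> borel_measurable lebesgue" "(\<lambda>\<rho>. g t * ?i t \<rho>) \<in> borel_measurable lebesgue"
        using mg by (auto intro!: borel_measurable_times_ennreal)
      have "(\<lambda>\<rho>. f t \<rho>) \<in> borel_measurable lebesgue"
        unfolding f_def using mS by measurable
      then show "(\<lambda>\<rho>. f t \<rho> * ?i t \<rho>) \<in> borel_measurable lebesgue"
        by (auto intro!: borel_measurable_times_ennreal)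
    qed
    note m2 = strip_integral_measurable[OF mgs(1), of h] strip_integral_measurable[OF mgs(2), of h]
      strip_integral_measurable[OF mf, of h]
    have "(\<integral>\<^sup>+t. \<integral>\<^sup>+\<rho>. ennreal (norm (W t - W \<rho>) powr p) * ?i t \<rho> \<partial>lebesgue \<partial>lebesgue)
        \<le> (\<integral>\<^sup>+t. \<integral>\<^sup>+\<rho>. ennreal C * (g t * ?i t \<rho>) + ennreal C * (f t \<rho> * ?i t \<rho>) + ennreal C * (g \<rho> * ?i t \<rho>) \<partial>lebesgue \<partial>lebesgue)"
      by (intro nn_integral_mono pt)
    also have "\<dots> = (\<integral>\<^sup>+t. ennreal C * (\<integral>\<^sup>+\<rho>. g t * ?i t \<rho> \<partial>lebesgue) + ennreal C * (\<integral>\<^sup>+\<rho>. f t \<rho> * ?i t \<rho> \<partial>lebesgue)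
        + ennreal C * (\<integral>\<^sup>+\<rho>. g \<rho> * ?i t \<rho> \<partial>lebesgue) \<partial>lebesgue)"
      using m1 by (simp add: nn_integral_add nn_integral_cmult)
    also have "\<dots> = ennreal C * (ennreal h * (\<integral>\<^sup>+t. g t \<partial>lebesgue)) + ennreal C * (\<integral>\<^sup>+t. \<integral>\<^sup>+\<rho>. f t \<rho> * ?i t \<rho> \<partial>lebesgue \<partial>lebesgue)
        + ennreal C * (ennreal h * (\<integral>\<^sup>+t. g t \<partial>lebesgue))"
    proof -
      have "(\<integral>\<^sup>+t. ennreal C * a t + ennreal C * b t + ennreal C * c t \<partial>lebesgue)
          = ennreal C * (\<integral>\<^sup>+t. a t \<partial>lebesgue) + ennreal C * (\<integral>\<^sup>+t. b t \<partial>lebesgue) + ennreal C * (\<integral>\<^sup>+t. c t \<partial>lebesgue)"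
        if "a \<in> borel_measurable lebesgue" "b \<in> borel_measurable lebesgue" "c \<in> borel_measurable lebesgue"
        for a b c :: "real \<Rightarrow> ennreal"
        using that by (simp add: nn_integral_add nn_integral_cmult)
      from this[OF m2(1) m2(3) m2(2)] show ?thesis
        unfolding strip_integral_outer[OF h(1) mg] strip_integral_inner[OF h(1) mg] .
    qed
    also have "\<dots> \<le> ennreal C * (ennreal h * ennreal e') + ennreal C * ennreal (e' * h) + ennreal C * (ennreal h * ennreal e')"
      using S(3) h0(2)[OF h] unfolding g_def f_def by (intro add_mono mult_left_mono) auto
    also have "\<dots> = ennreal (3 * C * e' * h)"
      using C e'(1) h(1) by (simp flip: ennreal_plus ennreal_mult add: algebra_simps)
    finally show "(\<integral>\<^sup>+t. \<integral>\<^sup>+\<rho>. ennreal (norm (W t - W \<rho>) powr p) * ?i t \<rho> \<partial>lebesgue \<partial>lebesgue) \<le> ennreal (e * h)"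
      unfolding e'(2) .
  qed
qed

lemma ennreal_integral_le_nn_integral:
  fixes f :: "'a \<Rightarrow> real"
  assumes "integrable M f"
  shows "ennreal (integral\<^sup>L M f) \<le> (\<integral>\<^sup>+x. ennreal (f x) \<partial>M)"
proof -
  have i: "integrable M (\<lambda>x. max 0 (f x))" using assms by simp
  have "integral\<^sup>L M f \<le> integral\<^sup>L M (\<lambda>x. max 0 (f x))"
    using assms i by (intro integral_mono) auto
  then have "ennreal (integral\<^sup>L M f) \<le> ennreal (integral\<^sup>L M (\<lambda>x. max 0 (f x)))"
    by (rule ennreal_leI)
  also have "\<dots> = (\<integral>\<^sup>+x. ennreal (max 0 (f x)) \<partial>M)"
    using i by (intro nn_integral_eq_integral[symmetric]) auto
  also have "\<dots> = (\<integral>\<^sup>+x. ennreal (f x) \<partial>M)"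
    by (intro nn_integral_cong) (simp add: max_def ennreal_neg)
  finally show ?thesis .
qed

lemma integrable_Icc_iff_Ioo:
  fixes f :: "real \<Rightarrow> 'b::{banach, second_countable_topology}"
  shows "integrable (lebesgue_on {a..b}) f \<longleftrightarrow> integrable (lebesgue_on {a<..<b}) f"
proof -
  have "integrable lebesgue (\<lambda>x. indicator {a..b} x *\<^sub>R f x) \<longleftrightarrow> integrable lebesgue (\<lambda>x. indicator {a<..<b} x *\<^sub>R f x)"
    by (rule integrable_discrete_difference[where X="{a, b}"]) (auto split: split_indicator)
  then show ?thesis by (simp add: integrable_lebesgue_on_iff set_integrable_def)
qed

lemma integrable_Ioo_imp_Icc:
  fixes f :: "real \<Rightarrow> 'b::{banach, second_countable_topology}"
  assumes "integrable (lebesgue_on {a<..<b}) f" "a \<le> s" "t \<le> b"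
  shows "integrable (lebesgue_on {s..t}) f"
  using integrable_lebesgue_on_subset[of "{a..b}" f "{s..t}"] assms by (auto simp: integrable_Icc_iff_Ioo)

lemma integrable_Ioo_imp_HK:
  fixes f :: "real \<Rightarrow> real"
  assumes "integrable (lebesgue_on {a<..<b}) f" "a \<le> s" "t \<le> b"
  shows "f integrable_on {s..t}" "integral\<^sup>L (lebesgue_on {s..t}) f = integral {s..t} f"
    "integral\<^sup>L (lebesgue_on {s<..<t}) f = integral {s..t} f"
proof -
  have i: "integrable (lebesgue_on {s..t}) f" by (rule integrable_Ioo_imp_Icc[OF assms])
  show "f integrable_on {s..t}"
    using i integrable_lebesgue_on_iff[of "{s..t}" f] set_lebesgue_integral_eq_integral(1)[of "{s..t}" f] by simp
  show "integral\<^sup>L (lebesgue_on {s..t}) f = integral {s..t} f"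
    by (rule lebesgue_integral_eq_integral[OF i]) simp
  have "integrable (lebesgue_on {s<..<t}) f" using i by (simp add: integrable_Icc_iff_Ioo)
  then show "integral\<^sup>L (lebesgue_on {s<..<t}) f = integral {s..t} f"
    by (simp add: lebesgue_integral_eq_integral integral_open_interval_real)
qed

text \<open>The factors are rescaled by a \<theta> with \<theta>^q / q = \<eta> before Young's
  inequality is applied, which moves the whole cost to the other term.\<close>

lemma Youngs_inequality_small:
  fixes p q :: real
  assumes "p > 1" "q > 1" "1 / p + 1 / q = 1" "\<eta> > 0"
  obtains C where "C > 0" "\<And>x y. x \<ge> 0 \<Longrightarrow> y \<ge> 0 \<Longrightarrow> x * y \<le> \<eta> * x powr q + C * y powr p"
proof -
  define \<theta> where "\<theta> = (\<eta> * q) powr (1 / q)"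
  have \<theta>: "\<theta> > 0" "\<theta> powr q = \<eta> * q" using assms by (auto simp: \<theta>_def powr_powr)
  define C where "C = inverse (\<theta> powr p * p)"
  have "C > 0" using assms \<theta> by (simp add: C_def)
  moreover have "x * y \<le> \<eta> * x powr q + C * y powr p" if "x \<ge> 0" "y \<ge> 0" for x y
  proof -
    have "x * y = (y / \<theta>) * (\<theta> * x)" using \<theta> by simp
    also have "\<dots> \<le> (y / \<theta>) powr p / p + (\<theta> * x) powr q / q"
      using assms \<theta> that by (intro Youngs_inequality) auto
    also have "\<dots> = \<eta> * x powr q + C * y powr p"
      using assms \<theta> that by (simp add: powr_mult powr_divide C_def field_simps)
    finally show ?thesis .
  qed
  ultimately show ?thesis by (rule that)
qed

text \<open>Integrated over \<open>r\<close> in \<open>[s, t]\<close>, the increment \<open>G r - G (r - h)\<close> gives \<open>h\<close> times the difference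
of the means of \<open>G\<close> over lags at \<open>t\<close> and \<open>s\<close>, while the right-hand side becomes a strip integral of order \<open>o(h)\<close>.\<close>

lemma le_of_strip_difference:
  fixes G :: "real \<Rightarrow> real" and R :: "real \<Rightarrow> real \<Rightarrow> ennreal"
  assumes G: "continuous_on {a..b} G"
    and st: "a < s" "s < t" "t < b"
    and ineq: "AE r in lebesgue. r \<in> {a<..<b} \<longrightarrow> (\<forall>s. a < s \<longrightarrow> s < r \<longrightarrow>
      ennreal (G r - G s) \<le> (\<integral>\<^sup>+\<rho>. R r \<rho> * indicator {s<..<r} \<rho> \<partial>lebesgue))"
    and small: "\<And>e. e > 0 \<Longrightarrow> \<exists>h0>0. \<forall>h. 0 < h \<longrightarrow> h < h0 \<longrightarrow>
      (\<integral>\<^sup>+r. \<integral>\<^sup>+\<rho>. R r \<rho> * indicator {r - h<..<r} \<rho> \<partial>lebesgue \<partial>lebesgue) \<le> ennreal (e * h)"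
  shows "G t \<le> G s"
proof (rule field_le_epsilon)
  fix e0 :: real assume "e0 > 0"
  \<comment> \<open>One share for continuity at \<open>t\<close>, one for continuity at
    \<open>s\<close> and one for the strip integral.\<close>
  define e where "e = e0 / 3"
  have e: "e > 0" using \<open>e0 > 0\<close> by (simp add: e_def)
  have cont: "isCont G r" if "r \<in> {a<..<b}" for r
    using G that continuous_on_interior[of "{a..b}" G r] by simp
  obtain h1 where h1: "h1 > 0" "\<And>r. \<bar>r - t\<bar> < h1 \<Longrightarrow> \<bar>G r - G t\<bar> < e"
    using cont[of t] st e unfolding continuous_at_eps_delta dist_real_def by fastforce
  obtain h2 where h2: "h2 > 0" "\<And>r. \<bar>r - s\<bar> < h2 \<Longrightarrow> \<bar>G r - G s\<bar> < e"
    using cont[of s] st e unfolding continuous_at_eps_delta dist_real_def by fastforce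
  obtain h3 where h3: "h3 > 0" "\<And>h. 0 < h \<Longrightarrow> h < h3 \<Longrightarrow>
      (\<integral>\<^sup>+r. \<integral>\<^sup>+\<rho>. R r \<rho> * indicator {r - h<..<r} \<rho> \<partial>lebesgue \<partial>lebesgue) \<le> ennreal (e * h)"
    using small[OF e] by blast
  define h where "h = min (min h1 h2) (min h3 (s - a)) / 2"
  have h: "0 < h" "h < h1" "h < h2" "h < h3" "h < s - a"
    using h1(1) h2(1) h3(1) st by (auto simp: h_def min_def)
  have Gi: "G integrable_on {c..d}" if "a \<le> c" "d \<le> b" for c d
    using that by (intro integrable_continuous_interval continuous_on_subset[OF G]) auto
  have Gh: "continuous_on {s..t} (\<lambda>r. G (r - h))"
    using st h by (intro continuous_on_compose2[OF G]) (auto intro!: continuous_intros)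
  have Gst: "continuous_on {s..t} G" using st by (intro continuous_on_subset[OF G]) auto
  have cd: "continuous_on {s..t} (\<lambda>r. G r - G (r - h))" by (intro continuous_intros Gh Gst)
  have id: "integrable (lebesgue_on {s..t}) (\<lambda>r. G r - G (r - h))"
    by (rule continuous_imp_integrable_real[OF cd])
  have shift: "integral {s..t} (\<lambda>r. G (r - h)) = integral {s - h..t - h} G"
    using integral_shift_Icc_real[of s t G "- h"] by (simp add: comp_def)
  have I1: "integral {s..t} (\<lambda>r. G r - G (r - h)) = integral {s..t} G - integral {s - h..t - h} G"
    unfolding shift[symmetric]
    by (rule integral_diff) (intro integrable_continuous_interval Gst Gh)+
  have c1: "integral {s - h..t} G = integral {s - h..s} G + integral {s..t} G"
    using st h by (intro Henstock_Kurzweil_Integration.integral_combine[symmetric] Gi) auto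
  have c2: "integral {s - h..t} G = integral {s - h..t - h} G + integral {t - h..t} G"
    using st h by (intro Henstock_Kurzweil_Integration.integral_combine[symmetric] Gi) auto
  have b1: "integral {t - h..t} (\<lambda>r. G t - e) \<le> integral {t - h..t} G"
  proof (intro integral_le Gi)
    show "(\<lambda>r. G t - e) integrable_on {t - h..t}" by (rule integrable_const_ivl)
    show "G t - e \<le> G r" if "r \<in> {t - h..t}" for r
    proof -
      have "\<bar>r - t\<bar> < h1" using that h by auto
      from h1(2)[OF this] show ?thesis by linarith
    qed
  qed (use st h in auto)
  have b2: "integral {s - h..s} G \<le> integral {s - h..s} (\<lambda>r. G s + e)"
  proof (intro integral_le Gi)
    show "(\<lambda>r. G s + e) integrable_on {s - h..s}" by (rule integrable_const_ivl)
    show "G r \<le> G s + e" if "r \<in> {s - h..s}" for r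
    proof -
      have "\<bar>r - s\<bar> < h2" using that h by auto
      from h2(2)[OF this] show ?thesis by linarith
    qed
  qed (use st h in auto)
  have low: "h * (G t - G s - 2 * e) \<le> integral {s..t} (\<lambda>r. G r - G (r - h))"
    using b1 b2 c1 c2 h(1) unfolding I1 by (simp add: algebra_simps)
  have "ennreal (integral {s..t} (\<lambda>r. G r - G (r - h)))
      = ennreal (integral\<^sup>L (lebesgue_on {s..t}) (\<lambda>r. G r - G (r - h)))"
    using lebesgue_integral_eq_integral[OF id] by simp
  also have "\<dots> \<le> (\<integral>\<^sup>+r. ennreal (G r - G (r - h)) \<partial>lebesgue_on {s..t})"
    by (rule ennreal_integral_le_nn_integral[OF id])
  also have "\<dots> = (\<integral>\<^sup>+r. ennreal (G r - G (r - h)) * indicator {s..t} r \<partial>lebesgue)"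
    by (rule nn_integral_restrict_space) simp
  also have "\<dots> \<le> (\<integral>\<^sup>+r. \<integral>\<^sup>+\<rho>. R r \<rho> * indicator {r - h<..<r} \<rho> \<partial>lebesgue \<partial>lebesgue)"
  proof (rule nn_integral_mono_AE)
    show "AE r in lebesgue. ennreal (G r - G (r - h)) * indicator {s..t} r
        \<le> (\<integral>\<^sup>+\<rho>. R r \<rho> * indicator {r - h<..<r} \<rho> \<partial>lebesgue)"
      using ineq
    proof eventually_elim
      case (elim r)
      show ?case
      proof (cases "r \<in> {s..t}")
        case True
        then have "r \<in> {a<..<b}" "a < r - h" "r - h < r" using st h by auto
        then show ?thesis using elim True by simp
      qed simp
    qed
  qed
  also have "\<dots> \<le> ennreal (e * h)" by (rule h3(2)[OF h(1) h(4)])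
  finally have "integral {s..t} (\<lambda>r. G r - G (r - h)) \<le> e * h"
    using e h(1) by (subst (asm) ennreal_le_iff) auto
  with low have "h * (G t - G s - 2 * e) \<le> h * e" by (simp add: mult.commute)
  then have "G t - G s - 2 * e \<le> e" using h(1) by simp
  then show "G t \<le> G s + e0" by (simp add: e_def)
qed

text \<open>The strip argument looks back by a positive lag and so reaches only interior points. The
  endpoints follow by continuity along points moved inwards by at most a third of
  \<open>t - s\<close>, which keeps their order.\<close>

lemma antimono_on_closed:
  fixes G :: "real \<Rightarrow> real"
  assumes G: "continuous_on {a..b} G" and int: "\<And>s t. a < s \<Longrightarrow> s < t \<Longrightarrow> t < b \<Longrightarrow> G t \<le> G s"
    and st: "a \<le> s" "s \<le> t" "t \<le> b"
  shows "G t \<le> G s"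
proof (cases "s = t")
  case False
  define d where "d n = (t - s) / 3 * inverse (real (Suc n))" for n
  have d: "0 < d n" "d n \<le> (t - s) / 3" for n
  proof -
    show "0 < d n" using st False by (simp add: d_def)
    have "inverse (real (Suc n)) \<le> 1" by (simp add: inverse_le_1_iff)
    then have "(t - s) / 3 * inverse (real (Suc n)) \<le> (t - s) / 3 * 1"
      using st by (intro mult_left_mono) auto
    then show "d n \<le> (t - s) / 3" by (simp add: d_def)
  qed
  have dlim: "d \<longlonglongrightarrow> 0"
    unfolding d_def[abs_def]
    using tendsto_mult[OF tendsto_const LIMSEQ_inverse_real_of_nat, of "(t - s) / 3"] by (simp only: mult_zero_right)
  have in1: "s + d n \<in> {a..b}" "t - d n \<in> {a..b}" for n
    using st d[of n] by (auto simp: field_simps)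
  have l1: "(\<lambda>n. G (s + d n)) \<longlonglongrightarrow> G s"
    using tendsto_add[OF tendsto_const dlim, of s] st in1
    by (intro continuous_on_tendsto_compose[OF G]) auto
  have l2: "(\<lambda>n. G (t - d n)) \<longlonglongrightarrow> G t"
    using tendsto_diff[OF tendsto_const dlim, of t] st in1
    by (intro continuous_on_tendsto_compose[OF G]) auto
  have "G (t - d n) \<le> G (s + d n)" for n
    using st d[of n] False by (intro int) (auto simp: field_simps)
  then show ?thesis by (intro LIMSEQ_le[OF l2 l1]) auto
qed simp

text \<open>The proof uses \<open>|w r|\<^sup>2 - |w s|\<^sup>2 \<le> 2 (w r - w s, w r) = 2 \<integral> \<langle>w' \<rho>, W r\<rangle> d\<rho>\<close>. Replacing \<open>W r\<close> by \<open>W \<rho>\<close>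
costs \<open>\<mu> \<rho> \<parallel>W r - W \<rho>\<parallel>\<close>, which Young's inequality splits into a small term and a strip integral.\<close>

lemma energy_inequality:
  fixes \<iota> :: "'v::{banach, second_countable_topology} \<Rightarrow>\<^sub>L 'h::{real_inner, banach, second_countable_topology}"
    and k \<mu> :: "real \<Rightarrow> real"
  assumes pq: "p > 1" "q > 1" "1 / p + 1 / q = 1"
    and w: "continuous_on {a..b} w" "AE t in lebesgue_on {a<..<b}. w t = blinfun_apply \<iota> (W t)"
    and W: "Lp_fun p {a<..<b} W"
    and int: "\<And>v. integrable (lebesgue_on {a<..<b}) (\<lambda>r. blinfun_apply (w' r) v)"
    and weak: "\<And>s t v. a < s \<Longrightarrow> s < t \<Longrightarrow> t < b \<Longrightarrow>
      integral {s..t} (\<lambda>r. blinfun_apply (w' r) v) = inner (w t - w s) (blinfun_apply \<iota> v)"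
    and \<mu>: "AE r in lebesgue_on {a<..<b}. norm (w' r) \<le> \<mu> r" "Lp_fun q {a<..<b} \<mu>"
    and k: "integrable (lebesgue_on {a<..<b}) k" "AE r in lebesgue_on {a<..<b}. blinfun_apply (w' r) (W r) \<le> k r"
    and st: "a \<le> s" "s \<le> t" "t \<le> b"
  shows "(norm (w t))\<^sup>2 - (norm (w s))\<^sup>2 \<le> 2 * integral {s..t} k"
proof (rule field_le_epsilon)
  fix e0 :: real assume "e0 > 0"
  have imu: "integrable (lebesgue_on {a<..<b}) (\<lambda>r. norm (\<mu> r) powr q)"
    using \<mu>(2) by (simp add: Lp_fun_def)
  define Q where "Q = integral {s..t} (\<lambda>r. norm (\<mu> r) powr q)"
  have Q0: "Q \<ge> 0" unfolding Q_def
    by (rule integral_nonneg[OF integrable_Ioo_imp_HK(1)[OF imu st(1,3)]]) simp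
  \<comment> \<open>Makes the total Young term \<open>2 * \<eta> * Q\<close> at most
    \<open>e0\<close>.\<close>
  define \<eta> where "\<eta> = e0 / (2 * (1 + Q))"
  have \<eta>: "\<eta> > 0" "2 * \<eta> * Q \<le> e0" using \<open>e0 > 0\<close> Q0 by (auto simp: \<eta>_def field_simps)
  obtain C where C: "C > 0" "\<And>x y. x \<ge> 0 \<Longrightarrow> y \<ge> 0 \<Longrightarrow> x * y \<le> \<eta> * x powr q + C * y powr p"
    using Youngs_inequality_small[OF pq \<eta>(1)] by blast
  \<comment> \<open>Twice the given majorant plus the small term of Young's inequality. The claim,
    up to \<open>e0\<close>, then says that |w|^2 minus the primitive of \<open>K\<close> is
    nonincreasing.\<close>
  define K where "K r = 2 * k r + 2 * \<eta> * norm (\<mu> r) powr q" for r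
  have iK: "integrable (lebesgue_on {a<..<b}) K"
    unfolding K_def using k(1) imu by simp
  define G where "G r = (norm (w r))\<^sup>2 - integral {a..r} K" for r
  have Gc: "continuous_on {a..b} G"
    unfolding G_def
    by (intro continuous_intros w(1) indefinite_integral_continuous_1 integrable_Ioo_imp_HK(1)[OF iK]) auto
  \<comment> \<open>Extension by zero makes the strip estimate on the whole line applicable; only
    pairs inside the interval are ever compared.\<close>
  define W0 where "W0 t = indicator {a<..<b} t *\<^sub>R W t" for t
  have mW0: "W0 \<in> borel_measurable lebesgue"
    using W borel_measurable_restrict_space_iff[of "{a<..<b}" lebesgue W]
    unfolding Lp_fun_def W0_def by simp
  have W0p: "(\<integral>\<^sup>+t. ennreal (norm (W0 t) powr p) \<partial>lebesgue) < \<infinity>"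
  proof -
    have "(\<integral>\<^sup>+t. ennreal (norm (W0 t) powr p) \<partial>lebesgue) = (\<integral>\<^sup>+t. ennreal (norm (W t) powr p) * indicator {a<..<b} t \<partial>lebesgue)"
      using pq by (intro nn_integral_cong) (auto simp: W0_def split: split_indicator)
    also have "\<dots> = (\<integral>\<^sup>+t. ennreal (norm (W t) powr p) \<partial>lebesgue_on {a<..<b})"
      by (rule nn_integral_restrict_space[symmetric]) simp
    also have "\<dots> < \<infinity>"
      using W unfolding Lp_fun_def integrable_iff_bounded by simp
    finally show ?thesis .
  qed
  have bW0: "bounded {t. W0 t \<noteq> 0}"
    by (rule bounded_subset[of "{a..b}"]) (auto simp: W0_def split: split_indicator_asm)
  define R where "R r \<rho> = ennreal (2 * C) * ennreal (norm (W0 r - W0 \<rho>) powr p)" for r \<rho>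
  have G_anti: "G t' \<le> G s'" if st': "a < s'" "s' < t'" "t' < b" for s' t'
  proof (rule le_of_strip_difference[OF Gc st', where R=R])
    fix e :: real assume "e > 0"
    then have "e / (2 * C) > 0" using C by simp
    from strip_small[OF mW0 W0p bW0 _ this] pq obtain h0 where h0: "h0 > 0" "\<And>h. 0 < h \<Longrightarrow> h < h0 \<Longrightarrow>
       (\<integral>\<^sup>+r. \<integral>\<^sup>+\<rho>. ennreal (norm (W0 r - W0 \<rho>) powr p) * indicator {r - h<..<r} \<rho> \<partial>lebesgue \<partial>lebesgue) \<le> ennreal (e / (2 * C) * h)"
      by auto
    show "\<exists>h0>0. \<forall>h. 0 < h \<longrightarrow> h < h0 \<longrightarrow>
      (\<integral>\<^sup>+r. \<integral>\<^sup>+\<rho>. R r \<rho> * indicator {r - h<..<r} \<rho> \<partial>lebesgue \<partial>lebesgue) \<le> ennreal (e * h)"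
    proof (intro exI[of _ h0] conjI allI impI h0(1))
      fix h assume h: "0 < h" "h < h0"
      have mpair: "(\<lambda>(r, \<rho>). ennreal (norm (W0 r - W0 \<rho>) powr p)) \<in> borel_measurable (lebesgue \<Otimes>\<^sub>M lebesgue)"
      proof -
        have [measurable]: "(\<lambda>z. W0 (fst z)) \<in> borel_measurable (lebesgue \<Otimes>\<^sub>M (lebesgue :: real measure))"
          "(\<lambda>z. W0 (snd z)) \<in> borel_measurable ((lebesgue :: real measure) \<Otimes>\<^sub>M lebesgue)"
          by (rule measurable_compose[OF measurable_fst mW0], rule measurable_compose[OF measurable_snd mW0])
        show ?thesis unfolding case_prod_unfold by measurable
      qed
      have mone: "(\<lambda>\<rho>. ennreal (norm (W0 r - W0 \<rho>) powr p) * indicator {r - h<..<r} \<rho>) \<in> borel_measurable lebesgue" for r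
      proof (rule borel_measurable_times_ennreal)
        show "(\<lambda>\<rho>. ennreal (norm (W0 r - W0 \<rho>) powr p)) \<in> borel_measurable lebesgue"
          using mW0 by measurable
      qed simp
      have "(\<integral>\<^sup>+r. \<integral>\<^sup>+\<rho>. R r \<rho> * indicator {r - h<..<r} \<rho> \<partial>lebesgue \<partial>lebesgue)
          = ennreal (2 * C) * (\<integral>\<^sup>+r. \<integral>\<^sup>+\<rho>. ennreal (norm (W0 r - W0 \<rho>) powr p) * indicator {r - h<..<r} \<rho> \<partial>lebesgue \<partial>lebesgue)"
        unfolding R_def mult.assoc nn_integral_cmult[OF mone]
        by (rule nn_integral_cmult) (rule strip_integral_measurable[OF mpair])
      also have "\<dots> \<le> ennreal (2 * C) * ennreal (e / (2 * C) * h)"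
        by (intro mult_left_mono h0(2) h) auto
      also have "\<dots> = ennreal (e * h)"
        using C h(1) \<open>e > 0\<close> by (subst ennreal_mult[symmetric]) auto
      finally show "(\<integral>\<^sup>+r. \<integral>\<^sup>+\<rho>. R r \<rho> * indicator {r - h<..<r} \<rho> \<partial>lebesgue \<partial>lebesgue) \<le> ennreal (e * h)" .
    qed
  next
    \<comment> \<open>Only the upper endpoint \<open>r\<close> has to be a time at which
      \<open>w r\<close> is the image of \<open>W r\<close>. The exceptional null set is therefore
      independent of \<open>s\<close>, as the strip lemma requires.\<close>
    have "AE r in lebesgue. r \<in> {a<..<b} \<longrightarrow> w r = blinfun_apply \<iota> (W r)"
      using w(2) by (simp add: AE_restrict_space_iff)
    then show "AE r in lebesgue. r \<in> {a<..<b} \<longrightarrow> (\<forall>s. a < s \<longrightarrow> s < r \<longrightarrow>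
      ennreal (G r - G s) \<le> (\<integral>\<^sup>+\<rho>. R r \<rho> * indicator {s<..<r} \<rho> \<partial>lebesgue))"
    proof eventually_elim
      case (elim r)
      show ?case
      proof (intro impI allI)
        fix s assume r: "r \<in> {a<..<b}" and s: "a < s" "s < r"
        have wr: "w r = blinfun_apply \<iota> (W r)" using elim r by simp
        define D where "D \<rho> = 2 * blinfun_apply (w' \<rho>) (W r) - K \<rho>" for \<rho>
        have iD: "integrable (lebesgue_on {a<..<b}) D"
          unfolding D_def using int[of "W r"] iK by simp
        have iD': "integrable (lebesgue_on {s<..<r}) D"
          using r s by (intro integrable_lebesgue_on_subset[OF iD]) auto
        have "(norm (w r))\<^sup>2 - (norm (w s))\<^sup>2 \<le> 2 * inner (w r - w s) (w r)"
        proof -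
          have "(norm (w r - w s))\<^sup>2 \<ge> 0" by simp
          then show ?thesis
            unfolding power2_norm_eq_inner by (simp add: inner_diff_left inner_diff_right inner_commute)
        qed
        also have "\<dots> = 2 * integral {s..r} (\<lambda>\<rho>. blinfun_apply (w' \<rho>) (W r))"
          using weak[of s r "W r"] r s wr by simp
        finally have n: "(norm (w r))\<^sup>2 - (norm (w s))\<^sup>2 \<le> 2 * integral {s..r} (\<lambda>\<rho>. blinfun_apply (w' \<rho>) (W r))" .
        have "integral {a..r} K = integral {a..s} K + integral {s..r} K"
          using r s by (intro Henstock_Kurzweil_Integration.integral_combine[symmetric] integrable_Ioo_imp_HK(1)[OF iK]) auto
        then have "G r - G s \<le> 2 * integral {s..r} (\<lambda>\<rho>. blinfun_apply (w' \<rho>) (W r)) - integral {s..r} K"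
          unfolding G_def using n by linarith
        also have "\<dots> = integral {s..r} D"
          unfolding D_def using r s
          by (subst integral_diff) (auto intro!: integrable_on_mult_right integrable_Ioo_imp_HK(1)[OF int] integrable_Ioo_imp_HK(1)[OF iK])
        also have "\<dots> = integral\<^sup>L (lebesgue_on {s<..<r}) D"
          using integrable_Ioo_imp_HK(3)[OF iD, of s r] r s by simp
        finally have "ennreal (G r - G s) \<le> ennreal (integral\<^sup>L (lebesgue_on {s<..<r}) D)"
          by (rule ennreal_leI)
        also have "\<dots> \<le> (\<integral>\<^sup>+\<rho>. ennreal (D \<rho>) \<partial>lebesgue_on {s<..<r})"
          by (rule ennreal_integral_le_nn_integral[OF iD'])
        also have "\<dots> \<le> (\<integral>\<^sup>+\<rho>. R r \<rho> \<partial>lebesgue_on {s<..<r})"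
        proof (rule nn_integral_mono_AE)
          have sub: "{s<..<r} \<subseteq> {a<..<b}" using r s by auto
          have "AE \<rho> in lebesgue_on {s<..<r}. norm (w' \<rho>) \<le> \<mu> \<rho>" "AE \<rho> in lebesgue_on {s<..<r}. blinfun_apply (w' \<rho>) (W \<rho>) \<le> k \<rho>"
            by (rule AE_lebesgue_on_subset[OF \<mu>(1) sub], auto)
              (rule AE_lebesgue_on_subset[OF k(2) sub], auto)
          then show "AE \<rho> in lebesgue_on {s<..<r}. ennreal (D \<rho>) \<le> R r \<rho>"
            using AE_space
          proof eventually_elim
            case (elim \<rho>)
            then have \<rho>: "\<rho> \<in> {a<..<b}" using sub by auto
            have "blinfun_apply (w' \<rho>) (W r) = blinfun_apply (w' \<rho>) (W \<rho>) + blinfun_apply (w' \<rho>) (W r - W \<rho>)"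
              by (simp add: blinfun.diff_right)
            also have "blinfun_apply (w' \<rho>) (W r - W \<rho>) \<le> norm (w' \<rho>) * norm (W r - W \<rho>)"
              using norm_blinfun[of "w' \<rho>" "W r - W \<rho>"] by simp
            also have "norm (w' \<rho>) * norm (W r - W \<rho>) \<le> \<eta> * norm (w' \<rho>) powr q + C * norm (W r - W \<rho>) powr p"
              by (rule C(2)) auto
            also have "norm (w' \<rho>) powr q \<le> norm (\<mu> \<rho>) powr q"
              using elim pq by (intro powr_mono2) auto
            also have "blinfun_apply (w' \<rho>) (W \<rho>) \<le> k \<rho>" using elim by simp
            finally have "D \<rho> \<le> 2 * C * norm (W r - W \<rho>) powr p"
              unfolding D_def K_def using \<eta>(1) by simp
            moreover have "W r - W \<rho> = W0 r - W0 \<rho>" using r \<rho> by (simp add: W0_def)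
            ultimately show ?case
              unfolding R_def using C(1) by (simp add: ennreal_mult[symmetric] ennreal_leI)
          qed
        qed
        also have "\<dots> = (\<integral>\<^sup>+\<rho>. R r \<rho> * indicator {s<..<r} \<rho> \<partial>lebesgue)"
          by (rule nn_integral_restrict_space) simp
        finally show "ennreal (G r - G s) \<le> (\<integral>\<^sup>+\<rho>. R r \<rho> * indicator {s<..<r} \<rho> \<partial>lebesgue)" .
      qed
    qed
  qed
  have "G t \<le> G s" by (rule antimono_on_closed[OF Gc G_anti st])
  moreover have "integral {a..t} K = integral {a..s} K + integral {s..t} K"
    using st by (intro Henstock_Kurzweil_Integration.integral_combine[symmetric] integrable_Ioo_imp_HK(1)[OF iK]) auto
  moreover have "integral {s..t} K = 2 * integral {s..t} k + 2 * \<eta> * Q"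
    unfolding K_def Q_def
    by (subst integral_add) (auto intro!: integrable_on_mult_right integrable_Ioo_imp_HK(1)[OF k(1)] integrable_Ioo_imp_HK(1)[OF imu]
        integrable_Ioo_imp_HK(1)[OF imu[unfolded real_norm_def]] st)
  ultimately show "(norm (w t))\<^sup>2 - (norm (w s))\<^sup>2 \<le> 2 * integral {s..t} k + e0"
    using \<eta>(2) unfolding G_def by linarith
qed

section \<open>A priori bounds for trajectories\<close>

text \<open>The data needed by the energy method. The derivative enters only through its integrals
  over inner subintervals, paired with fixed vectors, so test functions do not appear beyond this
  point except in the concatenation of trajectories.\<close>

definition solves ::
  "('v::{banach, second_countable_topology} \<Rightarrow>\<^sub>L 'h::{real_inner, banach, second_countable_topology})
     \<Rightarrow> (real \<Rightarrow> 'v \<Rightarrow> ('v \<Rightarrow>\<^sub>L real)) \<Rightarrow> real \<Rightarrow> real \<Rightarrow> real \<Rightarrow> real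
     \<Rightarrow> (real \<Rightarrow> 'h) \<Rightarrow> (real \<Rightarrow> 'h) \<Rightarrow> (real \<Rightarrow> 'v) \<Rightarrow> (real \<Rightarrow> ('v \<Rightarrow>\<^sub>L real)) \<Rightarrow> bool" where
  "solves \<iota> A p q a b x f X X' \<longleftrightarrow>
     continuous_on {a..b} x \<and> f \<in> borel_measurable (lebesgue_on {a<..<b}) \<and>
     Lp_fun p {a<..<b} X \<and> Lp_fun q {a<..<b} X' \<and>
     (AE t in lebesgue_on {a<..<b}. x t = blinfun_apply \<iota> (X t)) \<and>
     (AE t in lebesgue_on {a<..<b}. X' t + A t (X t) = to_dual \<iota> (f t)) \<and>
     (\<forall>s t v. a < s \<longrightarrow> s < t \<longrightarrow> t < b \<longrightarrow>
        integral {s..t} (\<lambda>r. blinfun_apply (X' r) v) = inner (x t - x s) (blinfun_apply \<iota> v))"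

lemma trajectory_solves:
  assumes "trajectory_with \<iota> A p q T L t0 x0 x f" "0 \<le> t0" "p \<ge> 1" "q \<ge> 1"
  obtains X X' where "solves \<iota> A p q t0 T x f X X'"
proof -
  obtain X X' where W: "Wpq \<iota> p q t0 T X X'" "AE t in lebesgue_on {t0<..<T}. x t = blinfun_apply \<iota> (X t)"
    "AE t in lebesgue_on {t0<..<T}. X' t + A t (X t) = to_dual \<iota> (f t)"
    using assms(1) unfolding trajectory_with_def by blast
  have c: "continuous_on {t0..T} x"
    using assms(1,2) unfolding trajectory_with_def paths_def by (auto intro: continuous_on_subset)
  have "solves \<iota> A p q t0 T x f X X'"
    unfolding solves_def
    using W c assms(1) Wpq_weak_identity[OF W(1) assms(3,4) c W(2)]
    by (auto simp: Wpq_def trajectory_with_def Lp_fun_def)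
  then show ?thesis by (rule that)
qed

lemma integrable_bounded_inner:
  fixes f x :: "real \<Rightarrow> 'h::{real_inner, banach, second_countable_topology}"
  assumes f: "f \<in> borel_measurable (lebesgue_on {a<..<b})" "AE t in lebesgue_on {a<..<b}. norm (f t) \<le> C"
    and x: "continuous_on {a..b} x"
  shows "integrable (lebesgue_on {a<..<b}) (\<lambda>t. inner (f t) (x t))"
proof -
  obtain D where D: "\<And>t. t \<in> {a..b} \<Longrightarrow> norm (x t) \<le> D"
    using compact_imp_bounded[OF compact_continuous_image[OF x compact_Icc]]
    unfolding bounded_iff by blast
  have mx: "x \<in> borel_measurable (lebesgue_on {a<..<b})" by (rule continuous_on_measurable_open_interval[OF x])
  show ?thesis
  proof (rule Bochner_Integration.integrable_bound)
    show "integrable (lebesgue_on {a<..<b}) (\<lambda>t. \<bar>C\<bar> * \<bar>D\<bar>)" by (rule integrable_const_lebesgue_on)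
    show "(\<lambda>t. inner (f t) (x t)) \<in> borel_measurable (lebesgue_on {a<..<b})"
      using f(1) mx by measurable
    show "AE t in lebesgue_on {a<..<b}. norm (inner (f t) (x t)) \<le> norm (\<bar>C\<bar> * \<bar>D\<bar>)"
      using f(2) AE_space
    proof eventually_elim
      case (elim t)
      have "\<bar>inner (f t) (x t)\<bar> \<le> norm (f t) * norm (x t)" by (rule Cauchy_Schwarz_ineq2)
      also have "\<dots> \<le> \<bar>C\<bar> * \<bar>D\<bar>"
        using elim D[of t] by (intro mult_mono) auto
      finally show ?case by simp
    qed
  qed
qed

text \<open>The sum of the norms serves as the bound \<mu> of the energy inequality for a difference
  of trajectories. It is a real function, so measurability of a difference in the dual never has to
  be discussed.\<close>

lemma Lp_fun_norm_add:
  fixes X Y :: "real \<Rightarrow> 'b::real_normed_vector"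
  assumes "Lp_fun p S X" "Lp_fun p S Y" "p > 0"
  shows "Lp_fun p S (\<lambda>t. norm (X t) + norm (Y t))"
proof -
  have m: "(\<lambda>t. norm (X t)) \<in> borel_measurable (lebesgue_on S)" "(\<lambda>t. norm (Y t)) \<in> borel_measurable (lebesgue_on S)"
    using assms unfolding Lp_fun_def
    by (auto intro!: measurable_compose[of _ _ borel norm] borel_measurable_continuous_onI continuous_intros)
  have "integrable (lebesgue_on S) (\<lambda>t. norm (norm (X t) + norm (Y t)) powr p)"
  proof (rule Bochner_Integration.integrable_bound)
    show "integrable (lebesgue_on S) (\<lambda>t. 3 powr p * (norm (X t) powr p + norm (Y t) powr p))"
      using assms unfolding Lp_fun_def by simp
    show "(\<lambda>t. norm (norm (X t) + norm (Y t)) powr p) \<in> borel_measurable (lebesgue_on S)"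
      using m by measurable
    show "AE t in lebesgue_on S. norm (norm (norm (X t) + norm (Y t)) powr p) \<le> norm (3 powr p * (norm (X t) powr p + norm (Y t) powr p))"
      using norm_powr_triangle3[OF assms(3), of "norm (X _)" "norm (Y _)" 0] assms(3) by (intro AE_I2) simp
  qed
  then show ?thesis unfolding Lp_fun_def using m by simp
qed

lemma Lp_fun_diff:
  fixes X Y :: "real \<Rightarrow> 'b::{real_normed_vector, second_countable_topology}"
  assumes "Lp_fun p S X" "Lp_fun p S Y" "p > 0"
  shows "Lp_fun p S (\<lambda>t. X t - Y t)"
proof -
  have m: "(\<lambda>t. X t - Y t) \<in> borel_measurable (lebesgue_on S)"
    using assms unfolding Lp_fun_def by (intro borel_measurable_diff) auto
  have "integrable (lebesgue_on S) (\<lambda>t. norm (X t - Y t) powr p)"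
  proof (rule Bochner_Integration.integrable_bound)
    show "integrable (lebesgue_on S) (\<lambda>t. norm (norm (X t) + norm (Y t)) powr p)"
      using Lp_fun_norm_add[OF assms] by (simp add: Lp_fun_def)
    show "(\<lambda>t. norm (X t - Y t) powr p) \<in> borel_measurable (lebesgue_on S)"
      using m by measurable
    show "AE t in lebesgue_on S. norm (norm (X t - Y t) powr p) \<le> norm (norm (norm (X t) + norm (Y t)) powr p)"
      using norm_triangle_ineq4 assms(3) by (intro AE_I2) (auto intro!: powr_mono2)
  qed
  then show ?thesis unfolding Lp_fun_def using m by simp
qed

lemma admissible_operator_AE:
  assumes A: "admissible_operator T p q A" and t0: "0 \<le> t0"
  shows "AE t in lebesgue_on {t0<..<T}. \<forall>x y. blinfun_apply (A t x - A t y) (x - y) \<ge> 0"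
    and "\<exists>a1 c1. Lp_fun q {t0<..<T} (a1 :: real \<Rightarrow> real) \<and> c1 \<ge> 0 \<and>
        (AE t in lebesgue_on {t0<..<T}. \<forall>x. norm (A t x) \<le> a1 t + c1 * norm x powr (p - 1))"
    and "\<exists>c2>0. AE t in lebesgue_on {t0<..<T}. \<forall>x. blinfun_apply (A t x) x \<ge> c2 * norm x powr p"
proof -
  have sub: "{t0<..<T} \<subseteq> {0..T}" using t0 by auto
  note r = AE_lebesgue_on_subset[OF _ sub]
  show "AE t in lebesgue_on {t0<..<T}. \<forall>x y. blinfun_apply (A t x - A t y) (x - y) \<ge> 0"
    using A unfolding admissible_operator_def by (intro r) auto
  show "\<exists>c2>0. AE t in lebesgue_on {t0<..<T}. \<forall>x. blinfun_apply (A t x) x \<ge> c2 * norm x powr p"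
  proof -
    obtain c2 where c2: "c2 > 0" "AE t in lebesgue_on {0..T}. \<forall>x. blinfun_apply (A t x) x \<ge> c2 * norm x powr p"
      using A unfolding admissible_operator_def by blast
    show ?thesis by (intro exI[of _ c2] conjI c2(1) r[OF c2(2)]) auto
  qed
  show "\<exists>a1 c1. Lp_fun q {t0<..<T} (a1 :: real \<Rightarrow> real) \<and> c1 \<ge> 0 \<and>
        (AE t in lebesgue_on {t0<..<T}. \<forall>x. norm (A t x) \<le> a1 t + c1 * norm x powr (p - 1))"
  proof -
    obtain a1 c1 where a: "Lp_fun q {0..T} (a1 :: real \<Rightarrow> real)" "c1 \<ge> 0"
        "AE t in lebesgue_on {0..T}. \<forall>x. norm (A t x) \<le> a1 t + c1 * norm x powr (p - 1)"
      using A unfolding admissible_operator_def by blast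
    have "Lp_fun q {t0<..<T} a1" by (rule Lp_fun_subset[OF a(1) sub]) auto
    then show ?thesis using a(2) r[OF a(3)] by auto
  qed
qed

lemma solves_energy_diff:
  assumes pq: "p \<ge> 2" "q > 1" "1 / p + 1 / q = 1"
    and A: "admissible_operator T p q A" and t0: "0 \<le> t0"
    and x: "solves \<iota> A p q t0 T x f X X'" "AE t in lebesgue_on {t0<..<T}. norm (f t) \<le> C"
    and y: "solves \<iota> A p q t0 T y g Y Y'" "AE t in lebesgue_on {t0<..<T}. norm (g t) \<le> C"
    and st: "t0 \<le> s" "s \<le> t" "t \<le> T"
  shows "(norm (x t - y t))\<^sup>2 - (norm (x s - y s))\<^sup>2 \<le> 2 * integral {s..t} (\<lambda>r. inner (f r - g r) (x r - y r))"
    and "integrable (lebesgue_on {t0<..<T}) (\<lambda>r. inner (f r - g r) (x r - y r))"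
proof -
  let ?M = "lebesgue_on {t0<..<T}"
  have cxy: "continuous_on {t0..T} (\<lambda>r. x r - y r)"
    using x(1) y(1) unfolding solves_def by (intro continuous_intros) auto
  have mf: "(\<lambda>r. f r - g r) \<in> borel_measurable ?M"
    using x(1) y(1) unfolding solves_def by (intro borel_measurable_diff) auto
  have "AE t in ?M. norm (f t - g t) \<le> 2 * C"
    using x(2) y(2)
  proof eventually_elim
    case (elim r)
    then show ?case using norm_triangle_ineq4[of "f r" "g r"] by linarith
  qed
  from integrable_bounded_inner[OF mf this cxy]
  show ik: "integrable ?M (\<lambda>r. inner (f r - g r) (x r - y r))" .
  have ix: "integrable ?M (\<lambda>r. blinfun_apply (X' r) v)" "integrable ?M (\<lambda>r. blinfun_apply (Y' r) v)" for v
    using x(1) y(1) pq unfolding solves_def by (auto intro: Lp_fun_apply_integrable)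
  show "(norm (x t - y t))\<^sup>2 - (norm (x s - y s))\<^sup>2 \<le> 2 * integral {s..t} (\<lambda>r. inner (f r - g r) (x r - y r))"
  proof (rule energy_inequality[where a=t0 and b=T and p=p and q=q and \<iota>=\<iota> and W="\<lambda>r. X r - Y r" and w'="\<lambda>r. X' r - Y' r"
        and \<mu>="\<lambda>r. norm (X' r) + norm (Y' r)", OF _ _ _ cxy _ _ _ _ _ _ ik _ st])
    show "p > 1" "q > 1" "1 / p + 1 / q = 1" using pq by auto
    have ax: "AE t in ?M. x t = blinfun_apply \<iota> (X t)" "AE t in ?M. y t = blinfun_apply \<iota> (Y t)"
      using x(1) y(1) unfolding solves_def by auto
    then show xy: "AE t in ?M. x t - y t = blinfun_apply \<iota> (X t - Y t)"
      by eventually_elim (simp add: blinfun.diff_right)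
    show "Lp_fun p {t0<..<T} (\<lambda>r. X r - Y r)"
      using x(1) y(1) pq unfolding solves_def by (intro Lp_fun_diff) auto
    show "Lp_fun q {t0<..<T} (\<lambda>r. norm (X' r) + norm (Y' r))"
      using x(1) y(1) pq unfolding solves_def by (intro Lp_fun_norm_add) auto
    show "integrable ?M (\<lambda>r. blinfun_apply (X' r - Y' r) v)" for v
      using ix[of v] by (simp add: blinfun.diff_left)
    show "integral {s..t} (\<lambda>r. blinfun_apply (X' r - Y' r) v) = inner (x t - y t - (x s - y s)) (blinfun_apply \<iota> v)"
      if "t0 < s" "s < t" "t < T" for s t v
    proof -
      have "integral {s..t} (\<lambda>r. blinfun_apply (X' r) v) = inner (x t - x s) (blinfun_apply \<iota> v)"
        "integral {s..t} (\<lambda>r. blinfun_apply (Y' r) v) = inner (y t - y s) (blinfun_apply \<iota> v)"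
        using x(1) y(1) that unfolding solves_def by auto
      moreover have "integral {s..t} (\<lambda>r. blinfun_apply (X' r - Y' r) v)
          = integral {s..t} (\<lambda>r. blinfun_apply (X' r) v) - integral {s..t} (\<lambda>r. blinfun_apply (Y' r) v)"
        unfolding blinfun.diff_left using that
        by (intro integral_diff integrable_Ioo_imp_HK(1)[OF ix(1)] integrable_Ioo_imp_HK(1)[OF ix(2)]) auto
      ultimately show ?thesis by (simp add: inner_diff_left)
    qed
    show "AE r in ?M. norm (X' r - Y' r) \<le> norm (X' r) + norm (Y' r)"
      by (intro AE_I2 norm_triangle_ineq4)
    have ex: "AE t in ?M. X' t + A t (X t) = to_dual \<iota> (f t)" "AE t in ?M. Y' t + A t (Y t) = to_dual \<iota> (g t)"
      using x(1) y(1) unfolding solves_def by auto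
    show "AE r in ?M. blinfun_apply (X' r - Y' r) (X r - Y r) \<le> inner (f r - g r) (x r - y r)"
      using ex ax admissible_operator_AE(1)[OF A t0]
    proof eventually_elim
      case (elim r)
      have "X' r = to_dual \<iota> (f r) - A r (X r)" "Y' r = to_dual \<iota> (g r) - A r (Y r)"
        using elim(1,2) by (simp_all add: eq_diff_eq)
      then have "blinfun_apply (X' r - Y' r) (X r - Y r)
          = inner (f r - g r) (x r - y r) - blinfun_apply (A r (X r) - A r (Y r)) (X r - Y r)"
        using elim(3,4) by (simp add: blinfun.diff_left blinfun.diff_right inner_diff_left inner_diff_right)
      moreover have "blinfun_apply (A r (X r) - A r (Y r)) (X r - Y r) \<ge> 0" using elim(5) by blast
      ultimately show ?case by linarith
    qed
  qed
qed

text \<open>Pairing the equation with \<open>X\<close> and using coercivity keeps the term with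
  \<open>c2\<close> on the right-hand side; it is the source of the bound in
  \<open>L\<^sup>p(V)\<close>.\<close>

lemma solves_energy:
  assumes pq: "p \<ge> 2" "q > 1" "1 / p + 1 / q = 1"
    and c2: "AE t in lebesgue_on {t0<..<T}. \<forall>x. blinfun_apply (A t x) x \<ge> c2 * norm x powr p"
    and x: "solves \<iota> A p q t0 T x f X X'" "AE t in lebesgue_on {t0<..<T}. norm (f t) \<le> C"
    and st: "t0 \<le> s" "s \<le> t" "t \<le> T"
  shows "(norm (x t))\<^sup>2 - (norm (x s))\<^sup>2 \<le> 2 * integral {s..t} (\<lambda>r. inner (f r) (x r) - c2 * norm (X r) powr p)"
    and "integrable (lebesgue_on {t0<..<T}) (\<lambda>r. inner (f r) (x r))"
    and "integrable (lebesgue_on {t0<..<T}) (\<lambda>r. norm (X r) powr p)"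
proof -
  let ?M = "lebesgue_on {t0<..<T}"
  have cx: "continuous_on {t0..T} x" and mf: "f \<in> borel_measurable ?M"
    and LX: "Lp_fun p {t0<..<T} X" and LX': "Lp_fun q {t0<..<T} X'"
    and ax: "AE t in ?M. x t = blinfun_apply \<iota> (X t)" and ex: "AE t in ?M. X' t + A t (X t) = to_dual \<iota> (f t)"
    using x(1) unfolding solves_def by auto
  show i1: "integrable ?M (\<lambda>r. inner (f r) (x r))" by (rule integrable_bounded_inner[OF mf x(2) cx])
  show i2: "integrable ?M (\<lambda>r. norm (X r) powr p)" using LX by (simp add: Lp_fun_def)
  have ik: "integrable ?M (\<lambda>r. inner (f r) (x r) - c2 * norm (X r) powr p)" using i1 i2 by simp
  show "(norm (x t))\<^sup>2 - (norm (x s))\<^sup>2 \<le> 2 * integral {s..t} (\<lambda>r. inner (f r) (x r) - c2 * norm (X r) powr p)"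
  proof (rule energy_inequality[where a=t0 and b=T and p=p and q=q and \<iota>=\<iota> and W=X and w'=X'
        and \<mu>="\<lambda>r. norm (X' r) + norm (X' r)", OF _ _ _ cx ax LX _ _ _ _ ik _ st])
    show "p > 1" "q > 1" "1 / p + 1 / q = 1" using pq by auto
    show "Lp_fun q {t0<..<T} (\<lambda>r. norm (X' r) + norm (X' r))"
      using LX' pq by (intro Lp_fun_norm_add) auto
    show "integrable ?M (\<lambda>r. blinfun_apply (X' r) v)" for v
      using LX' pq by (intro Lp_fun_apply_integrable) auto
    show "integral {s..t} (\<lambda>r. blinfun_apply (X' r) v) = inner (x t - x s) (blinfun_apply \<iota> v)"
      if "t0 < s" "s < t" "t < T" for s t v
      using x(1) that unfolding solves_def by auto
    show "AE r in ?M. norm (X' r) \<le> norm (X' r) + norm (X' r)" by (intro AE_I2) simp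
    show "AE r in ?M. blinfun_apply (X' r) (X r) \<le> inner (f r) (x r) - c2 * norm (X r) powr p"
      using ex ax c2
    proof eventually_elim
      case (elim r)
      have "X' r = to_dual \<iota> (f r) - A r (X r)" using elim(1) by (simp add: eq_diff_eq)
      then have "blinfun_apply (X' r) (X r) = inner (f r) (x r) - blinfun_apply (A r (X r)) (X r)"
        using elim(2) by (simp add: blinfun.diff_left)
      then show ?case using elim(3) by (smt (verit))
    qed
  qed
qed

lemma run_sup_le:
  assumes "0 \<le> t" "\<And>s. s \<in> {0..t} \<Longrightarrow> norm (x s) \<le> R"
  shows "run_sup x t \<le> R"
  unfolding run_sup_def using assms by (intro cSUP_least) auto

lemma paths_bounded:
  fixes x :: "real \<Rightarrow> 'h::real_normed_vector"
  assumes "x \<in> paths T"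
  obtains B where "B \<ge> 0" "\<And>t. t \<in> {0..T} \<Longrightarrow> norm (x t) \<le> B"
proof -
  have c: "continuous_on {0..T} x" using assms by (simp add: paths_def)
  obtain B where B: "\<And>t. t \<in> {0..T} \<Longrightarrow> norm (x t) \<le> B"
    using compact_imp_bounded[OF compact_continuous_image[OF c compact_Icc]] unfolding bounded_iff by blast
  show ?thesis by (rule that[of "max B 0"]) (use B in \<open>auto simp: le_max_iff_disj\<close>)
qed

lemma trajectory_source_bound:
  assumes tr: "trajectory_with \<iota> A p q T L t0 x0 x f" and t0: "0 \<le> t0" and L: "L \<ge> 0"
    and R: "\<And>t. t \<in> {0..T} \<Longrightarrow> norm (x t) \<le> R"
  shows "AE t in lebesgue_on {t0<..<T}. norm (f t) \<le> L * (1 + R)"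
proof -
  have "AE t in lebesgue_on {t0<..<T}. norm (f t) \<le> L * (1 + run_sup x t)"
    using tr unfolding trajectory_with_def by blast
  then show ?thesis
    using AE_space
  proof eventually_elim
    case (elim t)
    have "run_sup x t \<le> R" using elim t0 R by (intro run_sup_le) auto
    then have "L * (1 + run_sup x t) \<le> L * (1 + R)" using L by (intro mult_left_mono) auto
    then show ?case using elim by linarith
  qed
qed

text \<open>A Gronwall argument in the form of a weighted maximum, since the source at time r is
  bounded through the running supremum and not through the present value. If exp (- \<kappa> t) |x
  t|^2 attains its maximum m at tm, then all earlier values, hence also the running supremum, are
  controlled by m. The energy inequality up to tm bounds m by data plus m / 2.\<close>

lemma trajectory_bound:
  assumes pq: "p \<ge> 2" "q > 1" "1 / p + 1 / q = 1"
    and A: "admissible_operator T p q A" and t0: "0 \<le> t0" "t0 < T" and x0: "x0 \<in> paths T" and L: "L \<ge> 0"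
  shows "\<exists>R\<ge>0. \<forall>x f. trajectory_with \<iota> A p q T L t0 x0 x f \<longrightarrow> (\<forall>t\<in>{0..T}. norm (x t) \<le> R)"
proof -
  obtain B where B: "B \<ge> 0" "\<And>t. t \<in> {0..T} \<Longrightarrow> norm (x0 t) \<le> B" using paths_bounded[OF x0] by blast
  obtain c2 where c2: "c2 > 0" "AE t in lebesgue_on {t0<..<T}. \<forall>x. blinfun_apply (A t x) x \<ge> c2 * norm x powr p"
    using admissible_operator_AE(3)[OF A t0(1)] by blast
  \<comment> \<open>With this rate the self-referential term \<open>4 * L * m / \<kappa>\<close> is
    at most \<open>m / 2\<close> and is absorbed; this is also the reason for the factor 2 in
    \<open>m0\<close>.\<close>
  define \<kappa> where "\<kappa> = 8 * L + 1"
  have lam: "\<kappa> > 0" using L by (simp add: \<kappa>_def)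
  define m0 where "m0 = 2 * (B\<^sup>2 + 2 * L * T)"
  have m0: "m0 \<ge> 0" using L t0 by (simp add: m0_def)
  define R where "R = sqrt (exp (\<kappa> * T) * m0)"
  have "norm (x t) \<le> R" if tr: "trajectory_with \<iota> A p q T L t0 x0 x f" and t: "t \<in> {0..T}" for x f t
  proof -
    obtain X X' where sol: "solves \<iota> A p q t0 T x f X X'"
      using trajectory_solves[OF tr t0(1)] pq by auto
    have xp: "x \<in> paths T" and x_init: "\<And>t. t \<in> {0..t0} \<Longrightarrow> x t = x0 t"
      and fb: "AE t in lebesgue_on {t0<..<T}. norm (f t) \<le> L * (1 + run_sup x t)"
      using tr unfolding trajectory_with_def by auto
    obtain B' where B': "\<And>t. t \<in> {0..T} \<Longrightarrow> norm (x t) \<le> B'" using paths_bounded[OF xp] by blast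
    have fC: "AE t in lebesgue_on {t0<..<T}. norm (f t) \<le> L * (1 + B')"
      by (rule trajectory_source_bound[OF tr t0(1) L B'])
    define N where "N t = (norm (x t))\<^sup>2" for t
    have "continuous_on {0..T} (\<lambda>t. exp (- \<kappa> * t) * N t)"
      unfolding N_def using xp by (intro continuous_intros) (simp add: paths_def)
    then obtain tm where tm: "tm \<in> {0..T}" "\<And>t. t \<in> {0..T} \<Longrightarrow> exp (- \<kappa> * t) * N t \<le> exp (- \<kappa> * tm) * N tm"
      using continuous_attains_sup[of "{0..T}" "\<lambda>t. exp (- \<kappa> * t) * N t"] t0 by auto
    define m where "m = exp (- \<kappa> * tm) * N tm"
    have m_nonneg: "m \<ge> 0" by (simp add: m_def N_def)
    have Nle: "N s \<le> exp (\<kappa> * s) * m" if "s \<in> {0..T}" for s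
    proof -
      have "exp (\<kappa> * s) * (exp (- \<kappa> * s) * N s) \<le> exp (\<kappa> * s) * m"
        using tm(2)[OF that] unfolding m_def by (intro mult_left_mono) auto
      then show ?thesis by (simp add: mult.assoc[symmetric] exp_add[symmetric])
    qed
    have m_le: "m \<le> m0"
    proof (cases "tm \<le> t0")
      case True
      then have "norm (x tm) \<le> B" using tm(1) x_init[of tm] B(2)[of tm] by simp
      then have "N tm \<le> B\<^sup>2" unfolding N_def by (intro power_mono) auto
      moreover have "exp (- \<kappa> * tm) \<le> 1" using lam tm(1) by simp
      ultimately have "m \<le> 1 * B\<^sup>2" unfolding m_def by (intro mult_mono) (auto simp: N_def)
      also have "\<dots> \<le> m0" using L t0 by (simp add: m0_def)
      finally show ?thesis .
    next
      case False
      \<comment> \<open>The product of the source bound and the path bound is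
        \<open>L * (1 + \<rho>) * \<rho>\<close>, which is at most
        \<open>L * (1 + 2 * \<rho>\<^sup>2)\<close> with
        \<open>\<rho>\<^sup>2 = exp (\<kappa> * r) * m\<close>.\<close>
      define b where "b r = L * (1 + 2 * (exp (\<kappa> * r) * m))" for r
      have b0: "b r \<ge> 0" for r using L m_nonneg by (simp add: b_def)
      have cb: "continuous_on S b" for S unfolding b_def by (intro continuous_intros)
      have ib: "integrable (lebesgue_on {t0..tm}) b" by (rule continuous_imp_integrable_real[OF cb])
      let ?k = "\<lambda>r. inner (f r) (x r) - c2 * norm (X r) powr p"
      have ik: "integrable (lebesgue_on {t0<..<T}) ?k"
        using solves_energy(2,3)[OF pq c2(2) sol fC, of t0 T] t0 by simp
      have "integral {t0..tm} ?k = integral\<^sup>L (lebesgue_on {t0<..<tm}) ?k"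
        using integrable_Ioo_imp_HK(3)[OF ik, of t0 tm] tm(1) by simp
      also have "\<dots> \<le> integral\<^sup>L (lebesgue_on {t0..tm}) b"
      proof (rule integral_mono_lebesgue_on_AE[OF ib])
        have sub: "{t0<..<tm} \<subseteq> {t0<..<T}" using tm(1) by auto
        have "AE r in lebesgue_on {t0<..<tm}. norm (f r) \<le> L * (1 + run_sup x r)"
          by (rule AE_lebesgue_on_subset[OF fb sub]) auto
        then show "AE r in lebesgue_on {t0<..<tm}. ?k r \<le> b r"
          using AE_space
        proof eventually_elim
          case (elim r)
          then have r: "r \<in> {t0<..<tm}" by simp
          define \<rho> where "\<rho> = sqrt (exp (\<kappa> * r) * m)"
          have \<rho>2: "\<rho>\<^sup>2 = exp (\<kappa> * r) * m" "\<rho> \<ge> 0" using m_nonneg by (auto simp: \<rho>_def)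
          have nx: "norm (x s) \<le> \<rho>" if "s \<in> {0..r}" for s
          proof -
            have "N s \<le> exp (\<kappa> * s) * m" using that r tm(1) by (intro Nle) auto
            also have "\<dots> \<le> exp (\<kappa> * r) * m" using that lam m_nonneg by (intro mult_right_mono) auto
            finally show ?thesis unfolding \<rho>_def N_def by (rule real_le_rsqrt)
          qed
          have rs: "run_sup x r \<le> \<rho>" using r t0 by (intro run_sup_le nx) auto
          have "inner (f r) (x r) \<le> norm (f r) * norm (x r)" by (rule norm_cauchy_schwarz)
          also have "\<dots> \<le> (L * (1 + \<rho>)) * \<rho>"
          proof (intro mult_mono)
            have "L * (1 + run_sup x r) \<le> L * (1 + \<rho>)" using L rs by (intro mult_left_mono) auto
            then show "norm (f r) \<le> L * (1 + \<rho>)" using elim by linarith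
            show "norm (x r) \<le> \<rho>" using r t0 by (intro nx) auto
          qed (use L \<rho>2 in auto)
          also have "\<dots> = L * (\<rho> + \<rho>\<^sup>2)" by (simp add: algebra_simps power2_eq_square)
          also have "\<dots> \<le> L * (1 + 2 * \<rho>\<^sup>2)"
          proof (intro mult_left_mono L)
            have "0 \<le> (\<rho> - 1)\<^sup>2" by simp
            then have "2 * \<rho> \<le> \<rho>\<^sup>2 + 1" by (simp add: power2_diff)
            then show "\<rho> + \<rho>\<^sup>2 \<le> 1 + 2 * \<rho>\<^sup>2" using \<rho>2(2) by simp
          qed
          also have "\<dots> = b r" unfolding b_def \<rho>2 ..
          finally show ?case using c2(1) by (smt (verit) mult_nonneg_nonneg powr_ge_zero)
        qed
        show "AE r in lebesgue_on {t0..tm}. 0 \<le> b r" using b0 by simp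
      qed auto
      also have "\<dots> = integral {t0..tm} b" by (rule lebesgue_integral_eq_integral[OF ib]) simp
      also have "\<dots> \<le> L * T + 2 * L * m * (exp (\<kappa> * tm) / \<kappa>)"
      proof -
        have "(b has_integral ((L * tm + 2 * L * m * (exp (\<kappa> * tm) / \<kappa>)) - (L * t0 + 2 * L * m * (exp (\<kappa> * t0) / \<kappa>)))) {t0..tm}"
        proof (rule fundamental_theorem_of_calculus)
          show "t0 \<le> tm" using False by simp
          show "((\<lambda>r. L * r + 2 * L * m * (exp (\<kappa> * r) / \<kappa>)) has_vector_derivative b r) (at r within {t0..tm})" for r
          proof -
            have "((\<lambda>r. L * r + 2 * L * m * (exp (\<kappa> * r) / \<kappa>)) has_real_derivative
                L * 1 + 2 * L * m * (exp (\<kappa> * r) * (\<kappa> * 1) / \<kappa>)) (at r)"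
              by (intro DERIV_add DERIV_cmult DERIV_cdivide DERIV_fun_exp DERIV_ident)
            moreover have "L * 1 + 2 * L * m * (exp (\<kappa> * r) * (\<kappa> * 1) / \<kappa>) = b r"
              using lam by (simp add: b_def algebra_simps)
            ultimately show ?thesis
              by (simp add: has_real_derivative_iff_has_vector_derivative has_vector_derivative_at_within)
          qed
        qed
        then have "integral {t0..tm} b = (L * tm + 2 * L * m * (exp (\<kappa> * tm) / \<kappa>)) - (L * t0 + 2 * L * m * (exp (\<kappa> * t0) / \<kappa>))"
          by (rule integral_unique)
        moreover have "L * tm \<le> L * T" using L tm(1) by (intro mult_left_mono) auto
        moreover have "0 \<le> L * t0" "0 \<le> 2 * L * m * (exp (\<kappa> * t0) / \<kappa>)" using L t0 m_nonneg lam by auto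
        ultimately show ?thesis by linarith
      qed
      finally have ki: "integral {t0..tm} ?k \<le> L * T + 2 * L * m * (exp (\<kappa> * tm) / \<kappa>)" .
      have "N tm - N t0 \<le> 2 * integral {t0..tm} ?k"
        unfolding N_def using solves_energy(1)[OF pq c2(2) sol fC, of t0 tm] False tm(1) by simp
      moreover have "N t0 \<le> B\<^sup>2"
        unfolding N_def using x_init[of t0] B(2)[of t0] t0 by (intro power_mono) auto
      ultimately have "N tm \<le> B\<^sup>2 + 2 * L * T + 4 * L * m * (exp (\<kappa> * tm) / \<kappa>)" using ki by linarith
      then have "m \<le> exp (- \<kappa> * tm) * (B\<^sup>2 + 2 * L * T + 4 * L * m * (exp (\<kappa> * tm) / \<kappa>))"
        unfolding m_def[symmetric] by (subst m_def, intro mult_left_mono) auto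
      also have "\<dots> = exp (- \<kappa> * tm) * (B\<^sup>2 + 2 * L * T) + 4 * L * m / \<kappa> * (exp (- \<kappa> * tm) * exp (\<kappa> * tm))"
        by (simp add: algebra_simps)
      also have "exp (- \<kappa> * tm) * exp (\<kappa> * tm) = 1" by (simp add: exp_add[symmetric])
      also have "exp (- \<kappa> * tm) * (B\<^sup>2 + 2 * L * T) \<le> 1 * (B\<^sup>2 + 2 * L * T)"
        using lam tm(1) L t0 by (intro mult_right_mono) auto
      also have "4 * L * m / \<kappa> * 1 \<le> m / 2"
      proof -
        have "8 * L * m \<le> m * \<kappa>" using m_nonneg by (simp add: \<kappa>_def algebra_simps)
        then show ?thesis using lam by (simp add: field_simps)
      qed
      finally show ?thesis by (simp add: m0_def)
    qed
    have "N t \<le> exp (\<kappa> * t) * m" by (rule Nle[OF t])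
    also have "\<dots> \<le> exp (\<kappa> * T) * m0" using m_le m_nonneg lam t by (intro mult_mono) auto
    finally show ?thesis unfolding R_def N_def by (rule real_le_rsqrt)
  qed
  moreover have "R \<ge> 0" using m0 by (simp add: R_def)
  ultimately show ?thesis by blast
qed

lemma integral_const_Ioo:
  "a \<le> b \<Longrightarrow> integral\<^sup>L (lebesgue_on {a<..<b}) (\<lambda>_. c :: real) = (b - a) * c"
  using integrable_Ioo_imp_HK(3)[of a b "\<lambda>_. c" a b] by (simp add: integrable_const_lebesgue_on)

lemma measure_lebesgue_on_Ioo:
  "a \<le> b \<Longrightarrow> measure (lebesgue_on {a<..<b}) {a<..<b :: real} = b - a"
  by (simp add: measure_restrict_space)

lemma integral_AE_le_const:
  assumes "integrable (lebesgue_on {a<..<b}) g" "AE r in lebesgue_on {a<..<b}. g r \<le> (c::real)" "a \<le> b"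
  shows "integral\<^sup>L (lebesgue_on {a<..<b}) g \<le> (b - a) * c"
proof -
  have "integral\<^sup>L (lebesgue_on {a<..<b}) g \<le> integral\<^sup>L (lebesgue_on {a<..<b}) (\<lambda>_. c)"
    by (rule integral_mono_AE[OF assms(1) integrable_const_lebesgue_on assms(2)])
  then show ?thesis unfolding integral_const_Ioo[OF assms(3)] .
qed

lemma norm_to_dual_le: "norm (to_dual \<iota> y) \<le> norm y * norm \<iota>"
proof (rule norm_blinfun_bound)
  fix v
  have "norm (blinfun_apply (to_dual \<iota> y) v) \<le> norm y * norm (blinfun_apply \<iota> v)"
    by (simp add: Cauchy_Schwarz_ineq2)
  also have "\<dots> \<le> norm y * (norm \<iota> * norm v)"
    by (intro mult_left_mono norm_blinfun) simp
  finally show "norm (blinfun_apply (to_dual \<iota> y) v) \<le> norm y * norm \<iota> * norm v"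
    by (simp add: mult.assoc)
qed simp

text \<open>The energy inequality over the whole interval, solved for the coercive term, bounds
  \<open>X\<close>; this gives \<open>M1\<close>. The equation expresses \<open>X'\<close> by the
  source and the operator, and the growth condition bounds its q-th power by the p-th power of the
  norm of \<open>X\<close> because (p - 1) q = p; this gives \<open>M2\<close>.\<close>

lemma trajectory_Lp_bounds:
  assumes pq: "p \<ge> 2" "q > 1" "1 / p + 1 / q = 1"
    and A: "admissible_operator T p q A" and t0: "0 \<le> t0" "t0 < T" and L: "L \<ge> 0"
    and R: "R \<ge> 0" "\<And>x f t. trajectory_with \<iota> A p q T L t0 x0 x f \<Longrightarrow> t \<in> {0..T} \<Longrightarrow> norm (x t) \<le> R"
  shows "\<exists>M\<ge>0. \<forall>x f X X'. trajectory_with \<iota> A p q T L t0 x0 x f \<longrightarrow> solves \<iota> A p q t0 T x f X X' \<longrightarrow>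
    integral\<^sup>L (lebesgue_on {t0<..<T}) (\<lambda>r. norm (X r) powr p) \<le> M \<and>
    integral\<^sup>L (lebesgue_on {t0<..<T}) (\<lambda>r. norm (X' r) powr q) \<le> M"
proof -
  let ?M = "lebesgue_on {t0<..<T}"
  define C where "C = L * (1 + R)"
  have C: "C \<ge> 0" using L R by (simp add: C_def)
  obtain c2 where c2: "c2 > 0" "AE t in ?M. \<forall>x. blinfun_apply (A t x) x \<ge> c2 * norm x powr p"
    using admissible_operator_AE(3)[OF A t0(1)] by blast
  obtain a1 :: "real \<Rightarrow> real" and c1 where a1: "Lp_fun q {t0<..<T} a1" "c1 \<ge> 0"
    "AE t in ?M. \<forall>x. norm (A t x) \<le> a1 t + c1 * norm x powr (p - 1)"
    using admissible_operator_AE(2)[OF A t0(1)] by blast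
  define M1 where "M1 = (R\<^sup>2 + 2 * ((T - t0) * (C * R))) / (2 * c2)"
  define \<alpha> where "\<alpha> = integral\<^sup>L ?M (\<lambda>r. norm (a1 r) powr q)"
  define M2 where "M2 = 3 powr q * (\<alpha> + c1 powr q * M1 + (T - t0) * ((C * norm \<iota>) powr q))"
  have ia: "integrable ?M (\<lambda>r. norm (a1 r) powr q)" using a1(1) by (simp add: Lp_fun_def)
  have "integral\<^sup>L ?M (\<lambda>r. norm (X r) powr p) \<le> M1 \<and> integral\<^sup>L ?M (\<lambda>r. norm (X' r) powr q) \<le> M2"
    if tr: "trajectory_with \<iota> A p q T L t0 x0 x f" and sol: "solves \<iota> A p q t0 T x f X X'" for x f X X'
  proof
    have fC: "AE t in ?M. norm (f t) \<le> C"
      unfolding C_def by (rule trajectory_source_bound[OF tr t0(1) L R(2)[OF tr]])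
    note en = solves_energy[OF pq c2(2) sol fC, of t0 T]
    have ii: "integrable ?M (\<lambda>r. inner (f r) (x r))" and iX: "integrable ?M (\<lambda>r. norm (X r) powr p)"
      using en t0 by auto
    have fx: "integral\<^sup>L ?M (\<lambda>r. inner (f r) (x r)) \<le> (T - t0) * (C * R)"
    proof (rule integral_AE_le_const[OF ii])
      show "AE r in ?M. inner (f r) (x r) \<le> C * R"
        using fC AE_space
      proof eventually_elim
        case (elim r)
        have "inner (f r) (x r) \<le> norm (f r) * norm (x r)" by (rule norm_cauchy_schwarz)
        also have "\<dots> \<le> C * R" using elim R(2)[OF tr, of r] t0 C by (intro mult_mono) auto
        finally show ?case .
      qed
    qed (use t0 in simp)
    have "integral {t0..T} (\<lambda>r. inner (f r) (x r) - c2 * norm (X r) powr p)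
        = integral\<^sup>L ?M (\<lambda>r. inner (f r) (x r)) - c2 * integral\<^sup>L ?M (\<lambda>r. norm (X r) powr p)"
      using ii iX integrable_Ioo_imp_HK(3)[of t0 T "\<lambda>r. inner (f r) (x r) - c2 * norm (X r) powr p" t0 T] by simp
    moreover have "(norm (x t0))\<^sup>2 \<le> R\<^sup>2" using R(2)[OF tr, of t0] t0 by (intro power_mono) auto
    moreover have "(norm (x T))\<^sup>2 - (norm (x t0))\<^sup>2 \<le> 2 * integral {t0..T} (\<lambda>r. inner (f r) (x r) - c2 * norm (X r) powr p)"
      using en(1) t0 by simp
    moreover have "(norm (x T))\<^sup>2 \<ge> 0" by simp
    ultimately have "2 * c2 * integral\<^sup>L ?M (\<lambda>r. norm (X r) powr p) \<le> R\<^sup>2 + 2 * ((T - t0) * (C * R))"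
      using fx unfolding mult.assoc[of 2 c2] by linarith
    then show X_le: "integral\<^sup>L ?M (\<lambda>r. norm (X r) powr p) \<le> M1"
      using c2(1) by (simp add: M1_def pos_le_divide_eq mult.commute)
    have LX': "Lp_fun q {t0<..<T} X'" using sol by (simp add: solves_def)
    have iX': "integrable ?M (\<lambda>r. norm (X' r) powr q)" using LX' by (simp add: Lp_fun_def)
    let ?b = "\<lambda>r. 3 powr q * (norm (a1 r) powr q + c1 powr q * norm (X r) powr p + (C * norm \<iota>) powr q)"
    have pq1: "(p - 1) * q = p" using pq by (simp add: field_simps)
    have "integral\<^sup>L ?M (\<lambda>r. norm (X' r) powr q) \<le> integral\<^sup>L ?M ?b"
    proof (rule integral_mono_AE[OF iX'])
      show "integrable ?M ?b" using ia iX by (intro integrable_mult_right Bochner_Integration.integrable_add integrable_const_lebesgue_on) auto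
      have "AE t in ?M. X' t + A t (X t) = to_dual \<iota> (f t)" using sol by (simp add: solves_def)
      then show "AE r in ?M. norm (X' r) powr q \<le> ?b r"
        using a1(3) fC
      proof eventually_elim
        case (elim r)
        have "X' r = to_dual \<iota> (f r) - A r (X r)" using elim(1) by (simp add: eq_diff_eq)
        then have "norm (X' r) \<le> norm (to_dual \<iota> (f r)) + norm (A r (X r))"
          using norm_triangle_ineq4 by metis
        also have "norm (to_dual \<iota> (f r)) \<le> C * norm \<iota>"
          using norm_to_dual_le[of \<iota> "f r"] mult_right_mono[OF elim(3), of "norm \<iota>"] by simp
        also have "norm (A r (X r)) \<le> norm (a1 r) + c1 * norm (X r) powr (p - 1)"
          using elim(2)[rule_format, of "X r"] by simp
        finally have "norm (X' r) \<le> norm (norm (a1 r) + c1 * norm (X r) powr (p - 1) + C * norm \<iota>)"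
          using a1(2) C by simp
        then have "norm (X' r) powr q \<le> norm (norm (a1 r) + c1 * norm (X r) powr (p - 1) + C * norm \<iota>) powr q"
          using pq by (intro powr_mono2) auto
        also have "\<dots> \<le> 3 powr q * (norm (norm (a1 r)) powr q + norm (c1 * norm (X r) powr (p - 1)) powr q + norm (C * norm \<iota>) powr q)"
          using pq by (intro norm_powr_triangle3) auto
        also have "\<dots> = ?b r"
          using a1(2) C by (simp add: powr_mult powr_powr pq1)
        finally show ?case .
      qed
    qed
    also have "\<dots> = 3 powr q * (\<alpha> + c1 powr q * integral\<^sup>L ?M (\<lambda>r. norm (X r) powr p) + (T - t0) * ((C * norm \<iota>) powr q))"
      using ia iX t0 by (simp add: \<alpha>_def measure_lebesgue_on_Ioo integrable_const_lebesgue_on)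
    also have "\<dots> \<le> M2"
      unfolding M2_def using X_le t0 by (intro mult_left_mono add_mono) auto
    finally show "integral\<^sup>L ?M (\<lambda>r. norm (X' r) powr q) \<le> M2" .
  qed
  then show ?thesis by (intro exI[of _ "max 0 (max M1 M2)"]) (auto simp: le_max_iff_disj)
qed

section \<open>Precompactness of trajectories\<close>

lemma integral_uniform_partition:
  fixes g :: "real \<Rightarrow> real"
  assumes "\<And>s t. a \<le> s \<Longrightarrow> t \<le> b \<Longrightarrow> g integrable_on {s..t}" "d \<ge> 0" "a + real n * d = b"
  shows "integral {a..b} g = (\<Sum>j<n. integral {a + real j * d..a + real (Suc j) * d} g)"
proof -
  have "m \<le> n \<Longrightarrow> integral {a..a + real m * d} g = (\<Sum>j<m. integral {a + real j * d..a + real (Suc j) * d} g)" for m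
  proof (induction m)
    case (Suc m)
    have "real (Suc m) * d \<le> real n * d" using Suc.prems assms(2) by (intro mult_right_mono) auto
    then have "a + real (Suc m) * d \<le> b" using assms(3) by simp
    moreover have "real m * d \<ge> 0" using assms(2) by simp
    ultimately have "integral {a..a + real (Suc m) * d} g
        = integral {a..a + real m * d} g + integral {a + real m * d..a + real (Suc m) * d} g"
      using assms(2) by (intro Henstock_Kurzweil_Integration.integral_combine[symmetric] assms(1))
        (auto simp: algebra_simps)
    then show ?case using Suc by simp
  qed simp
  from this[of n] show ?thesis using assms(3) by simp
qed

text \<open>At two times where the path is the image of \<open>X\<close>, the increment is itself
  the image of a vector of V and can be used as the test vector in the integral identity for itself.
  Smallness in the dual and boundedness in V thus combine to smallness in H.\<close>

lemma solves_increment: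
  assumes sol: "solves \<iota> A p q a b x f X X'" and q: "q \<ge> 1"
    and cd: "a \<le> c" "d \<le> b"
    and st: "s \<in> {c<..<d}" "t \<in> {c<..<d}" "x s = blinfun_apply \<iota> (X s)" "x t = blinfun_apply \<iota> (X t)"
  shows "(norm (x t - x s))\<^sup>2 \<le> (norm (X t) + norm (X s)) * integral {c..d} (\<lambda>r. norm (X' r))"
  using st
proof (induction s t rule: linorder_wlog)
  case (sym s t)
  then show ?case by (simp add: norm_minus_commute add.commute)
next
  case (le s t)
  have LX': "Lp_fun q {a<..<b} X'" using sol by (simp add: solves_def)
  have iN: "integrable (lebesgue_on {a<..<b}) (\<lambda>r. norm (X' r))" by (rule Lp_fun_integrable_norm[OF LX' q])
  note hN = integrable_Ioo_imp_HK(1)[OF iN]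
  note hv = integrable_Ioo_imp_HK(1)[OF Lp_fun_apply_integrable[OF LX' q]]
  show ?case
  proof (cases "s = t")
    case True
    then show ?thesis
      using integral_nonneg[OF hN[OF cd], of] by simp
  next
    case False
    define v where "v = X t - X s"
    have "(norm (x t - x s))\<^sup>2 = inner (x t - x s) (blinfun_apply \<iota> v)"
      using le by (simp add: v_def power2_norm_eq_inner blinfun.diff_right)
    also have "\<dots> = integral {s..t} (\<lambda>r. blinfun_apply (X' r) v)"
      using sol le False cd unfolding solves_def by auto
    also have "\<dots> \<le> integral {s..t} (\<lambda>r. norm (X' r) * norm v)"
    proof (rule integral_le)
      show "(\<lambda>r. blinfun_apply (X' r) v) integrable_on {s..t}" using le cd by (intro hv) auto
      show "(\<lambda>r. norm (X' r) * norm v) integrable_on {s..t}" using le cd by (intro integrable_on_mult_left hN) auto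
      show "blinfun_apply (X' r) v \<le> norm (X' r) * norm v" for r using norm_blinfun[of "X' r" v] by simp
    qed
    also have "\<dots> = norm v * integral {s..t} (\<lambda>r. norm (X' r))" by simp
    also have "\<dots> \<le> norm v * integral {c..d} (\<lambda>r. norm (X' r))"
      using le cd by (intro mult_left_mono integral_subset_le hN) auto
    also have "\<dots> \<le> (norm (X t) + norm (X s)) * integral {c..d} (\<lambda>r. norm (X' r))"
      unfolding v_def by (intro mult_right_mono norm_triangle_ineq4 integral_nonneg hN cd) auto
    finally show ?thesis .
  qed
qed

text \<open>There is a time s at which the norm of \<open>X\<close> is at most its average plus one,
  since otherwise integration would give a contradiction. The increments from this s are estimated
  in mean. All bounds are multiplied by the length of the cell so that they can be summed over a
  partition.\<close>

lemma solves_local_oscillation: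
  assumes sol: "solves \<iota> A p q a b x f X X'" and pq: "p \<ge> 1" "q \<ge> 1"
    and cd: "a \<le> c" "c < d" "d \<le> b" and \<theta>: "\<theta> > 0"
    and \<kappa>: "integral {c..d} (\<lambda>r. norm (X' r)) \<le> \<kappa>"
  shows "\<exists>s\<in>{c<..<d}. x s = blinfun_apply \<iota> (X s) \<and>
    (d - c) * norm (X s) \<le> integral {c..d} (\<lambda>r. norm (X r)) + (d - c) \<and>
    integral {c..d} (\<lambda>t. norm (x t - x s)) \<le> (d - c) * \<theta> + \<kappa> / \<theta> * (2 * integral {c..d} (\<lambda>r. norm (X r)) + (d - c))"
proof -
  let ?N = "lebesgue_on {c<..<d}"
  have sub: "{c<..<d} \<subseteq> {a<..<b}" using cd by auto
  have cx: "continuous_on {a..b} x" and LX: "Lp_fun p {a<..<b} X" and LX': "Lp_fun q {a<..<b} X'"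
    and ax: "AE t in lebesgue_on {a<..<b}. x t = blinfun_apply \<iota> (X t)"
    using sol by (auto simp: solves_def)
  have iX: "integrable (lebesgue_on {a<..<b}) (\<lambda>r. norm (X r))" by (rule Lp_fun_integrable_norm[OF LX pq(1)])
  have iX': "integrable (lebesgue_on {a<..<b}) (\<lambda>r. norm (X' r))" by (rule Lp_fun_integrable_norm[OF LX' pq(2)])
  have iXN: "integrable ?N (\<lambda>r. norm (X r))" by (rule integrable_lebesgue_on_subset[OF iX sub]) auto
  have axN: "AE t in ?N. x t = blinfun_apply \<iota> (X t)" by (rule AE_lebesgue_on_subset[OF ax sub]) auto
  define I where "I = integral {c..d} (\<lambda>r. norm (X r))"
  have IL: "integral\<^sup>L ?N (\<lambda>r. norm (X r)) = I"
    unfolding I_def using cd by (intro integrable_Ioo_imp_HK(3)[OF iX]) auto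
  have "\<exists>s\<in>{c<..<d}. x s = blinfun_apply \<iota> (X s) \<and> norm (X s) < I / (d - c) + 1"
  proof (rule ccontr)
    assume neg: "\<not> ?thesis"
    have "AE s in ?N. I / (d - c) + 1 \<le> norm (X s)"
      using axN AE_space by eventually_elim (use neg in \<open>auto simp: not_less\<close>)
    then have "integral\<^sup>L ?N (\<lambda>_. I / (d - c) + 1) \<le> integral\<^sup>L ?N (\<lambda>r. norm (X r))"
      by (intro integral_mono_AE iXN integrable_const_lebesgue_on)
    then have "(d - c) * (I / (d - c) + 1) \<le> I"
      unfolding IL integral_const_Ioo[OF less_imp_le[OF cd(2)]] .
    moreover have "(d - c) * (I / (d - c) + 1) = I + (d - c)" using cd by (simp add: distrib_left)
    ultimately show False using cd by linarith
  qed
  then obtain s where s: "s \<in> {c<..<d}" "x s = blinfun_apply \<iota> (X s)" "norm (X s) < I / (d - c) + 1" by blast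
  have Xs: "(d - c) * norm (X s) \<le> I + (d - c)"
  proof -
    have "(d - c) * norm (X s) \<le> (d - c) * (I / (d - c) + 1)" using s(3) cd by (intro mult_left_mono) auto
    moreover have "(d - c) * (I / (d - c) + 1) = I + (d - c)" using cd by (simp add: distrib_left)
    ultimately show ?thesis by linarith
  qed
  have k0: "\<kappa> \<ge> 0"
    using integral_nonneg[OF integrable_Ioo_imp_HK(1)[OF iX' cd(1,3)]] \<kappa> by force
  have cn: "continuous_on {c..d} (\<lambda>t. norm (x t - x s))"
    using cd by (intro continuous_intros continuous_on_subset[OF cx]) auto
  have inN: "integrable ?N (\<lambda>t. norm (x t - x s))"
    using continuous_imp_integrable_real[OF cn] by (simp add: integrable_Icc_iff_Ioo)
  have "integral {c..d} (\<lambda>t. norm (x t - x s)) = integral\<^sup>L ?N (\<lambda>t. norm (x t - x s))"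
    using integrable_Ioo_imp_HK(3)[OF inN, of c d] by simp
  also have "\<dots> \<le> integral\<^sup>L ?N (\<lambda>t. (\<theta> + \<kappa> / \<theta> * norm (X s)) + \<kappa> / \<theta> * norm (X t))"
  proof (rule integral_mono_AE[OF inN])
    show "integrable ?N (\<lambda>t. (\<theta> + \<kappa> / \<theta> * norm (X s)) + \<kappa> / \<theta> * norm (X t))"
      using iXN by (intro Bochner_Integration.integrable_add integrable_const_lebesgue_on) auto
    show "AE t in ?N. norm (x t - x s) \<le> (\<theta> + \<kappa> / \<theta> * norm (X s)) + \<kappa> / \<theta> * norm (X t)"
      using axN AE_space
    proof eventually_elim
      case (elim t)
      have "(norm (x t - x s))\<^sup>2 \<le> (norm (X t) + norm (X s)) * integral {c..d} (\<lambda>r. norm (X' r))"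
        using elim s cd by (intro solves_increment[OF sol pq(2)]) auto
      also have "\<dots> \<le> (norm (X t) + norm (X s)) * \<kappa>" using \<kappa> by (intro mult_left_mono) auto
      finally have sq: "(norm (x t - x s))\<^sup>2 \<le> (norm (X t) + norm (X s)) * \<kappa>" .
      \<comment> \<open>Trades the quadratic increment bound for a linear one that is integrable in
        t: a norm above \<theta> is at most its square divided by \<theta>.\<close>
      have "norm (x t - x s) \<le> \<theta> + (norm (x t - x s))\<^sup>2 / \<theta>"
      proof (cases "norm (x t - x s) \<le> \<theta>")
        case True
        then show ?thesis using \<theta> by (simp add: add_increasing2)
      next
        case False
        then have "norm (x t - x s) * \<theta> \<le> (norm (x t - x s))\<^sup>2"
          unfolding power2_eq_square by (intro mult_left_mono) auto
        then have "norm (x t - x s) \<le> (norm (x t - x s))\<^sup>2 / \<theta>" using \<theta> by (simp add: pos_le_divide_eq)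
        then show ?thesis using \<theta> by linarith
      qed
      also have "(norm (x t - x s))\<^sup>2 / \<theta> \<le> (norm (X t) + norm (X s)) * \<kappa> / \<theta>"
        using sq \<theta> by (intro divide_right_mono) auto
      finally show ?case by (simp add: algebra_simps add_divide_distrib)
    qed
  qed
  also have "\<dots> = (d - c) * (\<theta> + \<kappa> / \<theta> * norm (X s)) + \<kappa> / \<theta> * I"
    using iXN cd by (subst Bochner_Integration.integral_add)
      (auto simp: measure_lebesgue_on_Ioo IL integrable_const_lebesgue_on)
  also have "\<dots> = (d - c) * \<theta> + \<kappa> / \<theta> * ((d - c) * norm (X s) + I)"
  proof -
    have "(d - c) * (\<theta> + u * z) + u * I = (d - c) * \<theta> + u * ((d - c) * z + I)" for u z
      by (simp add: algebra_simps)
    then show ?thesis .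
  qed
  also have "\<dots> \<le> (d - c) * \<theta> + \<kappa> / \<theta> * (2 * I + (d - c))"
    using Xs k0 \<theta> by (intro add_left_mono mult_left_mono) auto
  finally show ?thesis
    using s(1,2) Xs unfolding I_def by blast
qed

text \<open>On each cell of a uniform partition a trajectory is close in mean to its value at a good
  time, and that value is the image of a vector in a ball of V whose radius is common to all
  trajectories. The embedding makes the image of the ball precompact, so a finite set
  \<open>F\<close> approximates all such values, and there are finitely many ways of choosing one
  element of \<open>F\<close> per cell.\<close>

lemma trajectories_L1_net:
  assumes pq: "p \<ge> 2" "q > 1" "1 / p + 1 / q = 1" and emb: "compact_dense_embedding \<iota>"
    and A: "admissible_operator T p q A" and t0: "0 \<le> t0" "t0 < T" and x0: "x0 \<in> paths T" and L: "L \<ge> 0"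
    and e: "e > 0"
  shows "\<exists>n>0. \<exists>Cs :: (nat \<Rightarrow> 'h) set. finite Cs \<and>
    (\<forall>x \<in> trajectories (\<iota> :: 'v::{banach, second_countable_topology} \<Rightarrow>\<^sub>L 'h::{real_inner, banach, second_countable_topology}) A p q T L t0 x0.
      \<exists>c\<in>Cs. (\<Sum>j<n. integral {t0 + real j * ((T - t0) / real n)..t0 + real (Suc j) * ((T - t0) / real n)} (\<lambda>t. norm (x t - c j))) \<le> e)"
proof -
  obtain R where R: "R \<ge> 0" "\<And>x f t. trajectory_with \<iota> A p q T L t0 x0 x f \<Longrightarrow> t \<in> {0..T} \<Longrightarrow> norm (x t) \<le> R"
    using trajectory_bound[OF pq A t0 x0 L] by blast
  obtain M where M: "M \<ge> 0" "\<And>x f X X'. trajectory_with \<iota> A p q T L t0 x0 x f \<Longrightarrow> solves \<iota> A p q t0 T x f X X' \<Longrightarrow>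
    integral\<^sup>L (lebesgue_on {t0<..<T}) (\<lambda>r. norm (X r) powr p) \<le> M \<and>
    integral\<^sup>L (lebesgue_on {t0<..<T}) (\<lambda>r. norm (X' r) powr q) \<le> M"
    using trajectory_Lp_bounds[where \<iota>=\<iota> and ?x0.0=x0 and R=R, OF pq A t0 L R(1)] R(2) by blast
  define D where "D = T - t0"
  have D: "D > 0" using t0 by (simp add: D_def)
  define M1 where "M1 = D + M"
  have M1: "M1 > 0" using D M by (simp add: M1_def)
  \<comment> \<open>Together with \<open>\<kappa>\<close> below, this splits the total error into
    two halves: \<open>2 * (D * \<theta>)\<close> from the net and the small increments, and
    \<open>\<kappa> / \<theta> * (2 * M1 + D)\<close> from the large increments.\<close>
  define \<theta> where "\<theta> = e / (4 * D)"
  have \<theta>: "\<theta> > 0" "2 * (D * \<theta>) = e / 2" using e D by (auto simp: \<theta>_def)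
  define \<kappa> where "\<kappa> = \<theta> * e / (2 * (2 * M1 + D))"
  have \<kappa>: "\<kappa> > 0" "\<kappa> / \<theta> * (2 * M1 + D) = e / 2"
  proof -
    show "\<kappa> > 0" using \<theta> e M1 D by (simp add: \<kappa>_def)
    have "\<theta> * e / (2 * z) / \<theta> * z = e / 2" if "z > 0" for z using that \<theta>(1) by simp
    from this[of "2 * M1 + D"] show "\<kappa> / \<theta> * (2 * M1 + D) = e / 2"
      unfolding \<kappa>_def using M1 D by linarith
  qed
  \<comment> \<open>Young's inequality with second factor 1 bounds the integral of the norm of
    \<open>X'\<close> over one cell by \<open>\<eta> * M + C * d\<close>. Here the first summand is
    made at most \<open>\<kappa> / 2\<close>; the number of cells is then chosen large enough for
    the second.\<close>
  define \<eta> where "\<eta> = \<kappa> / (2 * (M + 1))"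
  have \<eta>: "\<eta> > 0" "\<eta> * M \<le> \<kappa> / 2" using \<kappa> M by (auto simp: \<eta>_def field_simps)
  have p1: "p > 1" using pq(1) by simp
  obtain C where C: "C > 0" "\<And>x y. x \<ge> 0 \<Longrightarrow> y \<ge> 0 \<Longrightarrow> x * y \<le> \<eta> * x powr q + C * y powr p"
    using Youngs_inequality_small[OF p1 pq(2,3) \<eta>(1)] by blast
  obtain n where n: "2 * C * D / \<kappa> < real n" using reals_Archimedean2 by blast
  have "0 < 2 * C * D / \<kappa>" using C D \<kappa> by simp
  then have "0 < real n" using n by linarith
  then have n0: "n > 0" by simp
  define d where "d = D / real n"
  have d: "d > 0" "real n * d = D" "C * d \<le> \<kappa> / 2" "d \<le> D"
  proof -
    show "d > 0" "real n * d = D" using D n0 by (auto simp: d_def)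
    have "2 * C * D < \<kappa> * real n" using n \<kappa> by (simp add: field_simps)
    then show "C * d \<le> \<kappa> / 2" using n0 by (simp add: d_def field_simps)
    show "d \<le> D" using D n0 by (simp add: d_def field_simps)
  qed
  \<comment> \<open>The bound for the norm of \<open>X\<close> at a good time. It depends on the
    cell length, which is already fixed, but not on the trajectory.\<close>
  define \<rho> where "\<rho> = (M1 + D) / d"
  define K where "K = closure (blinfun_apply \<iota> ` cball 0 \<rho>)"
  have "compact K" using emb unfolding K_def compact_dense_embedding_def by blast
  then obtain F where F: "finite F" "K \<subseteq> (\<Union>c\<in>F. ball c \<theta>)"
    using \<theta>(1) unfolding compact_eq_totally_bounded by blast
  define Cs where "Cs = PiE {..<n} (\<lambda>_. F)"
  define a where "a j = t0 + real j * d" for j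
  have a: "t0 \<le> a j" "a j < a (Suc j)" "a (Suc j) - a j = d" for j
    using d by (auto simp: a_def algebra_simps)
  have aT: "a (Suc j) \<le> T" if "j < n" for j
  proof -
    have "real (Suc j) * d \<le> real n * d" using that d by (intro mult_right_mono) auto
    then show ?thesis using d by (simp add: a_def D_def)
  qed
  have "\<exists>c\<in>Cs. (\<Sum>j<n. integral {a j..a (Suc j)} (\<lambda>t. norm (x t - c j))) \<le> e"
    if xT: "x \<in> trajectories \<iota> A p q T L t0 x0" for x
  proof -
    obtain f where tr: "trajectory_with \<iota> A p q T L t0 x0 x f" using xT by (auto simp: trajectories_def)
    obtain X X' where sol: "solves \<iota> A p q t0 T x f X X'"
      using trajectory_solves[OF tr t0(1)] pq by auto
    have cx: "continuous_on {t0..T} x" and LX: "Lp_fun p {t0<..<T} X" and LX': "Lp_fun q {t0<..<T} X'"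
      using sol by (auto simp: solves_def)
    have iX: "integrable (lebesgue_on {t0<..<T}) (\<lambda>r. norm (X r))"
      and iX': "integrable (lebesgue_on {t0<..<T}) (\<lambda>r. norm (X' r))"
      using Lp_fun_integrable_norm[OF LX] Lp_fun_integrable_norm[OF LX'] pq by auto
    have iXp: "integrable (lebesgue_on {t0<..<T}) (\<lambda>r. norm (X r) powr p)"
      and iXq: "integrable (lebesgue_on {t0<..<T}) (\<lambda>r. norm (X' r) powr q)"
      using LX LX' by (auto simp: Lp_fun_def)
    have MX: "integral {t0..T} (\<lambda>r. norm (X r)) \<le> M1"
    proof -
      have "integral {t0..T} (\<lambda>r. norm (X r)) = integral\<^sup>L (lebesgue_on {t0<..<T}) (\<lambda>r. norm (X r))"
        using integrable_Ioo_imp_HK(3)[OF iX, of t0 T] by simp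
      also have "\<dots> \<le> integral\<^sup>L (lebesgue_on {t0<..<T}) (\<lambda>r. 1 + norm (X r) powr p)"
        using pq by (intro integral_mono iX Bochner_Integration.integrable_add integrable_const_lebesgue_on iXp le_one_plus_powr) auto
      also have "\<dots> = D + integral\<^sup>L (lebesgue_on {t0<..<T}) (\<lambda>r. norm (X r) powr p)"
        using iXp t0 by (subst Bochner_Integration.integral_add) (auto simp: integrable_const_lebesgue_on measure_lebesgue_on_Ioo D_def)
      also have "\<dots> \<le> M1" using M(2)[OF tr sol] by (simp add: M1_def)
      finally show ?thesis .
    qed
    have kap: "integral {a j..a (Suc j)} (\<lambda>r. norm (X' r)) \<le> \<kappa>" if j: "j < n" for j
    proof -
      have h: "g integrable_on {a j..a (Suc j)}" if "integrable (lebesgue_on {t0<..<T}) g" for g :: "real \<Rightarrow> real"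
        using a(1)[of j] aT[OF j] by (intro integrable_Ioo_imp_HK(1)[OF that]) auto
      have "integral {a j..a (Suc j)} (\<lambda>r. norm (X' r)) \<le> integral {a j..a (Suc j)} (\<lambda>r. \<eta> * norm (X' r) powr q + C)"
      proof (rule integral_le[OF h[OF iX']])
        show "(\<lambda>r. \<eta> * norm (X' r) powr q + C) integrable_on {a j..a (Suc j)}"
          by (intro h Bochner_Integration.integrable_add integrable_const_lebesgue_on integrable_mult_right iXq)
        show "norm (X' r) \<le> \<eta> * norm (X' r) powr q + C" for r
          using C(2)[of "norm (X' r)" 1] by simp
      qed
      also have "\<dots> = \<eta> * integral {a j..a (Suc j)} (\<lambda>r. norm (X' r) powr q) + C * d"
        using a(2,3)[of j] h[OF iXq] by (subst integral_add) (auto intro!: integrable_on_mult_right simp: mult.commute)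
      also have "integral {a j..a (Suc j)} (\<lambda>r. norm (X' r) powr q) \<le> integral {t0..T} (\<lambda>r. norm (X' r) powr q)"
        using a(1,2)[of j] aT[OF j] by (intro integral_subset_le h[OF iXq] integrable_Ioo_imp_HK(1)[OF iXq]) auto
      also have "integral {t0..T} (\<lambda>r. norm (X' r) powr q) \<le> M"
        using M(2)[OF tr sol] integrable_Ioo_imp_HK(3)[OF iXq, of t0 T] by simp
      finally have "integral {a j..a (Suc j)} (\<lambda>r. norm (X' r)) \<le> \<eta> * M + C * d" using \<eta>(1) by simp
      then show ?thesis using \<eta>(2) d(3) by linarith
    qed
    let ?I = "\<lambda>j. integral {a j..a (Suc j)} (\<lambda>r. norm (X r))"
    have I1: "?I j \<le> M1" if j: "j < n" for j
    proof -
      have "?I j \<le> integral {t0..T} (\<lambda>r. norm (X r))"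
        using a(1,2)[of j] aT[OF j] by (intro integral_subset_le integrable_Ioo_imp_HK(1)[OF iX]) auto
      then show ?thesis using MX by linarith
    qed
    have step: "\<exists>c\<in>F. integral {a j..a (Suc j)} (\<lambda>t. norm (x t - c)) \<le> 2 * (d * \<theta>) + \<kappa> / \<theta> * (2 * ?I j + d)"
      if j: "j < n" for j
    proof -
      obtain s where s: "s \<in> {a j<..<a (Suc j)}" "x s = blinfun_apply \<iota> (X s)" "d * norm (X s) \<le> ?I j + d"
        "integral {a j..a (Suc j)} (\<lambda>t. norm (x t - x s)) \<le> d * \<theta> + \<kappa> / \<theta> * (2 * ?I j + d)"
        using solves_local_oscillation[OF sol _ _ a(1) a(2) aT[OF j] \<theta>(1) kap[OF j]] pq unfolding a(3) by auto
      have "d * norm (X s) \<le> M1 + D" using s(3) I1[OF j] d(4) by linarith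
      then have "norm (X s) \<le> \<rho>" using d(1) by (simp add: \<rho>_def pos_le_divide_eq mult.commute)
      then have "x s \<in> K" unfolding K_def s(2) by (intro subsetD[OF closure_subset]) auto
      then obtain c where c: "c \<in> F" "norm (x s - c) < \<theta>" using F(2) by (force simp: dist_norm norm_minus_commute)
      have cs: "continuous_on {a j..a (Suc j)} x" using a(1)[of j] aT[OF j] by (intro continuous_on_subset[OF cx]) auto
      have "integral {a j..a (Suc j)} (\<lambda>t. norm (x t - c)) \<le> integral {a j..a (Suc j)} (\<lambda>t. norm (x t - x s) + \<theta>)"
      proof (intro integral_le integrable_continuous_interval continuous_intros cs)
        fix t
        have "norm (x t - c) \<le> norm (x t - x s) + norm (x s - c)"
          using norm_triangle_ineq[of "x t - x s" "x s - c"] by simp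
        then show "norm (x t - c) \<le> norm (x t - x s) + \<theta>" using c(2) by linarith
      qed
      also have "\<dots> = integral {a j..a (Suc j)} (\<lambda>t. norm (x t - x s)) + d * \<theta>"
        using a(2,3)[of j] by (subst integral_add) (auto intro!: integrable_continuous_interval continuous_intros cs simp: mult.commute)
      finally show ?thesis using s(4) c(1) by force
    qed
    then obtain c where c: "\<And>j. j < n \<Longrightarrow> c j \<in> F"
      "\<And>j. j < n \<Longrightarrow> integral {a j..a (Suc j)} (\<lambda>t. norm (x t - c j)) \<le> 2 * (d * \<theta>) + \<kappa> / \<theta> * (2 * ?I j + d)"
      by metis
    have "(\<Sum>j<n. integral {a j..a (Suc j)} (\<lambda>t. norm (x t - restrict c {..<n} j)))
        \<le> (\<Sum>j<n. 2 * (d * \<theta>) + \<kappa> / \<theta> * (2 * ?I j + d))"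
      using c(2) by (intro sum_mono) simp
    also have "\<dots> = 2 * (real n * d * \<theta>) + \<kappa> / \<theta> * (2 * (\<Sum>j<n. ?I j) + real n * d)"
    proof -
      have "(\<Sum>j<n. 2 * (d * \<theta>) + u * (2 * w j + d)) = 2 * (real n * d * \<theta>) + u * (2 * (\<Sum>j<n. w j) + real n * d)"
        for u and w :: "nat \<Rightarrow> real"
        by (induction n) (simp_all add: algebra_simps)
      then show ?thesis .
    qed
    also have "(\<Sum>j<n. ?I j) = integral {t0..T} (\<lambda>r. norm (X r))"
      unfolding a_def using d by (intro integral_uniform_partition[symmetric] integrable_Ioo_imp_HK(1)[OF iX]) (auto simp: D_def)
    also have "2 * (real n * d * \<theta>) + \<kappa> / \<theta> * (2 * integral {t0..T} (\<lambda>r. norm (X r)) + real n * d) \<le> e / 2 + \<kappa> / \<theta> * (2 * M1 + D)"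
      unfolding d(2) \<theta>(2) using MX \<kappa>(1) \<theta>(1) by (intro add_left_mono mult_left_mono) auto
    also have "\<dots> = e" unfolding \<kappa>(2) by simp
    finally have "(\<Sum>j<n. integral {a j..a (Suc j)} (\<lambda>t. norm (x t - restrict c {..<n} j))) \<le> e" .
    moreover have "restrict c {..<n} \<in> Cs" using c(1) by (auto simp: Cs_def)
    ultimately show ?thesis by blast
  qed
  moreover have "finite Cs" using F(1) unfolding Cs_def by (intro finite_PiE) auto
  ultimately show ?thesis using n0 unfolding a_def d_def D_def by blast
qed

text \<open>The centres of the net in mean are step functions and not paths, so the net is expressed
  by a finite code: trajectories with equal code are close to the same step function and hence to
  each other in mean. Their sources differ by a bounded amount, and the energy inequality for the
  difference bounds its square at every time by a multiple of the distance in mean.\<close>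

lemma trajectories_sup_net:
  fixes \<iota> :: "'v::{banach, second_countable_topology} \<Rightarrow>\<^sub>L 'h::{real_inner, banach, second_countable_topology}"
  assumes pq: "p \<ge> 2" "q > 1" "1 / p + 1 / q = 1" and emb: "compact_dense_embedding \<iota>"
    and A: "admissible_operator T p q A" and t0: "0 \<le> t0" "t0 < T" and x0: "x0 \<in> paths T" and L: "L \<ge> 0"
    and e: "e > 0"
  shows "\<exists>code :: (real \<Rightarrow> 'h) \<Rightarrow> nat \<Rightarrow> 'h. finite (code ` trajectories \<iota> A p q T L t0 x0) \<and>
    (\<forall>x\<in>trajectories \<iota> A p q T L t0 x0. \<forall>y\<in>trajectories \<iota> A p q T L t0 x0. code x = code y \<longrightarrow> (\<forall>t\<in>{0..T}. norm (x t - y t) \<le> e))"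
proof -
  let ?X = "trajectories \<iota> A p q T L t0 x0"
  obtain R where R: "R \<ge> 0" "\<And>x f t. trajectory_with \<iota> A p q T L t0 x0 x f \<Longrightarrow> t \<in> {0..T} \<Longrightarrow> norm (x t) \<le> R"
    using trajectory_bound[OF pq A t0 x0 L] by blast
  define C where "C = L * (1 + R)"
  have C: "C \<ge> 0" using L R by (simp add: C_def)
  \<comment> \<open>The squared distance comes out as at most \<open>2 * (2 * C * (2 * e1))\<close>,
    that is \<open>8 * C * e1\<close>; the added one covers the case \<open>C = 0\<close>.\<close>
  define e1 where "e1 = e\<^sup>2 / (8 * C + 1)"
  have e1: "e1 > 0" "8 * C * e1 \<le> e\<^sup>2"
    using e C by (auto simp: e1_def field_simps add_pos_nonneg)
  obtain n and Cs :: "(nat \<Rightarrow> 'h) set" where n: "n > 0" "finite Cs" "\<And>x. x \<in> ?X \<Longrightarrow>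
      \<exists>c\<in>Cs. (\<Sum>j<n. integral {t0 + real j * ((T - t0) / real n)..t0 + real (Suc j) * ((T - t0) / real n)} (\<lambda>t. norm (x t - c j))) \<le> e1"
    using trajectories_L1_net[OF pq emb A t0 x0 L e1(1)] by blast
  define d where "d = (T - t0) / real n"
  define I where "I j = {t0 + real j * d..t0 + real (Suc j) * d}" for j
  have d: "d > 0" "t0 + real n * d = T" using t0 n by (auto simp: d_def)
  have Isub: "I j \<subseteq> {t0..T}" if "j < n" for j
  proof -
    have "real (Suc j) * d \<le> real n * d" using that d by (intro mult_right_mono) auto
    moreover have "0 \<le> real j * d" using d by simp
    ultimately show ?thesis using d(2) by (auto simp: I_def)
  qed
  define code where "code x = (SOME c. c \<in> Cs \<and> (\<Sum>j<n. integral (I j) (\<lambda>t. norm (x t - c j))) \<le> e1)" for x :: "real \<Rightarrow> 'h"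
  have code: "code x \<in> Cs" "(\<Sum>j<n. integral (I j) (\<lambda>t. norm (x t - code x j))) \<le> e1" if "x \<in> ?X" for x
    using someI_ex[of "\<lambda>c. c \<in> Cs \<and> (\<Sum>j<n. integral (I j) (\<lambda>t. norm (x t - c j))) \<le> e1"] n(3)[OF that]
    unfolding code_def I_def d_def by blast+
  have "norm (x t - y t) \<le> e" if xy: "x \<in> ?X" "y \<in> ?X" and eq: "code x = code y" and t: "t \<in> {0..T}" for x y t
  proof (cases "t \<le> t0")
    case True
    then have "x t = y t" using xy t by (auto simp: trajectories_def trajectory_with_def)
    then show ?thesis using e by simp
  next
    case False
    obtain f g where f: "trajectory_with \<iota> A p q T L t0 x0 x f" and g: "trajectory_with \<iota> A p q T L t0 x0 y g"
      using xy by (auto simp: trajectories_def)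
    obtain X X' where X: "solves \<iota> A p q t0 T x f X X'" using trajectory_solves[OF f t0(1)] pq by auto
    obtain Y Y' where Y: "solves \<iota> A p q t0 T y g Y Y'" using trajectory_solves[OF g t0(1)] pq by auto
    have fC: "AE t in lebesgue_on {t0<..<T}. norm (f t) \<le> C" "AE t in lebesgue_on {t0<..<T}. norm (g t) \<le> C"
      unfolding C_def using trajectory_source_bound[OF f t0(1) L R(2)[OF f]] trajectory_source_bound[OF g t0(1) L R(2)[OF g]] by auto
    have cx: "continuous_on {t0..T} x" and cy: "continuous_on {t0..T} y" using X Y by (auto simp: solves_def)
    have cn: "continuous_on {t0..T} (\<lambda>r. norm (x r - y r))" by (intro continuous_intros cx cy)
    have iN: "(\<lambda>r. norm (x r - y r)) integrable_on {s..t}" if "t0 \<le> s" "t \<le> T" for s t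
      using that by (intro integrable_continuous_interval continuous_on_subset[OF cn]) auto
    have "integral {t0..T} (\<lambda>r. norm (x r - y r)) = (\<Sum>j<n. integral (I j) (\<lambda>r. norm (x r - y r)))"
      unfolding I_def using d by (intro integral_uniform_partition iN) auto
    also have "\<dots> \<le> (\<Sum>j<n. integral (I j) (\<lambda>r. norm (x r - code x j)) + integral (I j) (\<lambda>r. norm (y r - code y j)))"
    proof (rule sum_mono)
      fix j assume "j \<in> {..<n}"
      then have sub: "I j \<subseteq> {t0..T}" using Isub by simp
      have c: "continuous_on (I j) x" "continuous_on (I j) y" by (rule continuous_on_subset[OF cx sub], rule continuous_on_subset[OF cy sub])
      have i: "g integrable_on I j" if "continuous_on (I j) g" for g :: "real \<Rightarrow> real"
        using that unfolding I_def by (rule integrable_continuous_interval)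
      have "integral (I j) (\<lambda>r. norm (x r - y r)) \<le> integral (I j) (\<lambda>r. norm (x r - code x j) + norm (y r - code y j))"
      proof (intro integral_le i continuous_intros c)
        fix r
        show "norm (x r - y r) \<le> norm (x r - code x j) + norm (y r - code y j)"
          using norm_triangle_ineq4[of "x r - code x j" "y r - code y j"] eq by simp
      qed
      also have "\<dots> = integral (I j) (\<lambda>r. norm (x r - code x j)) + integral (I j) (\<lambda>r. norm (y r - code y j))"
        by (intro integral_add i continuous_intros c)
      finally show "integral (I j) (\<lambda>r. norm (x r - y r)) \<le> integral (I j) (\<lambda>r. norm (x r - code x j)) + integral (I j) (\<lambda>r. norm (y r - code y j))" .
    qed
    also have "\<dots> \<le> e1 + e1" unfolding sum.distrib using code(2)[OF xy(1)] code(2)[OF xy(2)] by (intro add_mono) auto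
    finally have L1: "integral {t0..T} (\<lambda>r. norm (x r - y r)) \<le> 2 * e1" by simp
    have st: "t0 \<le> t0" "t0 \<le> t" "t \<le> T" using False t by auto
    note en = solves_energy_diff[OF pq A t0(1) X fC(1) Y fC(2) st]
    have iN': "integrable (lebesgue_on {t0<..<T}) (\<lambda>r. norm (x r - y r))"
      using continuous_imp_integrable_real[OF cn] by (simp add: integrable_Icc_iff_Ioo)
    have "integral {t0..t} (\<lambda>r. inner (f r - g r) (x r - y r)) = integral\<^sup>L (lebesgue_on {t0<..<t}) (\<lambda>r. inner (f r - g r) (x r - y r))"
      using integrable_Ioo_imp_HK(3)[OF en(2), of t0 t] st by simp
    also have "\<dots> \<le> integral\<^sup>L (lebesgue_on {t0<..<T}) (\<lambda>r. 2 * C * norm (x r - y r))"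
    proof (rule integral_mono_lebesgue_on_AE)
      show "integrable (lebesgue_on {t0<..<T}) (\<lambda>r. 2 * C * norm (x r - y r))" using iN' by simp
      have sub: "{t0<..<t} \<subseteq> {t0<..<T}" using st by auto
      have "AE r in lebesgue_on {t0<..<T}. inner (f r - g r) (x r - y r) \<le> 2 * C * norm (x r - y r)"
        using fC
      proof eventually_elim
        case (elim r)
        have "inner (f r - g r) (x r - y r) \<le> norm (f r - g r) * norm (x r - y r)" by (rule norm_cauchy_schwarz)
        also have "\<dots> \<le> 2 * C * norm (x r - y r)"
          using elim norm_triangle_ineq4[of "f r" "g r"] by (intro mult_right_mono) auto
        finally show ?case .
      qed
      then show "AE r in lebesgue_on {t0<..<t}. inner (f r - g r) (x r - y r) \<le> 2 * C * norm (x r - y r)"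
        by (rule AE_lebesgue_on_subset[OF _ sub]) auto
      show "AE r in lebesgue_on {t0<..<T}. 0 \<le> 2 * C * norm (x r - y r)" using C by simp
      show "{t0<..<t} \<subseteq> {t0<..<T}" by (rule sub)
    qed auto
    also have "\<dots> = 2 * C * integral {t0..T} (\<lambda>r. norm (x r - y r))"
      using integrable_Ioo_imp_HK(3)[OF iN', of t0 T] by simp
    also have "\<dots> \<le> 2 * C * (2 * e1)" using C by (intro mult_left_mono L1) auto
    finally have "(norm (x t - y t))\<^sup>2 - (norm (x t0 - y t0))\<^sup>2 \<le> 2 * (2 * C * (2 * e1))" using en(1) by linarith
    moreover have "x t0 = y t0" using f g t0 by (auto simp: trajectory_with_def)
    ultimately have "(norm (x t - y t))\<^sup>2 \<le> e\<^sup>2" using e1(2) by simp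
    then show ?thesis by (rule power2_le_imp_le) (use e in simp)
  qed
  moreover have "finite (code ` ?X)" using code(1) by (intro finite_subset[OF _ n(2)]) auto
  ultimately show ?thesis by blast
qed

text \<open>Before \<open>t1\<close> the new path coincides with \<open>y\<close>, so the source of
  \<open>y\<close> is used there, and the running supremum of \<open>y\<close> is that of
  \<open>x\<close>. The case \<open>t1 = t0\<close> is separate because the joining lemma needs a
  first piece of positive length.\<close>

lemma trajectory_concat:
  fixes \<iota> :: "'v::{banach, second_countable_topology} \<Rightarrow>\<^sub>L 'h::{real_inner, banach, second_countable_topology}"
  assumes pq: "p \<ge> 1" "q \<ge> 1" and t: "0 \<le> t0" "t0 \<le> t1" "t1 < T"
    and y: "y \<in> trajectories \<iota> A p q T L t0 x0" and x: "trajectory_with \<iota> A p q T L t1 y x f"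
  shows "x \<in> trajectories \<iota> A p q T L t0 x0"
proof (cases "t1 = t0")
  case True
  have "trajectory_with \<iota> A p q T L t0 x0 x f"
    using x y unfolding True trajectories_def trajectory_with_def by auto
  then show ?thesis by (auto simp: trajectories_def)
next
  case False
  then have t01: "t0 < t1" using t by simp
  obtain g where g: "trajectory_with \<iota> A p q T L t0 x0 y g" using y by (auto simp: trajectories_def)
  obtain Y Y' where Y: "Wpq \<iota> p q t0 T Y Y'" "AE t in lebesgue_on {t0<..<T}. y t = blinfun_apply \<iota> (Y t)"
    "AE t in lebesgue_on {t0<..<T}. Y' t + A t (Y t) = to_dual \<iota> (g t)"
    using g unfolding trajectory_with_def by blast
  obtain X X' where X: "Wpq \<iota> p q t1 T X X'" "AE t in lebesgue_on {t1<..<T}. x t = blinfun_apply \<iota> (X t)"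
    "AE t in lebesgue_on {t1<..<T}. X' t + A t (X t) = to_dual \<iota> (f t)"
    using x unfolding trajectory_with_def by blast
  have xy: "x t = y t" if "t \<in> {0..t1}" for t using x that unfolding trajectory_with_def by auto
  have gb: "AE t in lebesgue_on {t0<..<T}. norm (g t) \<le> L * (1 + run_sup y t)"
    and fb: "AE t in lebesgue_on {t1<..<T}. norm (f t) \<le> L * (1 + run_sup x t)"
    and Lg: "Lp_fun 2 {t0<..<T} g" and Lf: "Lp_fun 2 {t1<..<T} f"
    using g x unfolding trajectory_with_def by auto
  have cx: "continuous_on {t0..T} x" "continuous_on {t0..T} y"
    using g x t unfolding trajectory_with_def paths_def by (auto intro: continuous_on_subset)
  let ?X = "\<lambda>s. if s < t1 then Y s else X s" and ?X' = "\<lambda>s. if s < t1 then Y' s else X' s"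
    and ?f = "\<lambda>s. if s < t1 then g s else f s"
  have sub: "{t0<..<t1} \<subseteq> {t0<..<T}" using t by auto
  note first = AE_lebesgue_on_subset[OF _ sub]
  have W: "Wpq \<iota> p q t0 T ?X ?X'"
    by (rule Wpq_join[OF Y(1) X(1) pq t01 t(3) cx(2) Y(2) cx(1) _ X(2)]) (use xy t in auto)
  have "Lp_fun 2 {t0<..<T} ?f"
    by (rule Lp_fun_join[OF Lp_fun_subset[OF Lg sub] Lf]) auto
  moreover have "AE t in lebesgue_on {t0<..<T}. x t = blinfun_apply \<iota> (?X t)"
  proof (rule AE_lebesgue_on_join)
    have "AE t in lebesgue_on {t0<..<t1}. y t = blinfun_apply \<iota> (Y t)" by (rule first[OF Y(2)]) auto
    then show "AE t in lebesgue_on {t0<..<t1}. x t = blinfun_apply \<iota> (?X t)"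
      using AE_space by eventually_elim (use xy t in auto)
    show "AE t in lebesgue_on {t1<..<T}. x t = blinfun_apply \<iota> (?X t)"
      using X(2) AE_space by eventually_elim auto
  qed
  moreover have "AE t in lebesgue_on {t0<..<T}. ?X' t + A t (?X t) = to_dual \<iota> (?f t)"
  proof (rule AE_lebesgue_on_join)
    have "AE t in lebesgue_on {t0<..<t1}. Y' t + A t (Y t) = to_dual \<iota> (g t)" by (rule first[OF Y(3)]) auto
    then show "AE t in lebesgue_on {t0<..<t1}. ?X' t + A t (?X t) = to_dual \<iota> (?f t)"
      using AE_space by eventually_elim auto
    show "AE t in lebesgue_on {t1<..<T}. ?X' t + A t (?X t) = to_dual \<iota> (?f t)"
      using X(3) AE_space by eventually_elim auto
  qed
  moreover have "AE t in lebesgue_on {t0<..<T}. norm (?f t) \<le> L * (1 + run_sup x t)"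
  proof (rule AE_lebesgue_on_join)
    have rs: "run_sup y t = run_sup x t" if "t < t1" for t
      unfolding run_sup_def using that xy by (intro arg_cong[where f=Sup] image_cong) auto
    have "AE t in lebesgue_on {t0<..<t1}. norm (g t) \<le> L * (1 + run_sup y t)" by (rule first[OF gb]) auto
    then show "AE t in lebesgue_on {t0<..<t1}. norm (?f t) \<le> L * (1 + run_sup x t)"
      using AE_space by eventually_elim (use rs in auto)
    show "AE t in lebesgue_on {t1<..<T}. norm (?f t) \<le> L * (1 + run_sup x t)"
      using fb AE_space by eventually_elim auto
  qed
  moreover have "x \<in> paths T" "\<forall>t\<in>{0..t0}. x t = x0 t"
    using x g xy t unfolding trajectory_with_def by auto
  ultimately have "trajectory_with \<iota> A p q T L t0 x0 x ?f"
    unfolding trajectory_with_def using W by blast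
  then show ?thesis by (auto simp: trajectories_def)
qed

section \<open>Uniformity of the data on precompact sets of paths\<close>

text \<open>Freezing a path outside the interval places paths among the bounded continuous functions
  on the line without changing the supremum distance. That space is complete, so total boundedness
  yields compactness.\<close>

definition path_extension :: "real \<Rightarrow> (real \<Rightarrow> 'h::metric_space) \<Rightarrow> (real \<Rightarrow>\<^sub>C 'h)" where
  "path_extension T x = Bcontfun (\<lambda>s. x (max 0 (min T s)))"

lemma apply_path_extension:
  fixes x :: "real \<Rightarrow> 'h::real_normed_vector"
  assumes "x \<in> paths T" "T \<ge> 0"
  shows "apply_bcontfun (path_extension T x) s = x (max 0 (min T s))"
proof -
  have c: "continuous_on {0..T} x" using assms by (simp add: paths_def)
  have "continuous_on UNIV (\<lambda>s. x (max 0 (min T s)))"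
    using assms(2) by (intro continuous_on_compose2[OF c]) (auto intro!: continuous_intros)
  moreover have "bounded (range (\<lambda>s. x (max 0 (min T s))))"
    by (rule bounded_subset[OF compact_imp_bounded[OF compact_continuous_image[OF c compact_Icc]]])
      (use assms(2) in auto)
  ultimately have "(\<lambda>s. x (max 0 (min T s))) \<in> bcontfun" by (simp add: bcontfun_def)
  then show ?thesis by (simp add: path_extension_def Bcontfun_inverse)
qed

text \<open>One representative per code gives the centres of a finite net, so the closure of the
  extended paths is compact. The limit is only claimed to be a path and need not belong to
  \<open>X\<close>; the data are continuous on all paths, which is enough.\<close>

lemma paths_seq_compact:
  fixes X :: "(real \<Rightarrow> 'h::banach) set"
  assumes T: "T \<ge> 0" and X: "X \<subseteq> paths T"
    and net: "\<And>e. e > 0 \<Longrightarrow> \<exists>code :: (real \<Rightarrow> 'h) \<Rightarrow> nat \<Rightarrow> 'h. finite (code ` X) \<and>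
      (\<forall>x\<in>X. \<forall>y\<in>X. code x = code y \<longrightarrow> (\<forall>t\<in>{0..T}. norm (x t - y t) \<le> e))"
    and f: "\<And>n::nat. f n \<in> X"
  shows "\<exists>r y. strict_mono r \<and> y \<in> paths T \<and>
    (\<forall>e>0. \<forall>\<^sub>F n in sequentially. \<forall>t\<in>{0..T}. norm (f (r n) t - y t) < e)"
proof -
  define K where "K = closure (path_extension T ` X)"
  have "\<exists>k. finite k \<and> K \<subseteq> (\<Union>z\<in>k. ball z e)" if e: "e > 0" for e
  proof -
    obtain code :: "(real \<Rightarrow> 'h) \<Rightarrow> nat \<Rightarrow> 'h" where code: "finite (code ` X)"
      "\<And>x y t. x \<in> X \<Longrightarrow> y \<in> X \<Longrightarrow> code x = code y \<Longrightarrow> t \<in> {0..T} \<Longrightarrow> norm (x t - y t) \<le> e / 2"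
      using net[of "e / 2"] e by auto
    define rep where "rep c = (SOME x. x \<in> X \<and> code x = c)" for c
    have rep: "rep (code x) \<in> X" "code (rep (code x)) = code x" if "x \<in> X" for x
      using someI[of "\<lambda>y. y \<in> X \<and> code y = code x" x] that unfolding rep_def by auto
    have "path_extension T ` X \<subseteq> (\<Union>c\<in>code ` X. cball (path_extension T (rep c)) (e / 2))"
    proof
      fix z assume "z \<in> path_extension T ` X"
      then obtain x where x: "x \<in> X" "z = path_extension T x" by blast
      have "dist (path_extension T (rep (code x))) z \<le> e / 2"
        unfolding x(2)
      proof (rule dist_bound)
        fix s
        have "norm (rep (code x) (max 0 (min T s)) - x (max 0 (min T s))) \<le> e / 2"
          using T by (intro code(2) rep x(1)) auto
        then show "dist (apply_bcontfun (path_extension T (rep (code x))) s) (apply_bcontfun (path_extension T x) s) \<le> e / 2"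
          using X x(1) rep(1)[OF x(1)] by (simp add: apply_path_extension T subset_iff dist_norm)
      qed
      then show "z \<in> (\<Union>c\<in>code ` X. cball (path_extension T (rep c)) (e / 2))" using x(1) by auto
    qed
    then have "K \<subseteq> (\<Union>c\<in>code ` X. cball (path_extension T (rep c)) (e / 2))"
      unfolding K_def using code(1) by (intro closure_minimal closed_UN) auto
    also have "\<dots> \<subseteq> (\<Union>z\<in>(path_extension T \<circ> rep) ` code ` X. ball z e)"
    proof
      fix z assume "z \<in> (\<Union>c\<in>code ` X. cball (path_extension T (rep c)) (e / 2))"
      then obtain c where c: "c \<in> code ` X" "dist (path_extension T (rep c)) z \<le> e / 2" by auto
      then have "z \<in> ball ((path_extension T \<circ> rep) c) e" using e by simp
      then show "z \<in> (\<Union>z\<in>(path_extension T \<circ> rep) ` code ` X. ball z e)" using c(1) by blast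
    qed
    finally show ?thesis using code(1) by (intro exI[of _ "(path_extension T \<circ> rep) ` code ` X"]) auto
  qed
  then have "compact K"
    unfolding compact_eq_totally_bounded by (simp add: K_def complete_eq_closed)
  moreover have "path_extension T (f n) \<in> K" for n
    unfolding K_def using f by (intro subsetD[OF closure_subset]) auto
  ultimately obtain l r where r: "strict_mono (r :: nat \<Rightarrow> nat)" "((\<lambda>n. path_extension T (f n)) \<circ> r) \<longlonglongrightarrow> l"
    unfolding compact_def by metis
  define y where "y = restrict (apply_bcontfun l) {0..T}"
  have "continuous_on {0..T} (apply_bcontfun l)" by (rule continuous_on_apply_bcontfun)
  then have "continuous_on {0..T} y" by (rule continuous_on_eq) (simp add: y_def)
  then have "y \<in> paths T" by (simp add: paths_def y_def)
  moreover have "\<forall>\<^sub>F n in sequentially. \<forall>t\<in>{0..T}. norm (f (r n) t - y t) < e" if "e > 0" for e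
    using tendstoD[OF r(2) that]
  proof eventually_elim
    case (elim n)
    show ?case
    proof
      fix t assume t: "t \<in> {0..T}"
      have "dist (apply_bcontfun (path_extension T (f (r n))) t) (apply_bcontfun l t) \<le> dist (path_extension T (f (r n))) l"
        by (rule dist_bounded)
      also have "\<dots> < e" using elim by simp
      also have "apply_bcontfun (path_extension T (f (r n))) t = f (r n) t"
        using apply_path_extension[of "f (r n)" T t] X f[of "r n"] T t by auto
      finally show "norm (f (r n) t - y t) < e" using t by (simp add: y_def dist_norm)
    qed
  qed
  ultimately show ?thesis using r(1) by blast
qed

text \<open>Each of the finitely many codes has a representative that is uniformly continuous on the
  compact interval. The smallest of these finitely many moduli works for every path with two errors
  of \<open>e / 3\<close> for the change to the representative.\<close>

lemma equicontinuous_of_net: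
  fixes X :: "(real \<Rightarrow> 'h::banach) set"
  assumes X: "X \<subseteq> paths T"
    and net: "\<And>e. e > 0 \<Longrightarrow> \<exists>code :: (real \<Rightarrow> 'h) \<Rightarrow> nat \<Rightarrow> 'h. finite (code ` X) \<and>
      (\<forall>x\<in>X. \<forall>y\<in>X. code x = code y \<longrightarrow> (\<forall>t\<in>{0..T}. norm (x t - y t) \<le> e))"
    and e: "e > 0"
  shows "\<exists>\<delta>>0. \<forall>x\<in>X. \<forall>s\<in>{0..T}. \<forall>t\<in>{0..T}. \<bar>s - t\<bar> < \<delta> \<longrightarrow> norm (x s - x t) < e"
proof -
  obtain code :: "(real \<Rightarrow> 'h) \<Rightarrow> nat \<Rightarrow> 'h" where code: "finite (code ` X)"
    "\<And>x y t. x \<in> X \<Longrightarrow> y \<in> X \<Longrightarrow> code x = code y \<Longrightarrow> t \<in> {0..T} \<Longrightarrow> norm (x t - y t) \<le> e / 3"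
    using net[of "e / 3"] e by auto
  have "\<forall>c\<in>code ` X. \<exists>\<delta>>0. \<exists>y\<in>X. code y = c \<and> (\<forall>s\<in>{0..T}. \<forall>t\<in>{0..T}. \<bar>s - t\<bar> < \<delta> \<longrightarrow> norm (y s - y t) < e / 3)"
  proof
    fix c assume "c \<in> code ` X"
    then obtain y where y: "y \<in> X" "code y = c" by blast
    have "uniformly_continuous_on {0..T} y"
      using X y by (intro compact_uniformly_continuous) (auto simp: paths_def)
    then obtain \<delta> where "\<delta> > 0" "\<forall>s\<in>{0..T}. \<forall>t\<in>{0..T}. \<bar>s - t\<bar> < \<delta> \<longrightarrow> norm (y s - y t) < e / 3"
      using e unfolding uniformly_continuous_on_def dist_norm real_norm_def
      by (metis abs_minus_commute divide_pos_pos norm_minus_commute zero_less_numeral)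
    then show "\<exists>\<delta>>0. \<exists>y\<in>X. code y = c \<and> (\<forall>s\<in>{0..T}. \<forall>t\<in>{0..T}. \<bar>s - t\<bar> < \<delta> \<longrightarrow> norm (y s - y t) < e / 3)"
      using y by blast
  qed
  from bchoice[OF this] obtain \<delta> where \<delta>: "\<And>c. c \<in> code ` X \<Longrightarrow> \<delta> c > 0"
    "\<And>c. c \<in> code ` X \<Longrightarrow> \<exists>y\<in>X. code y = c \<and> (\<forall>s\<in>{0..T}. \<forall>t\<in>{0..T}. \<bar>s - t\<bar> < \<delta> c \<longrightarrow> norm (y s - y t) < e / 3)"
    by blast
  define d where "d = Min (insert 1 (\<delta> ` code ` X))"
  have fin: "finite (insert 1 (\<delta> ` code ` X))" using code(1) by simp
  have "d \<in> insert 1 (\<delta> ` code ` X)" unfolding d_def using fin by (intro Min_in) auto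
  then have d0: "d > 0" using \<delta>(1) by auto
  have "norm (x s - x t) < e" if x: "x \<in> X" and st: "s \<in> {0..T}" "t \<in> {0..T}" "\<bar>s - t\<bar> < d" for x s t
  proof -
    have "d \<le> \<delta> (code x)" unfolding d_def using fin x by (intro Min_le) auto
    then obtain y where y: "y \<in> X" "code y = code x" "norm (y s - y t) < e / 3"
      using \<delta>(2)[of "code x"] x st by force
    have "x s - x t = (x s - y s) + (y s - y t) + (y t - x t)" by simp
    then have "norm (x s - x t) \<le> norm (x s - y s) + norm (y s - y t) + norm (y t - x t)"
      using norm_triangle_ineq[of "(x s - y s) + (y s - y t)" "y t - x t"] norm_triangle_ineq[of "x s - y s" "y s - y t"]
      by simp
    then show ?thesis
      using code(2)[OF x y(1) y(2)[symmetric] st(1)] code(2)[OF y(1) x y(2) st(2)] y(3) by linarith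
  qed
  then show ?thesis using d0 by blast
qed

lemma d_inf_le:
  assumes "T \<ge> 0" "\<And>r. r \<in> {0..T} \<Longrightarrow> norm (x (min r t) - y (min r s)) \<le> e"
  shows "d_inf T (t, x) (s, y) \<le> \<bar>t - s\<bar> + e"
proof -
  have "(SUP r\<in>{0..T}. norm (x (min r t) - y (min r s))) \<le> e"
    using assms by (intro cSUP_least) auto
  then show ?thesis by (simp add: d_inf_def)
qed

text \<open>The pseudo-metric compares paths stopped at different times. Moving the stopping time of
  \<open>x\<close> from \<open>t\<close> to \<open>s\<close> costs its own modulus of continuity,
  and replacing \<open>x\<close> by \<open>y\<close> costs the uniform distance; a quarter of the
  radius is reserved for each, and what is left for the change of time.\<close>

lemma hamiltonian_near:
  fixes F :: "real \<Rightarrow> (real \<Rightarrow> 'h::{real_inner, banach, second_countable_topology}) \<Rightarrow> 'h \<Rightarrow> real"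
  assumes F: "pm_continuous (\<lambda>(a, z) (b, w). d_inf T a b + norm (z - w))
       (({0..T} \<times> paths T) \<times> UNIV) (\<lambda>((t, x), z). F t x z)"
    and t: "t \<in> {0..T}" and x: "x \<in> paths T" and e: "e > 0"
  shows "\<exists>\<delta>>0. \<forall>s\<in>{0..T}. \<forall>y\<in>paths T. \<bar>t - s\<bar> < \<delta> \<longrightarrow> (\<forall>r\<in>{0..T}. norm (y r - x r) < \<delta>) \<longrightarrow>
    \<bar>F s y z - F t x z\<bar> < e"
proof -
  let ?S = "({0..T} \<times> paths T) \<times> (UNIV :: 'h set)"
  have "((t, x), z) \<in> ?S" using t x by simp
  from F[unfolded pm_continuous_def, rule_format, OF this e]
  have "\<exists>\<delta>>0. \<forall>s y. s \<in> {0..T} \<longrightarrow> y \<in> paths T \<longrightarrow> d_inf T (t, x) (s, y) < \<delta> \<longrightarrow> \<bar>F s y z - F t x z\<bar> < e"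
    apply (elim exE conjE)
    subgoal for \<delta>
      apply (intro exI[of _ \<delta>] conjI allI impI, assumption)
      subgoal for s y by (drule bspec[of _ _ "((s, y), z)"]) simp_all
      done
    done
  then obtain \<delta> where \<delta>: "\<delta> > 0" "\<And>s y. s \<in> {0..T} \<Longrightarrow> y \<in> paths T \<Longrightarrow> d_inf T (t, x) (s, y) < \<delta> \<Longrightarrow> \<bar>F s y z - F t x z\<bar> < e"
    by blast
  have "uniformly_continuous_on {0..T} x"
    using x by (intro compact_uniformly_continuous) (auto simp: paths_def)
  then obtain \<delta>' where \<delta>': "\<delta>' > 0" "\<And>r s. r \<in> {0..T} \<Longrightarrow> s \<in> {0..T} \<Longrightarrow> \<bar>r - s\<bar> < \<delta>' \<Longrightarrow> norm (x r - x s) < \<delta> / 4"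
    using \<delta>(1) unfolding uniformly_continuous_on_def dist_norm real_norm_def
    by (metis abs_minus_commute divide_pos_pos norm_minus_commute zero_less_numeral)
  define \<eta> where "\<eta> = min (\<delta> / 4) \<delta>'"
  have T: "T \<ge> 0" using t by auto
  show ?thesis
  proof (intro exI[of _ \<eta>] conjI ballI impI)
    show "\<eta> > 0" using \<delta> \<delta>' by (simp add: \<eta>_def)
    fix s y assume s: "s \<in> {0..T}" and y: "y \<in> paths T" and ts: "\<bar>t - s\<bar> < \<eta>"
      and near: "\<forall>r\<in>{0..T}. norm (y r - x r) < \<eta>"
    have "d_inf T (t, x) (s, y) \<le> \<bar>t - s\<bar> + \<delta> / 2"
    proof (rule d_inf_le[OF T])
      fix r assume r: "r \<in> {0..T}"
      have ts': "\<bar>t - s\<bar> < \<delta>'" using ts by (simp add: \<eta>_def)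
      have m: "min r t \<in> {0..T}" "min r s \<in> {0..T}" "\<bar>min r t - min r s\<bar> < \<delta>'"
        using r t s ts' \<delta>'(1) by (auto simp: min_def)
      have "norm (x (min r t) - y (min r s)) \<le> norm (x (min r t) - x (min r s)) + norm (x (min r s) - y (min r s))"
        using norm_triangle_ineq[of "x (min r t) - x (min r s)" "x (min r s) - y (min r s)"] by simp
      moreover have "norm (x (min r t) - x (min r s)) < \<delta> / 4" by (rule \<delta>'(2)[OF m])
      moreover have "norm (x (min r s) - y (min r s)) < \<delta> / 4"
        using near m(2) by (simp add: \<eta>_def norm_minus_commute)
      ultimately show "norm (x (min r t) - y (min r s)) \<le> \<delta> / 2" by linarith
    qed
    also have "\<dots> < \<delta>" using ts \<delta>(1) by (simp add: \<eta>_def)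
    finally show "\<bar>F s y z - F t x z\<bar> < e" by (rule \<delta>(2)[OF s y])
  qed
qed

lemma hamiltonian_continuous_time:
  fixes F :: "real \<Rightarrow> (real \<Rightarrow> 'h::{real_inner, banach, second_countable_topology}) \<Rightarrow> 'h \<Rightarrow> real"
  assumes F: "pm_continuous (\<lambda>(a, z) (b, w). d_inf T a b + norm (z - w))
       (({0..T} \<times> paths T) \<times> UNIV) (\<lambda>((t, x), z). F t x z)"
    and x: "x \<in> paths T"
  shows "continuous_on {0..T} (\<lambda>s. F s x z)"
  unfolding continuous_on_iff
proof (intro ballI allI impI)
  fix t e assume t: "t \<in> {0..T}" and e: "(e::real) > 0"
  obtain \<delta> where "\<delta> > 0" "\<forall>s\<in>{0..T}. \<forall>y\<in>paths T. \<bar>t - s\<bar> < \<delta> \<longrightarrow> (\<forall>r\<in>{0..T}. norm (y r - x r) < \<delta>) \<longrightarrow>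
    \<bar>F s y z - F t x z\<bar> < e"
    using hamiltonian_near[OF F t x e] by blast
  then show "\<exists>d>0. \<forall>s\<in>{0..T}. dist s t < d \<longrightarrow> dist (F s x z) (F t x z) < e"
    using x by (intro exI[of _ \<delta>]) (auto simp: dist_real_def abs_minus_commute)
qed

text \<open>Unbounded values would occur along times and paths with a common convergent subsequence,
  but near the limit the values stay within 1 of a single number.\<close>

lemma hamiltonian_bounded:
  fixes F :: "real \<Rightarrow> (real \<Rightarrow> 'h::{real_inner, banach, second_countable_topology}) \<Rightarrow> 'h \<Rightarrow> real"
  assumes F: "pm_continuous (\<lambda>(a, z) (b, w). d_inf T a b + norm (z - w))
       (({0..T} \<times> paths T) \<times> UNIV) (\<lambda>((t, x), z). F t x z)"
    and X: "X \<subseteq> paths T"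
    and cpt: "\<And>f. (\<And>n::nat. f n \<in> X) \<Longrightarrow> \<exists>r y. strict_mono r \<and> y \<in> paths T \<and>
    (\<forall>e>0. \<forall>\<^sub>F n in sequentially. \<forall>t\<in>{0..T}. norm (f (r n) t - y t) < e)"
  shows "\<exists>B. \<forall>t\<in>{0..T}. \<forall>x\<in>X. \<bar>F t x z\<bar> \<le> B"
proof (rule ccontr)
  assume neg: "\<not> ?thesis"
  have "\<forall>n::nat. \<exists>t x. t \<in> {0..T} \<and> x \<in> X \<and> \<bar>F t x z\<bar> > real n"
    using neg by (metis not_le)
  then obtain \<tau> f where f: "\<And>n::nat. \<tau> n \<in> {0..T}" "\<And>n. f n \<in> X" "\<And>n. \<bar>F (\<tau> n) (f n) z\<bar> > real n"
    by metis
  obtain r y where r: "strict_mono r" "y \<in> paths T"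
    "\<And>e. e > 0 \<Longrightarrow> \<forall>\<^sub>F n in sequentially. \<forall>t\<in>{0..T}. norm (f (r n) t - y t) < e"
    using cpt[of f, OF f(2)] by blast
  have "compact {0..T}" by simp
  then obtain t r' where t: "t \<in> {0..T}" "strict_mono r'" "((\<lambda>n. \<tau> (r n)) \<circ> r') \<longlonglongrightarrow> t"
    unfolding compact_def using f(1) by metis
  obtain \<delta> where \<delta>: "\<delta> > 0" "\<forall>s\<in>{0..T}. \<forall>x\<in>paths T. \<bar>t - s\<bar> < \<delta> \<longrightarrow> (\<forall>r\<in>{0..T}. norm (x r - y r) < \<delta>) \<longrightarrow>
    \<bar>F s x z - F t y z\<bar> < 1"
    using hamiltonian_near[OF F t(1) r(2) zero_less_one, of z] by blast
  have "\<forall>\<^sub>F n in sequentially. \<forall>t\<in>{0..T}. norm (f (r (r' n)) t - y t) < \<delta>"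
    using eventually_subseq[OF t(2) r(3)[OF \<delta>(1)]] .
  moreover have "\<forall>\<^sub>F n in sequentially. \<bar>t - \<tau> (r (r' n))\<bar> < \<delta>"
    using tendstoD[OF t(3) \<delta>(1)] by eventually_elim (simp add: dist_real_def abs_minus_commute)
  moreover have "\<forall>\<^sub>F n in sequentially. real n > \<bar>F t y z\<bar> + 1"
    using filterlim_real_sequentially unfolding filterlim_at_top_dense by blast
  ultimately have "\<forall>\<^sub>F n in sequentially. False"
  proof eventually_elim
    case (elim n)
    have "\<bar>F (\<tau> (r (r' n))) (f (r (r' n))) z - F t y z\<bar> < 1"
      using \<delta>(2) f(1)[of "r (r' n)"] f(2)[of "r (r' n)"] X elim by blast
    moreover have "n \<le> r (r' n)" using seq_suble[OF r(1)] seq_suble[OF t(2)] order_trans by blast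
    then have "real n \<le> real (r (r' n))" by simp
    moreover have "\<bar>F (\<tau> (r (r' n))) (f (r (r' n))) z\<bar> > real (r (r' n))" by (rule f(3))
    ultimately show False using elim by linarith
  qed
  then show False by simp
qed

lemma terminal_near:
  assumes h: "pm_continuous (sup_dist T) (paths T) h" and y: "y \<in> paths T" and T: "T \<ge> 0" and e: "e > 0"
  shows "\<exists>\<delta>>0. \<forall>x\<in>paths T. (\<forall>t\<in>{0..T}. norm (x t - y t) < \<delta>) \<longrightarrow> \<bar>h x - h y\<bar> < e"
proof -
  obtain \<delta> where \<delta>: "\<delta> > 0" "\<And>x. x \<in> paths T \<Longrightarrow> sup_dist T y x < \<delta> \<Longrightarrow> \<bar>h x - h y\<bar> < e"
    using h y e unfolding pm_continuous_def by blast
  show ?thesis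
  proof (intro exI[of _ "\<delta> / 2"] conjI ballI impI)
    fix x assume x: "x \<in> paths T" and n: "\<forall>t\<in>{0..T}. norm (x t - y t) < \<delta> / 2"
    have "sup_dist T y x \<le> \<delta> / 2"
      unfolding sup_dist_def using n T by (intro cSUP_least) (auto simp: norm_minus_commute intro: less_imp_le)
    then show "\<bar>h x - h y\<bar> < e" using \<delta> x by simp
  qed (use \<delta> in simp)
qed

lemma terminal_bounded:
  assumes h: "pm_continuous (sup_dist T) (paths T) h" and T: "T \<ge> 0" and X: "X \<subseteq> paths T"
    and cpt: "\<And>f. (\<And>n::nat. f n \<in> X) \<Longrightarrow> \<exists>r y. strict_mono r \<and> y \<in> paths T \<and>
    (\<forall>e>0. \<forall>\<^sub>F n in sequentially. \<forall>t\<in>{0..T}. norm (f (r n) t - y t) < e)"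
  shows "\<exists>B. \<forall>x\<in>X. \<bar>h x\<bar> \<le> B"
proof (rule ccontr)
  assume neg: "\<not> ?thesis"
  have "\<forall>n::nat. \<exists>x. x \<in> X \<and> \<bar>h x\<bar> > real n"
    using neg by (metis not_le)
  then obtain f where f: "\<And>n. f n \<in> X" "\<And>n::nat. \<bar>h (f n)\<bar> > real n" by metis
  obtain r y where r: "strict_mono r" "y \<in> paths T"
    "\<And>e. e > 0 \<Longrightarrow> \<forall>\<^sub>F n in sequentially. \<forall>t\<in>{0..T}. norm (f (r n) t - y t) < e"
    using cpt[of f, OF f(1)] by blast
  obtain \<delta> where \<delta>: "\<delta> > 0" "\<forall>x\<in>paths T. (\<forall>t\<in>{0..T}. norm (x t - y t) < \<delta>) \<longrightarrow> \<bar>h x - h y\<bar> < 1"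
    using terminal_near[OF h r(2) T, of 1] by auto
  have "\<forall>\<^sub>F n in sequentially. real n > \<bar>h y\<bar> + 1"
    using filterlim_real_sequentially unfolding filterlim_at_top_dense by blast
  with r(3)[OF \<delta>(1)] have "\<forall>\<^sub>F n in sequentially. False"
  proof eventually_elim
    case (elim n)
    have "\<bar>h (f (r n)) - h y\<bar> < 1" using \<delta>(2) f(1)[of "r n"] X elim by blast
    moreover have "real n \<le> real (r n)" using seq_suble[OF r(1)] by simp
    moreover have "\<bar>h (f (r n))\<bar> > real (r n)" by (rule f(2))
    ultimately show False using elim by linarith
  qed
  then show False by simp
qed

text \<open>Heine's argument on a precompact set: two sequences that violate the claim at distance
  tending to zero have a common limit path along a subsequence, and continuity there brings both
  values within \<open>e / 2\<close> of the same number.\<close>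

lemma terminal_uniform:
  assumes h: "pm_continuous (sup_dist T) (paths T) h" and T: "T \<ge> 0" and X: "X \<subseteq> paths T"
    and cpt: "\<And>f. (\<And>n::nat. f n \<in> X) \<Longrightarrow> \<exists>r y. strict_mono r \<and> y \<in> paths T \<and>
    (\<forall>e>0. \<forall>\<^sub>F n in sequentially. \<forall>t\<in>{0..T}. norm (f (r n) t - y t) < e)"
    and e: "e > 0"
  shows "\<exists>\<delta>>0. \<forall>x\<in>X. \<forall>y\<in>X. (\<forall>t\<in>{0..T}. norm (x t - y t) < \<delta>) \<longrightarrow> \<bar>h x - h y\<bar> < e"
proof (rule ccontr)
  assume neg: "\<not> ?thesis"
  have "\<forall>n::nat. \<exists>x x'. x \<in> X \<and> x' \<in> X \<and> (\<forall>t\<in>{0..T}. norm (x t - x' t) < inverse (Suc n)) \<and> \<not> \<bar>h x - h x'\<bar> < e"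
    using neg by (metis inverse_positive_iff_positive of_nat_0_less_iff zero_less_Suc)
  then obtain f f' where f: "\<And>n. f n \<in> X" "\<And>n. f' n \<in> X"
    "\<And>n::nat. \<forall>t\<in>{0..T}. norm (f n t - f' n t) < inverse (Suc n)" "\<And>n. \<not> \<bar>h (f n) - h (f' n)\<bar> < e" by metis
  obtain r y where r: "strict_mono r" "y \<in> paths T"
    "\<And>e. e > 0 \<Longrightarrow> \<forall>\<^sub>F n in sequentially. \<forall>t\<in>{0..T}. norm (f (r n) t - y t) < e"
    using cpt[of f, OF f(1)] by blast
  obtain \<delta> where \<delta>: "\<delta> > 0" "\<forall>x\<in>paths T. (\<forall>t\<in>{0..T}. norm (x t - y t) < \<delta>) \<longrightarrow> \<bar>h x - h y\<bar> < e / 2"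
    using terminal_near[OF h r(2) T, of "e / 2"] e by auto
  have d2: "\<delta> / 2 > 0" using \<delta>(1) by simp
  have "\<forall>\<^sub>F n in sequentially. inverse (real (Suc n)) < \<delta> / 2"
    using order_tendstoD(2)[OF LIMSEQ_inverse_real_of_nat d2] .
  with r(3)[OF d2] have "\<forall>\<^sub>F n in sequentially. False"
  proof eventually_elim
    case (elim n)
    have "n \<le> r n" using seq_suble[OF r(1)] .
    then have inv: "inverse (real (Suc (r n))) \<le> inverse (real (Suc n))" by (intro le_imp_inverse_le) auto
    have "norm (f (r n) t - y t) < \<delta> \<and> norm (f' (r n) t - y t) < \<delta>" if t: "t \<in> {0..T}" for t
    proof -
      have 1: "norm (f (r n) t - y t) < \<delta> / 2" using elim t by blast
      have 2: "norm (f (r n) t - f' (r n) t) < \<delta> / 2" 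
      proof -
        have "norm (f (r n) t - f' (r n) t) < inverse (real (Suc (r n)))" using f(3)[of "r n"] t by blast
        then show ?thesis using inv elim(2) by linarith
      qed
      have "norm (f' (r n) t - y t) \<le> norm (f (r n) t - y t) + norm (f (r n) t - f' (r n) t)"
        using norm_triangle_ineq4[of "f (r n) t - y t" "f (r n) t - f' (r n) t"] by simp
      then show ?thesis using 1 2 \<delta>(1) by linarith
    qed
    then have "\<bar>h (f (r n)) - h y\<bar> < e / 2" "\<bar>h (f' (r n)) - h y\<bar> < e / 2"
      using \<delta>(2) f(1,2)[of "r n"] X by blast+
    then show False using f(4)[of "r n"] by linarith
  qed
  then show False by simp
qed

section \<open>The comparison principle\<close>

text \<open>The two semisolution inequalities are subtracted and the energy inequality divided by 2
  \<epsilon> is added. The sources then enter only through the inner product of f - g with (x - y) /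
  \<epsilon> - z, which is small as long as the slope has not moved far from z. The growth of the
  integral penalty is included in the integrand, which explains the last summand in
  \<open>bound\<close>.\<close>

lemma doubled_step_inequality:
  fixes \<iota> :: "'v::{banach, second_countable_topology} \<Rightarrow>\<^sub>L 'h::{real_inner, banach, second_countable_topology}"
  assumes pq: "p \<ge> 2" "q > 1" "1 / p + 1 / q = 1"
    and A: "admissible_operator T p q A" and t1: "0 \<le> t1"
    and x: "solves \<iota> A p q t1 T x f X X'" "AE t in lebesgue_on {t1<..<T}. norm (f t) \<le> C"
    and y: "solves \<iota> A p q t1 T y g Y Y'" "AE t in lebesgue_on {t1<..<T}. norm (g t) \<le> C"
    and F: "continuous_on {t1..T} (\<lambda>s. F s x z)" "continuous_on {t1..T} (\<lambda>s. F s y z)"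
    and \<epsilon>: "\<epsilon> > 0" and t: "t1 \<le> t" "t \<le> T"
    and u: "U1 \<le> integral\<^sup>L (lebesgue_on {t1..t}) (\<lambda>s. - inner (f s) z + F s x z) + U2"
    and v: "V1 \<ge> integral\<^sup>L (lebesgue_on {t1..t}) (\<lambda>s. - inner (g s) z + F s y z) + V2"
    and bound: "\<And>s. s \<in> {t1..t} \<Longrightarrow>
      2 * C * norm ((1 / \<epsilon>) *\<^sub>R (x s - y s) - z) + (F s x z - F s y z) + (1 / \<epsilon>) * (norm (x s - y s))\<^sup>2 \<le> b"
  shows "U1 - V1 + (norm (x t - y t))\<^sup>2 / (2 * \<epsilon>) + (1 / \<epsilon>) * integral {t1..t} (\<lambda>s. (norm (x s - y s))\<^sup>2)
    \<le> U2 - V2 + (norm (x t1 - y t1))\<^sup>2 / (2 * \<epsilon>) + (t - t1) * b"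
proof -
  let ?M = "lebesgue_on {t1<..<T}"
  have cx: "continuous_on {t1..T} x" "continuous_on {t1..T} y"
    and mf: "f \<in> borel_measurable ?M" "g \<in> borel_measurable ?M"
    using x(1) y(1) by (auto simp: solves_def)
  have iF: "integrable ?M (\<lambda>s. F s x z)" "integrable ?M (\<lambda>s. F s y z)"
    using continuous_imp_integrable_real[OF F(1)] continuous_imp_integrable_real[OF F(2)]
    by (simp_all add: integrable_Icc_iff_Ioo)
  have iz: "integrable ?M (\<lambda>s. inner (f s) z)" "integrable ?M (\<lambda>s. inner (g s) z)"
    by (rule integrable_bounded_inner[OF mf(1) x(2) continuous_on_const], rule integrable_bounded_inner[OF mf(2) y(2) continuous_on_const])
  define ku where "ku s = - inner (f s) z + F s x z" for s
  define kv where "kv s = - inner (g s) z + F s y z" for s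
  define N where "N s = (norm (x s - y s))\<^sup>2" for s
  define E where "E s = inner (f s - g s) (x s - y s)" for s
  have iku: "integrable ?M ku" "integrable ?M kv" unfolding ku_def kv_def using iF iz by simp_all
  have "continuous_on {t1..T} N" unfolding N_def by (intro continuous_intros cx)
  then have iN: "integrable ?M N"
    using continuous_imp_integrable_real by (simp add: integrable_Icc_iff_Ioo[symmetric])
  have iE: "integrable ?M E" unfolding E_def
    using solves_energy_diff(2)[OF pq A t1 x y order_refl t] .
  have en: "N t - N t1 \<le> 2 * integral {t1..t} E"
    unfolding N_def E_def using solves_energy_diff(1)[OF pq A t1 x y order_refl t] .
  note HK = integrable_Ioo_imp_HK[OF _ order_refl t(2)]
  define k where "k s = ku s - kv s + (1 / \<epsilon>) * E s + (1 / \<epsilon>) * N s" for s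
  have ik: "integrable ?M k" unfolding k_def using iku iE iN by simp
  have keq: "integral {t1..t} k = integral {t1..t} ku - integral {t1..t} kv + (1 / \<epsilon>) * integral {t1..t} E + (1 / \<epsilon>) * integral {t1..t} N"
    unfolding HK(2)[OF ik, symmetric] HK(2)[OF iku(1), symmetric] HK(2)[OF iku(2), symmetric] HK(2)[OF iE, symmetric] HK(2)[OF iN, symmetric]
    using integrable_Ioo_imp_Icc[OF iku(1) order_refl t(2)] integrable_Ioo_imp_Icc[OF iku(2) order_refl t(2)]
      integrable_Ioo_imp_Icc[OF iE order_refl t(2)] integrable_Ioo_imp_Icc[OF iN order_refl t(2)]
    unfolding k_def by simp
  have sub: "{t1<..<t} \<subseteq> {t1<..<T}" using t by auto
  have "integral {t1..t} k = integral\<^sup>L (lebesgue_on {t1<..<t}) k" using HK(3)[OF ik] by simp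
  also have "\<dots> \<le> (t - t1) * b"
  proof (rule integral_AE_le_const[OF _ _ t(1)])
    show "integrable (lebesgue_on {t1<..<t}) k" by (rule integrable_lebesgue_on_subset[OF ik sub]) auto
    have "AE s in lebesgue_on {t1<..<t}. norm (f s) \<le> C" "AE s in lebesgue_on {t1<..<t}. norm (g s) \<le> C"
      by (rule AE_lebesgue_on_subset[OF x(2) sub], auto) (rule AE_lebesgue_on_subset[OF y(2) sub], auto)
    then show "AE s in lebesgue_on {t1<..<t}. k s \<le> b"
      using AE_space
    proof eventually_elim
      case (elim s)
      have "k s = inner (f s - g s) ((1 / \<epsilon>) *\<^sub>R (x s - y s) - z) + (F s x z - F s y z) + (1 / \<epsilon>) * N s"
        unfolding k_def ku_def kv_def E_def by (simp add: inner_diff_left inner_diff_right)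
      also have "inner (f s - g s) ((1 / \<epsilon>) *\<^sub>R (x s - y s) - z) \<le> norm (f s - g s) * norm ((1 / \<epsilon>) *\<^sub>R (x s - y s) - z)"
        by (rule norm_cauchy_schwarz)
      also have "norm (f s - g s) * norm ((1 / \<epsilon>) *\<^sub>R (x s - y s) - z) \<le> 2 * C * norm ((1 / \<epsilon>) *\<^sub>R (x s - y s) - z)"
        using elim norm_triangle_ineq4[of "f s" "g s"] by (intro mult_right_mono) auto
      finally show ?case using bound[of s] elim unfolding N_def by simp
    qed
  qed
  finally have kb: "integral {t1..t} k \<le> (t - t1) * b" .
  have "U1 \<le> integral {t1..t} ku + U2" "V1 \<ge> integral {t1..t} kv + V2"
    using u v HK(2)[OF iku(1)] HK(2)[OF iku(2)] unfolding ku_def[symmetric] kv_def[symmetric] by simp_all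
  moreover have "N t / (2 * \<epsilon>) - N t1 / (2 * \<epsilon>) \<le> (1 / \<epsilon>) * integral {t1..t} E"
    using divide_right_mono[OF en, of "2 * \<epsilon>"] \<epsilon> by (simp add: diff_divide_distrib)
  ultimately show ?thesis
    using kb unfolding keq N_def[symmetric] by linarith
qed

lemma integral_le_bound:
  fixes g :: "real \<Rightarrow> real"
  assumes "continuous_on {a..b} g" "\<And>s. s \<in> {a..b} \<Longrightarrow> g s \<le> B" "a \<le> b"
  shows "integral\<^sup>L (lebesgue_on {a..b}) g \<le> (b - a) * B"
proof -
  have "integral\<^sup>L (lebesgue_on {a..b}) g = integral {a..b} g"
    by (rule lebesgue_integral_eq_integral[OF continuous_imp_integrable_real[OF assms(1)]]) simp
  also have "\<dots> \<le> integral {a..b} (\<lambda>_. B)"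
    using assms by (intro integral_le integrable_continuous_interval) auto
  finally show ?thesis using assms(3) by (simp add: mult.commute)
qed

text \<open>If |x - y| exceeds \<open>e\<close> at some time, equicontinuity keeps it above
  \<open>e / 2\<close> on a preceding window of fixed length \<open>d\<close>. The window cannot
  reach back to \<open>t0\<close>, where the paths coincide, so it lies in the domain of integration
  and contributes at least \<open>d * (e / 2)\<^sup>2\<close>, which is more than \<sigma>.\<close>

lemma sup_small_of_integral_small:
  fixes X :: "(real \<Rightarrow> 'h::real_normed_vector) set"
  assumes t0: "0 \<le> t0" and X: "X \<subseteq> paths T"
    and equi: "\<And>e. e > 0 \<Longrightarrow> \<exists>\<delta>>0. \<forall>x\<in>X. \<forall>s\<in>{0..T}. \<forall>t\<in>{0..T}. \<bar>s - t\<bar> < \<delta> \<longrightarrow> norm (x s - x t) < e"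
    and init: "\<And>x y t. x \<in> X \<Longrightarrow> y \<in> X \<Longrightarrow> t \<in> {0..t0} \<Longrightarrow> x t = y t"
    and e: "e > 0"
  shows "\<exists>\<sigma>>0. \<forall>x\<in>X. \<forall>y\<in>X. \<forall>t\<in>{t0..T}. integral {t0..t} (\<lambda>s. (norm (x s - y s))\<^sup>2) \<le> \<sigma> \<longrightarrow>
    (\<forall>r\<in>{0..t}. norm (x r - y r) \<le> e)"
proof -
  obtain \<delta> where \<delta>: "\<delta> > 0" "\<And>x s t. x \<in> X \<Longrightarrow> s \<in> {0..T} \<Longrightarrow> t \<in> {0..T} \<Longrightarrow> \<bar>s - t\<bar> < \<delta> \<Longrightarrow> norm (x s - x t) < e / 4"
    using equi[of "e / 4"] e by auto
  define d where "d = \<delta> / 2"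
  have d: "0 < d" "d < \<delta>" using \<delta>(1) by (auto simp: d_def)
  define \<sigma> where "\<sigma> = d * (e / 2)\<^sup>2 / 2"
  have \<sigma>: "\<sigma> > 0" "\<sigma> < d * (e / 2)\<^sup>2" using d e by (auto simp: \<sigma>_def)
  have "norm (x r - y r) \<le> e"
    if x: "x \<in> X" and y: "y \<in> X" and t: "t \<in> {t0..T}" and J: "integral {t0..t} (\<lambda>s. (norm (x s - y s))\<^sup>2) \<le> \<sigma>" and r: "r \<in> {0..t}" for x y t r
  proof (rule ccontr)
    assume "\<not> norm (x r - y r) \<le> e"
    then have big: "norm (x r - y r) > e" by simp
    have near: "norm (x s - y s) > e / 2" if s: "s \<in> {0..T}" "\<bar>s - r\<bar> < \<delta>" for s
    proof -
      have rT: "r \<in> {0..T}" using r t t0 by auto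
      have "norm (x r - x s) < e / 4" "norm (y s - y r) < e / 4"
        using \<delta>(2)[OF x rT s(1)] \<delta>(2)[OF y s(1) rT] s(2) by (auto simp: abs_minus_commute)
      moreover have "norm (x r - y r) \<le> norm (x r - x s) + norm (x s - y s) + norm (y s - y r)"
        using norm_triangle_ineq[of "(x r - x s) + (x s - y s)" "y s - y r"] norm_triangle_ineq[of "x r - x s" "x s - y s"] by simp
      ultimately show ?thesis using big by linarith
    qed
    have "r > t0"
    proof (rule ccontr)
      assume "\<not> r > t0"
      then have "x r = y r" using init[OF x y, of r] r by simp
      then show False using big e by simp
    qed
    have rd: "t0 \<le> r - d"
    proof (rule ccontr)
      assume "\<not> t0 \<le> r - d"
      then have "norm (x t0 - y t0) > e / 2" using \<open>r > t0\<close> d t t0 by (intro near) auto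
      moreover have "x t0 = y t0" using init[OF x y, of t0] t0 by simp
      ultimately show False using e by simp
    qed
    have cxy: "continuous_on {0..T} x" "continuous_on {0..T} y" using X x y by (auto simp: paths_def)
    have cN: "continuous_on {0..T} (\<lambda>s. (norm (x s - y s))\<^sup>2)" by (intro continuous_intros cxy)
    have iN: "(\<lambda>s. (norm (x s - y s))\<^sup>2) integrable_on {c..c'}" if "0 \<le> c" "c' \<le> T" for c c'
      using that by (intro integrable_continuous_interval continuous_on_subset[OF cN]) auto
    have "integral {r - d..r} (\<lambda>s. (e / 2)\<^sup>2) \<le> integral {r - d..r} (\<lambda>s. (norm (x s - y s))\<^sup>2)"
    proof (intro integral_le iN)
      show "(\<lambda>s. (e / 2)\<^sup>2) integrable_on {r - d..r}" by (rule integrable_const_ivl)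
      show "(e / 2)\<^sup>2 \<le> (norm (x s - y s))\<^sup>2" if "s \<in> {r - d..r}" for s
        using near[of s] that d rd t0 r t e by (intro power_mono) auto
    qed (use rd t0 r t in auto)
    also have "\<dots> \<le> integral {t0..t} (\<lambda>s. (norm (x s - y s))\<^sup>2)"
      using rd r t t0 d by (intro integral_subset_le iN) auto
    finally have "d * (e / 2)\<^sup>2 \<le> \<sigma>" using J d by simp
    then show False using \<sigma>(2) by simp
  qed
  then show ?thesis using \<sigma>(1) by blast
qed

text \<open>The argument is localised at the presumed violation: all competitors are trajectories
  issuing from \<open>(t0, x0)\<close> that lie in \<open>\<Omega>\<close>. They share the past of
  \<open>x0\<close>, so the penalty vanishes at time \<open>t0\<close>, and they form a precompact
  set with uniform bounds.\<close>

lemma minimax_comparison: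
  fixes \<iota> :: "'v::{banach, second_countable_topology} \<Rightarrow>\<^sub>L 'h::{real_inner, banach, second_countable_topology}"
  assumes T: "T > 0" and pq: "p \<ge> 2" "q > 1" "1 / p + 1 / q = 1"
    and emb: "compact_dense_embedding \<iota>" and A: "admissible_operator T p q A"
    and h: "pm_continuous (sup_dist T) (paths T) h"
    and F: "admissible_hamiltonian \<iota> A p q T F" and L: "L \<ge> 0"
    and \<Omega>: "\<Omega> \<subseteq> paths T"
    and u: "minimax_subsolution \<iota> A p q T F h L \<Omega> u" and v: "minimax_supersolution \<iota> A p q T F h L \<Omega> v"
    and t0: "0 \<le> t0" "t0 < T" and x0: "x0 \<in> \<Omega>"
  shows "u t0 x0 \<le> v t0 x0"
proof (rule ccontr)
  assume "\<not> u t0 x0 \<le> v t0 x0"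
  define M0 where "M0 = u t0 x0 - v t0 x0"
  have M0: "M0 > 0" using \<open>\<not> u t0 x0 \<le> v t0 x0\<close> by (simp add: M0_def)
  have T0: "T \<ge> 0" using T by simp
  have x0p: "x0 \<in> paths T" using x0 \<Omega> by blast
  define Tr where "Tr = trajectories \<iota> A p q T L t0 x0"
  define X where "X = Tr \<inter> \<Omega>"
  have Trp: "Tr \<subseteq> paths T" by (auto simp: Tr_def trajectories_def trajectory_with_def)
  have XTr: "X \<subseteq> Tr" and Xp: "X \<subseteq> paths T" using Trp by (auto simp: X_def)
  have init: "x t = x0 t" if "x \<in> Tr" "t \<in> {0..t0}" for x t
    using that by (auto simp: Tr_def trajectories_def trajectory_with_def)
  obtain R where R: "R \<ge> 0" "\<And>x f t. trajectory_with \<iota> A p q T L t0 x0 x f \<Longrightarrow> t \<in> {0..T} \<Longrightarrow> norm (x t) \<le> R"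
    using trajectory_bound[OF pq A t0 x0p L] by blast
  have RX: "norm (x t) \<le> R" if "x \<in> Tr" "t \<in> {0..T}" for x t
    using that R(2) by (auto simp: Tr_def trajectories_def)
  define C where "C = L * (1 + R)"
  have C: "C \<ge> 0" using L R by (simp add: C_def)
  have net: "\<exists>code :: (real \<Rightarrow> 'h) \<Rightarrow> nat \<Rightarrow> 'h. finite (code ` Tr) \<and>
      (\<forall>x\<in>Tr. \<forall>y\<in>Tr. code x = code y \<longrightarrow> (\<forall>t\<in>{0..T}. norm (x t - y t) \<le> e))" if "e > 0" for e
    using trajectories_sup_net[OF pq emb A t0 x0p L that] unfolding Tr_def .
  note cpt = paths_seq_compact[OF T0 Trp net]
  note equi = equicontinuous_of_net[OF Trp net]
  obtain L0 where L0: "L0 \<ge> 0" "\<And>t x z z'. t \<in> {0..T} \<Longrightarrow> x \<in> paths T \<Longrightarrow>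
        \<bar>F t x z - F t x z'\<bar> \<le> L0 * (1 + run_sup x t) * norm (z - z')"
    using F unfolding admissible_hamiltonian_def by blast
  define L1 where "L1 = L0 * (1 + R)"
  have L1: "L1 \<ge> 0" using L0 R by (simp add: L1_def)
  have FL: "\<bar>F t x z - F t x z'\<bar> \<le> L1 * norm (z - z')" if "t \<in> {0..T}" "x \<in> Tr" for t x z z'
  proof -
    have "run_sup x t \<le> R" using that RX by (intro run_sup_le) auto
    then have "L0 * (1 + run_sup x t) * norm (z - z') \<le> L1 * norm (z - z')"
      unfolding L1_def using L0(1) by (intro mult_right_mono mult_left_mono) auto
    then show ?thesis using L0(2)[of t x z z'] that Trp by force
  qed
  have Fpm: "pm_continuous (\<lambda>(a, z) (b, w). d_inf T a b + norm (z - w))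
       (({0..T} \<times> paths T) \<times> UNIV) (\<lambda>((t, x), z). F t x z)"
    using F unfolding admissible_hamiltonian_def by blast
  have Fc: "continuous_on S (\<lambda>s. F s x z)" if "x \<in> Tr" "S \<subseteq> {0..T}" for x z S
    using hamiltonian_continuous_time[OF Fpm, of x z] that Trp by (blast intro: continuous_on_subset)
  have "\<exists>m. modulus_of_continuity m \<and>
        (\<forall>\<epsilon>>0. \<forall>t\<in>{t0..T}. \<forall>x\<in>Tr. \<forall>y\<in>Tr.
           F t x ((1 / \<epsilon>) *\<^sub>R (x t - y t)) - F t y ((1 / \<epsilon>) *\<^sub>R (x t - y t))
             \<le> m ((1 / \<epsilon>) * (norm (x t - y t))\<^sup>2 + (SUP s\<in>{0..t}. norm (x s - y s))))"
    using F L t0 x0p unfolding admissible_hamiltonian_def Tr_def by auto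
  then obtain m where m: "modulus_of_continuity m" "\<And>\<epsilon> t x y. \<epsilon> > 0 \<Longrightarrow> t \<in> {t0..T} \<Longrightarrow> x \<in> Tr \<Longrightarrow> y \<in> Tr \<Longrightarrow>
           F t x ((1 / \<epsilon>) *\<^sub>R (x t - y t)) - F t y ((1 / \<epsilon>) *\<^sub>R (x t - y t))
             \<le> m ((1 / \<epsilon>) * (norm (x t - y t))\<^sup>2 + (SUP s\<in>{0..t}. norm (x s - y s)))"
    by blast
  \<comment> \<open>The modulus is monotone, so any upper bound \<open>d\<close> of the running
    distance may stand in for the supremum.\<close>
  have Fm: "F t x ((1 / \<epsilon>) *\<^sub>R (x t - y t)) - F t y ((1 / \<epsilon>) *\<^sub>R (x t - y t)) \<le> m b"
    if "\<epsilon> > 0" and t: "t \<in> {t0..T}" and x: "x \<in> Tr" and y: "y \<in> Tr"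
      and d: "\<And>s. s \<in> {0..t} \<Longrightarrow> norm (x s - y s) \<le> d" and b: "(1 / \<epsilon>) * (norm (x t - y t))\<^sup>2 + d \<le> b" for \<epsilon> t x y d b
  proof -
    let ?S = "SUP s\<in>{0..t}. norm (x s - y s)"
    have 1: "?S \<le> d" using t t0 d by (intro cSUP_least) auto
    have bdd: "bdd_above ((\<lambda>s. norm (x s - y s)) ` {0..t})"
      by (rule bdd_aboveI2[where M=d]) (rule d)
    have "norm (x 0 - y 0) \<le> ?S" using t t0 by (intro cSUP_upper[OF _ bdd]) auto
    then have 2: "0 \<le> ?S" using norm_ge_zero order_trans by blast
    have 3: "0 \<le> (1 / \<epsilon>) * (norm (x t - y t))\<^sup>2" using that(1) by simp
    have "m ((1 / \<epsilon>) * (norm (x t - y t))\<^sup>2 + ?S) \<le> m b"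
      using m(1) 1 2 3 b unfolding modulus_of_continuity_def
      by (intro mono_onD[of "{0..}" m]) auto
    then show ?thesis using m(2)[OF that(1) t x y] by linarith
  qed
  note usub = u[unfolded minimax_subsolution_def, THEN conjunct2, THEN conjunct2, rule_format]
  note vsup = v[unfolded minimax_supersolution_def, THEN conjunct2, THEN conjunct2, rule_format]
  \<comment> \<open>The alternative in the assumption on \<open>x\<close> admits \<open>x0\<close>
    itself, which lies in \<open>\<Omega>\<close> but need not be a trajectory after time
    \<open>t0\<close>. In the other case concatenation brings the new path back to the
    competitors.\<close>
  have stepu: "\<exists>x'\<in>X. \<exists>f. trajectory_with \<iota> A p q T L t1 x x' f \<and> (\<forall>t\<in>{t1..T}. u t1 x \<le>
      integral\<^sup>L (lebesgue_on {t1..t}) (\<lambda>s. - inner (f s) z + F s x' z) + u t x')"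
    if t1: "t0 \<le> t1" "t1 < T" and x: "x \<in> \<Omega>" "x \<in> Tr \<or> (t1 = t0 \<and> x = x0)" for t1 x z
  proof -
    obtain x' f where x': "x' \<in> \<Omega>" "trajectory_with \<iota> A p q T L t1 x x' f" "\<forall>t\<in>{t1..T}. u t1 x \<le>
      integral\<^sup>L (lebesgue_on {t1..t}) (\<lambda>s. - inner (f s) z + F s x' z) + u t x'"
      using usub[OF _ x(1), of t1 z] t1 t0 by auto
    have "x' \<in> Tr"
      using x(2)
    proof
      assume "x \<in> Tr"
      then show ?thesis unfolding Tr_def
        using trajectory_concat[OF _ _ t0(1) t1 _ x'(2)] pq by simp
    qed (use x'(2) in \<open>auto simp: Tr_def trajectories_def\<close>)
    then show ?thesis using x' by (auto simp: X_def)
  qed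
  have stepv: "\<exists>x'\<in>X. \<exists>f. trajectory_with \<iota> A p q T L t1 x x' f \<and> (\<forall>t\<in>{t1..T}. v t1 x \<ge>
      integral\<^sup>L (lebesgue_on {t1..t}) (\<lambda>s. - inner (f s) z + F s x' z) + v t x')"
    if t1: "t0 \<le> t1" "t1 < T" and x: "x \<in> \<Omega>" "x \<in> Tr \<or> (t1 = t0 \<and> x = x0)" for t1 x z
  proof -
    obtain x' f where x': "x' \<in> \<Omega>" "trajectory_with \<iota> A p q T L t1 x x' f" "\<forall>t\<in>{t1..T}. v t1 x \<ge>
      integral\<^sup>L (lebesgue_on {t1..t}) (\<lambda>s. - inner (f s) z + F s x' z) + v t x'"
      using vsup[OF _ x(1), of t1 z] t1 t0 by auto
    have "x' \<in> Tr"
      using x(2)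
    proof
      assume "x \<in> Tr"
      then show ?thesis unfolding Tr_def
        using trajectory_concat[OF _ _ t0(1) t1 _ x'(2)] pq by simp
    qed (use x'(2) in \<open>auto simp: Tr_def trajectories_def\<close>)
    then show ?thesis using x' by (auto simp: X_def)
  qed
  have uT: "u T x \<le> h x" and vT: "v T x \<ge> h x" if "x \<in> X" for x
    using u v that by (auto simp: minimax_subsolution_def minimax_supersolution_def X_def)

  \<comment> \<open>A priori bounds for the semisolutions\<close>
  obtain Bh where Bh: "\<And>x. x \<in> Tr \<Longrightarrow> \<bar>h x\<bar> \<le> Bh" using terminal_bounded[OF h T0 Trp cpt] by blast
  obtain BF where BF: "\<And>t x. t \<in> {0..T} \<Longrightarrow> x \<in> Tr \<Longrightarrow> \<bar>F t x 0\<bar> \<le> BF"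
    using hamiltonian_bounded[OF Fpm Trp cpt, of 0] by blast
  have BF0: "BF \<ge> 0"
  proof -
    obtain x where "x \<in> X" using stepu[of t0 x0] t0 x0 by blast
    then show ?thesis using BF[of 0 x] XTr T0 by force
  qed
  \<comment> \<open>With slope 0 the source drops out of the semisolution inequality up to time T,
    leaving an integral of F at slope 0 and the terminal datum.\<close>
  define B where "B = T * BF + Bh"
  have ub: "u t x \<le> B" if t: "t \<in> {t0..T}" and x: "x \<in> X" for t x
  proof (cases "t = T")
    case True
    have "h x \<le> Bh" using Bh[of x] x XTr by auto
    moreover have "0 \<le> T * BF" using T0 BF0 by simp
    ultimately show ?thesis using uT[OF x] unfolding True B_def by linarith
  next
    case False
    then have tT: "t0 \<le> t" "t < T" using t by auto
    have xT: "x \<in> \<Omega>" "x \<in> Tr \<or> (t = t0 \<and> x = x0)" using x by (auto simp: X_def)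
    obtain x' f where x': "x' \<in> X" "u t x \<le> integral\<^sup>L (lebesgue_on {t..T}) (\<lambda>s. - inner (f s) (0 :: 'h) + F s x' 0) + u T x'"
    proof -
      obtain x' f where "x' \<in> X" "\<forall>r\<in>{t..T}. u t x \<le> integral\<^sup>L (lebesgue_on {t..r}) (\<lambda>s. - inner (f s) (0 :: 'h) + F s x' 0) + u r x'"
        using stepu[OF tT xT, of 0] by blast
      then show thesis using tT by (intro that[of x' f]) auto
    qed
    have x'T: "x' \<in> Tr" using x'(1) XTr by blast
    have "integral\<^sup>L (lebesgue_on {t..T}) (\<lambda>s. F s x' 0) \<le> (T - t) * BF"
    proof (rule integral_le_bound)
      show "continuous_on {t..T} (\<lambda>s. F s x' 0)" using t t0 by (intro Fc x'T) auto
      show "F s x' 0 \<le> BF" if "s \<in> {t..T}" for s using BF[OF _ x'T, of s] that t t0 by auto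
    qed (use t in simp)
    also have "\<dots> \<le> T * BF" using t t0 BF0 by (intro mult_right_mono) auto
    finally have "integral\<^sup>L (lebesgue_on {t..T}) (\<lambda>s. F s x' 0) \<le> T * BF" .
    then show ?thesis using x'(2) uT[OF x'(1)] Bh[OF x'T] unfolding B_def by simp
  qed
  have vb: "v t x \<ge> - B" if t: "t \<in> {t0..T}" and x: "x \<in> X" for t x
  proof (cases "t = T")
    case True
    have "h x \<ge> - Bh" using Bh[of x] x XTr by auto
    moreover have "0 \<le> T * BF" using T0 BF0 by simp
    ultimately show ?thesis using vT[OF x] unfolding True B_def by linarith
  next
    case False
    then have tT: "t0 \<le> t" "t < T" using t by auto
    have xT: "x \<in> \<Omega>" "x \<in> Tr \<or> (t = t0 \<and> x = x0)" using x by (auto simp: X_def)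
    obtain x' f where x': "x' \<in> X" "v t x \<ge> integral\<^sup>L (lebesgue_on {t..T}) (\<lambda>s. - inner (f s) (0 :: 'h) + F s x' 0) + v T x'"
    proof -
      obtain x' f where "x' \<in> X" "\<forall>r\<in>{t..T}. v t x \<ge> integral\<^sup>L (lebesgue_on {t..r}) (\<lambda>s. - inner (f s) (0 :: 'h) + F s x' 0) + v r x'"
        using stepv[OF tT xT, of 0] by blast
      then show thesis using tT by (intro that[of x' f]) auto
    qed
    have x'T: "x' \<in> Tr" using x'(1) XTr by blast
    have "integral\<^sup>L (lebesgue_on {t..T}) (\<lambda>s. - F s x' 0) \<le> (T - t) * BF"
    proof (rule integral_le_bound)
      show "continuous_on {t..T} (\<lambda>s. - F s x' 0)" using t t0 by (intro continuous_on_minus Fc x'T) auto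
      show "- F s x' 0 \<le> BF" if "s \<in> {t..T}" for s using BF[OF _ x'T, of s] that t t0 by auto
    qed (use t in simp)
    also have "\<dots> \<le> T * BF" using t t0 BF0 by (intro mult_right_mono) auto
    finally have "- integral\<^sup>L (lebesgue_on {t..T}) (\<lambda>s. F s x' 0) \<le> T * BF" by simp
    then show ?thesis using x'(2) vT[OF x'(1)] Bh[OF x'T] unfolding B_def by simp
  qed

  \<comment> \<open>The penalised functional\<close>
  define \<gamma> where "\<gamma> = M0 / (2 * T)"
  \<comment> \<open>The drift consumes at most half of the violation \<open>M0\<close>, so the
    functional still reaches \<open>M0 / 2\<close>.\<close>
  have \<gamma>: "\<gamma> > 0" "\<gamma> * T = M0 / 2" using M0 T by (auto simp: \<gamma>_def)
  define J where "J x y t = integral {t0..t} (\<lambda>s. (norm (x s - y s))\<^sup>2)" for x y :: "real \<Rightarrow> 'h" and t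
  define \<psi> where "\<psi> \<epsilon> x y t = (norm (x t - y t))\<^sup>2 / (2 * \<epsilon>) + (1 / \<epsilon>) * J x y t" for \<epsilon> and x y :: "real \<Rightarrow> 'h" and t
  define \<Phi> where "\<Phi> \<epsilon> = (\<lambda>(t, x, y). u t x - v t y - \<psi> \<epsilon> x y t - \<gamma> * (T - t))" for \<epsilon>
  define P where "P = {t0..T} \<times> X \<times> X"
  have iN: "(\<lambda>s. (norm (x s - y s))\<^sup>2) integrable_on {c..c'}" if "x \<in> Tr" "y \<in> Tr" "0 \<le> c" "c' \<le> T" for x y c c'
  proof -
    have "continuous_on {0..T} x" "continuous_on {0..T} y" using that Trp by (auto simp: paths_def)
    then have "continuous_on {0..T} (\<lambda>s. (norm (x s - y s))\<^sup>2)" by (intro continuous_intros)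
    then show ?thesis using that by (intro integrable_continuous_interval) (auto intro: continuous_on_subset)
  qed
  have J0: "J x y t \<ge> 0" if "x \<in> Tr" "y \<in> Tr" "t \<le> T" for x y t
    unfolding J_def using that t0 by (intro integral_nonneg iN) auto
  have \<psi>0: "\<psi> \<epsilon> x y t \<ge> 0" if "\<epsilon> > 0" "x \<in> Tr" "y \<in> Tr" "t \<le> T" for \<epsilon> x y t
    unfolding \<psi>_def using J0[OF that(2-4)] that(1) by simp
  have step: "\<exists>x'\<in>X. \<exists>y'\<in>X. (\<forall>s\<in>{0..t1}. x' s = x s \<and> y' s = y s) \<and>
      (\<forall>t\<in>{t1..T}. \<forall>b. (\<forall>s\<in>{t1..t}. 2 * (C + L1) * norm ((1 / \<epsilon>) *\<^sub>R (x' s - y' s) - (1 / \<epsilon>) *\<^sub>R (x t1 - y t1))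
        + (F s x' ((1 / \<epsilon>) *\<^sub>R (x' s - y' s)) - F s y' ((1 / \<epsilon>) *\<^sub>R (x' s - y' s)))
        + (1 / \<epsilon>) * (norm (x' s - y' s))\<^sup>2 \<le> b) \<longrightarrow>
      \<Phi> \<epsilon> (t1, x, y) \<le> \<Phi> \<epsilon> (t, x', y') + (t - t1) * (b - \<gamma>))"
    if \<epsilon>: "\<epsilon> > 0" and t1: "t0 \<le> t1" "t1 < T" and xy: "x \<in> X" "y \<in> X" for \<epsilon> t1 x y
  proof -
    define z where "z = (1 / \<epsilon>) *\<^sub>R (x t1 - y t1)"
    have xy\<Omega>: "x \<in> \<Omega>" "y \<in> \<Omega>" "x \<in> Tr" "y \<in> Tr" using xy by (auto simp: X_def)
    obtain x' f where x': "x' \<in> X" "trajectory_with \<iota> A p q T L t1 x x' f" "\<And>t. t\<in>{t1..T} \<Longrightarrow> u t1 x \<le>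
      integral\<^sup>L (lebesgue_on {t1..t}) (\<lambda>s. - inner (f s) z + F s x' z) + u t x'"
      using stepu[OF t1 xy\<Omega>(1), of z] xy\<Omega>(3) by blast
    obtain y' g where y': "y' \<in> X" "trajectory_with \<iota> A p q T L t1 y y' g" "\<And>t. t\<in>{t1..T} \<Longrightarrow> v t1 y \<ge>
      integral\<^sup>L (lebesgue_on {t1..t}) (\<lambda>s. - inner (g s) z + F s y' z) + v t y'"
      using stepv[OF t1 xy\<Omega>(2), of z] xy\<Omega>(4) by blast
    have T': "x' \<in> Tr" "y' \<in> Tr" using x'(1) y'(1) XTr by auto
    have t1': "0 \<le> t1" using t0 t1 by simp
    obtain XX XX' where sx: "solves \<iota> A p q t1 T x' f XX XX'" using trajectory_solves[OF x'(2) t1'] pq by auto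
    obtain YY YY' where sy: "solves \<iota> A p q t1 T y' g YY YY'" using trajectory_solves[OF y'(2) t1'] pq by auto
    have fC: "AE t in lebesgue_on {t1<..<T}. norm (f t) \<le> C" "AE t in lebesgue_on {t1<..<T}. norm (g t) \<le> C"
      unfolding C_def using trajectory_source_bound[OF x'(2) t1' L RX[OF T'(1)]] trajectory_source_bound[OF y'(2) t1' L RX[OF T'(2)]] by auto
    have eq: "x' s = x s" "y' s = y s" if "s \<in> {0..t1}" for s
      using x'(2) y'(2) that unfolding trajectory_with_def by auto
    have "\<Phi> \<epsilon> (t1, x, y) \<le> \<Phi> \<epsilon> (t, x', y') + (t - t1) * (b - \<gamma>)"
      if t: "t \<in> {t1..T}" and b: "\<And>s. s \<in> {t1..t} \<Longrightarrow> 2 * (C + L1) * norm ((1 / \<epsilon>) *\<^sub>R (x' s - y' s) - z)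
        + (F s x' ((1 / \<epsilon>) *\<^sub>R (x' s - y' s)) - F s y' ((1 / \<epsilon>) *\<^sub>R (x' s - y' s)))
        + (1 / \<epsilon>) * (norm (x' s - y' s))\<^sup>2 \<le> b" for t b
    proof -
      have "u t1 x - v t1 y + (norm (x' t - y' t))\<^sup>2 / (2 * \<epsilon>) + (1 / \<epsilon>) * integral {t1..t} (\<lambda>s. (norm (x' s - y' s))\<^sup>2)
          \<le> u t x' - v t y' + (norm (x' t1 - y' t1))\<^sup>2 / (2 * \<epsilon>) + (t - t1) * b"
      proof (rule doubled_step_inequality[where F=F and z=z, OF pq A t1' sx fC(1) sy fC(2) _ _ \<epsilon> _ _ x'(3)[OF t] y'(3)[OF t]])
        show "continuous_on {t1..T} (\<lambda>s. F s x' z)" "continuous_on {t1..T} (\<lambda>s. F s y' z)"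
          using t1' by (auto intro!: Fc T')
        fix s assume s: "s \<in> {t1..t}"
        then have sT: "s \<in> {0..T}" using t t1' by auto
        let ?w = "(1 / \<epsilon>) *\<^sub>R (x' s - y' s)"
        have "F s x' z - F s y' z \<le> F s x' ?w - F s y' ?w + 2 * L1 * norm (?w - z)"
          using FL[OF sT T'(1), of ?w z] FL[OF sT T'(2), of ?w z] by linarith
        then show "2 * C * norm (?w - z) + (F s x' z - F s y' z) + (1 / \<epsilon>) * (norm (x' s - y' s))\<^sup>2 \<le> b"
          using b[OF s] by (simp add: algebra_simps)
      qed (use t in auto)
      moreover have "J x' y' t = J x y t1 + integral {t1..t} (\<lambda>s. (norm (x' s - y' s))\<^sup>2)"
      proof -
        have "J x' y' t = integral {t0..t1} (\<lambda>s. (norm (x' s - y' s))\<^sup>2) + integral {t1..t} (\<lambda>s. (norm (x' s - y' s))\<^sup>2)"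
          unfolding J_def using t t1 t0 by (intro Henstock_Kurzweil_Integration.integral_combine[symmetric] iN T') auto
        also have "integral {t0..t1} (\<lambda>s. (norm (x' s - y' s))\<^sup>2) = J x y t1"
          unfolding J_def using eq t0 by (intro integral_cong) auto
        finally show ?thesis .
      qed
      moreover have "x' t1 = x t1" "y' t1 = y t1" using eq[of t1] t1' by auto
      ultimately show ?thesis unfolding \<Phi>_def \<psi>_def by (simp add: algebra_simps add_divide_distrib)
    qed
    then show ?thesis using x'(1) y'(1) eq unfolding z_def by blast
  qed
  have bdd: "bdd_above (\<Phi> \<epsilon> ` P)" if \<epsilon>: "\<epsilon> > 0" for \<epsilon>
  proof (rule bdd_aboveI2[where M="2 * B"])
    fix a assume "a \<in> P"
    then obtain t x y where a: "a = (t, x, y)" "t \<in> {t0..T}" "x \<in> X" "y \<in> X" by (auto simp: P_def)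
    have "\<psi> \<epsilon> x y t \<ge> 0" using a XTr by (intro \<psi>0 \<epsilon>) auto
    moreover have "\<gamma> * (T - t) \<ge> 0" using \<gamma> a by simp
    ultimately show "\<Phi> \<epsilon> a \<le> 2 * B" using ub[OF a(2,3)] vb[OF a(2,4)] unfolding a(1) \<Phi>_def by simp
  qed
  have x0': "x0 \<in> Tr \<or> (t0 = t0 \<and> x0 = x0)" by simp
  \<comment> \<open>At the initial time the integral in the semisolution inequality extends over a
    single point. This replaces \<open>x0\<close> by genuine competitors with no loss in
    value.\<close>
  obtain xs ys where start: "xs \<in> X" "ys \<in> X" "u t0 x0 \<le> u t0 xs" "v t0 ys \<le> v t0 x0"
  proof -
    obtain x' f where x': "x' \<in> X" "\<forall>t\<in>{t0..T}. u t0 x0 \<le> integral\<^sup>L (lebesgue_on {t0..t}) (\<lambda>s. - inner (f s) (0 :: 'h) + F s x' 0) + u t x'"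
      using stepu[OF order_refl t0(2) x0 x0', of 0] by blast
    obtain y' g where y': "y' \<in> X" "\<forall>t\<in>{t0..T}. v t0 x0 \<ge> integral\<^sup>L (lebesgue_on {t0..t}) (\<lambda>s. - inner (g s) (0 :: 'h) + F s y' 0) + v t y'"
      using stepv[OF order_refl t0(2) x0 x0', of 0] by blast
    have z: "integral\<^sup>L (lebesgue_on {t0..t0}) k = 0" if "integrable (lebesgue_on {t0..t0}) k" for k :: "real \<Rightarrow> real"
      using lebesgue_integral_eq_integral[OF that] by simp
    have "integrable (lebesgue_on {t0..t0}) (\<lambda>s. F s x 0)" if "x \<in> X" for x
      using that XTr t0 by (intro continuous_imp_integrable_real Fc) auto
    then have zx: "integral\<^sup>L (lebesgue_on {t0}) (\<lambda>s. F s x 0) = 0" if "x \<in> X" for x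
      using z[of "\<lambda>s. F s x 0"] that by simp
    have "u t0 x0 \<le> u t0 x'" "v t0 y' \<le> v t0 x0"
      using bspec[OF x'(2), of t0] bspec[OF y'(2), of t0] t0 zx[OF x'(1)] zx[OF y'(1)] by simp_all
    then show ?thesis using that x'(1) y'(1) by blast
  qed
  have startP: "(t0, xs, ys) \<in> P" using start t0 by (simp add: P_def)
  have start\<Phi>: "\<Phi> \<epsilon> (t0, xs, ys) \<ge> M0 / 2" for \<epsilon>
  proof -
    have "xs t0 = ys t0" using init[OF subsetD[OF XTr start(1)], of t0] init[OF subsetD[OF XTr start(2)], of t0] t0 by simp
    then have "\<psi> \<epsilon> xs ys t0 = 0" by (simp add: \<psi>_def J_def)
    moreover have "\<gamma> * (T - t0) \<le> M0 / 2" unfolding \<gamma>(2)[symmetric] using \<gamma> t0 by (intro mult_left_mono) auto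
    ultimately show ?thesis using start(3,4) unfolding \<Phi>_def M0_def by simp
  qed

  \<comment> \<open>An approximate maximiser with small penalty\<close>
  define S where "S k = Sup (\<Phi> ((1 / 2) ^ k) ` P)" for k :: nat
  have Sge: "\<Phi> ((1 / 2) ^ k) a \<le> S k" if "a \<in> P" for k a
    unfolding S_def using that by (intro cSUP_upper bdd) auto
  have Slow: "S k \<ge> M0 / 2" for k using Sge[OF startP, of k] start\<Phi>[of "(1 / 2) ^ k"] by linarith
  have Snear: "\<exists>a\<in>P. \<Phi> ((1 / 2) ^ k) a > S k - \<eta>" if "\<eta> > 0" for k \<eta>
  proof -
    have "S k - \<eta> < Sup (\<Phi> ((1 / 2) ^ k) ` P)" using that by (simp add: S_def)
    moreover have "\<Phi> ((1 / 2) ^ k) ` P \<noteq> {}" using startP by auto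
    ultimately obtain c where c: "c \<in> \<Phi> ((1 / 2) ^ k) ` P" "S k - \<eta> < c"
      using less_cSupD[of "\<Phi> ((1 / 2) ^ k) ` P" "S k - \<eta>"] by blast
    from c(1) obtain a where a: "c = \<Phi> ((1 / 2) ^ k) a" "a \<in> P" by (rule imageE)
    show ?thesis using c(2) unfolding a(1) by (rule bexI) (rule a(2))
  qed
  have mlim: "(m \<longlongrightarrow> 0) (at_right 0)" using m(1) by (simp add: modulus_of_continuity_def)
  have "\<forall>\<^sub>F r in at_right 0. m r < \<gamma> / 4" by (rule order_tendstoD(2)[OF mlim]) (use \<gamma>(1) in simp)
  then obtain r0 where r0: "r0 > 0" "\<And>r. 0 < r \<Longrightarrow> r < r0 \<Longrightarrow> m r < \<gamma> / 4"
    unfolding eventually_at_right_field by blast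
  have M04: "M0 / 4 > 0" using M0 by simp
  obtain eh where eh: "eh > 0" "\<And>x y. x \<in> Tr \<Longrightarrow> y \<in> Tr \<Longrightarrow> (\<And>t. t \<in> {0..T} \<Longrightarrow> norm (x t - y t) < eh) \<Longrightarrow> \<bar>h x - h y\<bar> < M0 / 4"
    using terminal_uniform[OF h T0 Trp cpt M04] by blast
  \<comment> \<open>The tolerance for the distance of two paths over their past. Twice this value
    has to be admissible both for the modulus of F and for the terminal datum, because one step may
    enlarge the distance.\<close>
  define e where "e = min (min (r0 / 4) (eh / 4)) (\<gamma> / 4)"
  have e: "e > 0" "2 * e < r0" "2 * e < eh" "e \<le> \<gamma> / 4"
    using r0(1) eh(1) \<gamma>(1) by (auto simp: e_def min_def)
  have me: "m (2 * e) < \<gamma> / 4" using e by (intro r0(2)) auto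
  have "\<exists>\<sigma>>0. \<forall>x\<in>Tr. \<forall>y\<in>Tr. \<forall>t\<in>{t0..T}. J x y t \<le> \<sigma> \<longrightarrow> (\<forall>r\<in>{0..t}. norm (x r - y r) \<le> e)"
    unfolding J_def
  proof (rule sup_small_of_integral_small[OF t0(1) Trp equi _ e(1)])
    show "x t = y t" if "x \<in> Tr" "y \<in> Tr" "t \<in> {0..t0}" for x y t
      using init[OF that(1,3)] init[OF that(2,3)] by simp
  qed
  then obtain \<sigma>1 where \<sigma>1: "\<sigma>1 > 0" "\<forall>x\<in>Tr. \<forall>y\<in>Tr. \<forall>t\<in>{t0..T}. J x y t \<le> \<sigma>1 \<longrightarrow> (\<forall>r\<in>{0..t}. norm (x r - y r) \<le> e)"
    by (elim exE conjE)
  \<comment> \<open>The penalty level to be reached: \<sigma>1 turns it into closeness of the past,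
    and \<open>e / 16\<close> makes the contribution \<open>4 * \<sigma>\<close> to the quadratic
    term at most \<open>e / 4\<close>.\<close>
  define \<sigma> where "\<sigma> = min \<sigma>1 (e / 16)"
  have \<sigma>: "\<sigma> > 0" "\<sigma> \<le> \<sigma>1" "\<sigma> \<le> e / 16" using \<sigma>1(1) e(1) by (simp_all add: \<sigma>_def min_le_iff_disj)
  text \<open>The suprema decrease in \<open>k\<close> and are bounded below, so two consecutive ones nearly agree. At an
    approximate maximiser for the smaller parameter, half of the penalty is a lower bound for their
    difference, so the penalty is small there.\<close>
  have "\<exists>k. S k - S (Suc k) < \<sigma> / 4"
  proof (rule ccontr)
    assume "\<not> ?thesis"
    then have nd: "\<forall>k. \<not> S k - S (Suc k) < \<sigma> / 4" by (rule not_ex[THEN iffD1])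
    have dec: "S (Suc k) \<le> S k - \<sigma> / 4" for k using spec[OF nd, of k] by linarith
    have "S k \<le> S 0 - real k * (\<sigma> / 4)" for k
    proof (induction k)
      case (Suc k)
      have "real (Suc k) * (\<sigma> / 4) = real k * (\<sigma> / 4) + \<sigma> / 4" by (simp add: field_simps)
      then show ?case using dec[of k] Suc.IH by linarith
    qed simp
    note dec' = this
    obtain k where "real k > (S 0 - M0 / 2) / (\<sigma> / 4)" using reals_Archimedean2 by blast
    then have "real k * (\<sigma> / 4) > S 0 - M0 / 2" using \<sigma>(1) by (subst (asm) pos_divide_less_eq) simp_all
    then show False using Slow[of k] dec'[of k] by linarith
  qed
  then obtain k where k: "S k - S (Suc k) < \<sigma> / 4" by blast
  define \<epsilon> where "\<epsilon> = (1 / 2 :: real) ^ Suc k"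
  have \<epsilon>: "\<epsilon> > 0" "\<epsilon> \<le> 1" "2 * \<epsilon> = (1 / 2) ^ k"
  proof -
    show "\<epsilon> > 0" unfolding \<epsilon>_def by simp
    show "2 * \<epsilon> = (1 / 2) ^ k" unfolding \<epsilon>_def power_Suc by simp
    show "\<epsilon> \<le> 1" unfolding \<epsilon>_def by (rule power_le_one) auto
  qed
  have K: "C + L1 + 1 > 0" using C L1 by simp
  \<comment> \<open>The oscillation allowed to a trajectory during one step, chosen after
    \<epsilon>. The bound \<open>e / 4\<close> keeps the past within
    \<open>e + 2 * \<omega>\<close>, \<open>e * \<epsilon> / 32\<close> controls the quadratic term,
    and the last bound controls the deviation of the slope from its frozen value.\<close>
  define \<omega> where "\<omega> = min (min 1 (e / 4)) (min (e * \<epsilon> / 32) (\<gamma> * \<epsilon> / (32 * (C + L1 + 1))))"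
  have \<omega>: "\<omega> > 0" "\<omega> \<le> 1" "\<omega> \<le> e / 4" "\<omega> \<le> e * \<epsilon> / 32" "\<omega> \<le> \<gamma> * \<epsilon> / (32 * (C + L1 + 1))"
  proof -
    have "\<gamma> * \<epsilon> / (32 * (C + L1 + 1)) > 0" using \<epsilon>(1) \<gamma>(1) K by (intro divide_pos_pos mult_pos_pos) auto
    moreover have "e * \<epsilon> / 32 > 0" using e(1) \<epsilon>(1) by simp
    ultimately show "\<omega> > 0" using e(1) unfolding \<omega>_def by (simp only: min_less_iff_conj) simp
  qed (simp_all only: \<omega>_def min_le_iff_disj order_refl simp_thms)
  have \<omega>2: "8 * \<omega>\<^sup>2 / \<epsilon> \<le> e / 4"
  proof -
    have "\<omega>\<^sup>2 \<le> \<omega> * 1" unfolding power2_eq_square using \<omega> by (intro mult_left_mono) auto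
    then have "8 * \<omega>\<^sup>2 \<le> 8 * (e * \<epsilon> / 32)" using \<omega>(4) by linarith
    also have "\<dots> = e / 4 * \<epsilon>" by simp
    finally have "8 * \<omega>\<^sup>2 \<le> e / 4 * \<epsilon>" .
    then show ?thesis using \<epsilon>(1) by (simp add: pos_divide_le_eq)
  qed
  have \<omega>3: "2 * (C + L1) * (2 * \<omega> / \<epsilon>) \<le> \<gamma> / 8"
  proof -
    have "(C + L1) * \<omega> \<le> (C + L1 + 1) * (\<gamma> * \<epsilon> / (32 * (C + L1 + 1)))"
      by (intro mult_mono \<omega>(5)) (use C L1 \<omega>(1) in auto)
    also have "\<dots> = \<gamma> * \<epsilon> / 32"
    proof -
      have "z * (c / (32 * z)) = c / 32" if "z > 0" for z c :: real using that by simp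
      from this[OF K] show ?thesis .
    qed
    finally have "(C + L1) * \<omega> \<le> \<gamma> * \<epsilon> / 32" .
    moreover have "2 * (C + L1) * (2 * \<omega>) = 4 * ((C + L1) * \<omega>)" by simp
    moreover have "4 * (\<gamma> * \<epsilon> / 32) = \<gamma> / 8 * \<epsilon>" by simp
    ultimately have "2 * (C + L1) * (2 * \<omega>) \<le> \<gamma> / 8 * \<epsilon>" by linarith
    then have "2 * (C + L1) * (2 * \<omega>) / \<epsilon> \<le> \<gamma> / 8" using \<epsilon>(1) by (simp only: pos_divide_le_eq)
    then show ?thesis by (simp only: times_divide_eq_right)
  qed
  obtain \<delta> where \<delta>: "\<delta> > 0" "\<And>x s t. x \<in> Tr \<Longrightarrow> s \<in> {0..T} \<Longrightarrow> t \<in> {0..T} \<Longrightarrow> \<bar>s - t\<bar> < \<delta> \<Longrightarrow> norm (x s - x t) < \<omega>"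
    using equi[OF _ \<omega>(1)] by blast
  \<comment> \<open>The error of the approximate maximiser: \<open>\<sigma> / 4\<close> for the
    penalty estimate, \<open>\<delta> * \<gamma> / 8\<close> to stay below the gain
    \<open>\<delta> * \<gamma> / 4\<close> of a full step, and \<open>M0 / 8\<close> to keep the
    functional above \<open>M0 / 4\<close>.\<close>
  define \<eta> where "\<eta> = min (\<sigma> / 4) (min (\<delta> * \<gamma> / 8) (M0 / 8))"
  have \<eta>: "\<eta> > 0" "\<eta> \<le> \<sigma> / 4" "\<eta> \<le> \<delta> * \<gamma> / 8" "\<eta> \<le> M0 / 8"
    using \<sigma>(1) \<delta>(1) \<gamma>(1) M0 by (simp_all add: \<eta>_def min_le_iff_disj)
  obtain a where a: "a \<in> P" "\<Phi> \<epsilon> a > S (Suc k) - \<eta>" using Snear[OF \<eta>(1), of "Suc k"] unfolding \<epsilon>_def by blast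
  obtain t1 x y where txy: "a = (t1, x, y)" "t1 \<in> {t0..T}" "x \<in> X" "y \<in> X" using a(1) by (auto simp: P_def)
  have xyT: "x \<in> Tr" "y \<in> Tr" using txy XTr by auto
  have \<psi>small: "\<psi> \<epsilon> x y t1 \<le> \<sigma>"
  proof -
    have half: "\<psi> (2 * \<epsilon>) x y t1 = \<psi> \<epsilon> x y t1 / 2"
      unfolding \<psi>_def using \<epsilon>(1) by (simp add: field_simps)
    have "\<Phi> (2 * \<epsilon>) a \<le> S k" unfolding \<epsilon>(3) by (rule Sge[OF a(1)])
    moreover have "\<Phi> (2 * \<epsilon>) a = \<Phi> \<epsilon> a + \<psi> \<epsilon> x y t1 / 2"
      unfolding txy(1) \<Phi>_def by (simp add: half)
    ultimately show ?thesis using a(2) k \<eta>(2) by linarith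
  qed
  have N1: "(norm (x t1 - y t1))\<^sup>2 \<le> 2 * \<sigma> * \<epsilon>" and J1: "J x y t1 \<le> \<sigma>1"
  proof -
    have nn: "0 \<le> (norm (x t1 - y t1))\<^sup>2 / (2 * \<epsilon>)" "0 \<le> (1 / \<epsilon>) * J x y t1"
      using \<epsilon>(1) J0[OF xyT, of t1] txy(2) by auto
    then have "(norm (x t1 - y t1))\<^sup>2 / (2 * \<epsilon>) \<le> \<sigma>" "(1 / \<epsilon>) * J x y t1 \<le> \<sigma>"
      using \<psi>small unfolding \<psi>_def by linarith+
    then show "(norm (x t1 - y t1))\<^sup>2 \<le> 2 * \<sigma> * \<epsilon>"
      using \<epsilon>(1) by (simp add: pos_divide_le_eq algebra_simps)
    have "J x y t1 \<le> \<sigma> * \<epsilon>" using \<open>(1 / \<epsilon>) * J x y t1 \<le> \<sigma>\<close> \<epsilon>(1) by (simp add: pos_divide_le_eq)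
    also have "\<dots> \<le> \<sigma> * 1" using \<epsilon> \<sigma> by (intro mult_left_mono) auto
    finally show "J x y t1 \<le> \<sigma>1" using \<sigma>(2) by simp
  qed
  have close: "norm (x r - y r) \<le> e" if "r \<in> {0..t1}" for r
    by (rule \<sigma>1(2)[rule_format, OF xyT txy(2) J1 that])
  \<comment> \<open>At the terminal time the semisolutions are separated by \<open>h\<close>, and
    \<open>h\<close> differs little on paths that are uniformly close.\<close>
  have \<Phi>T: "\<Phi> \<epsilon> (T, x', y') < M0 / 4"
    if x'y': "x' \<in> X" "y' \<in> X" and cl: "\<And>r. r \<in> {0..T} \<Longrightarrow> norm (x' r - y' r) \<le> 2 * e" for x' y'
  proof -
    have TT: "x' \<in> Tr" "y' \<in> Tr" using x'y' XTr by auto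
    have "\<bar>h x' - h y'\<bar> < M0 / 4"
    proof (rule eh(2)[OF TT])
      show "norm (x' r - y' r) < eh" if "r \<in> {0..T}" for r using cl[OF that] e(3) by linarith
    qed
    moreover have "\<psi> \<epsilon> x' y' T \<ge> 0" by (rule \<psi>0[OF \<epsilon>(1) TT order_refl])
    moreover have "\<Phi> \<epsilon> (T, x', y') = u T x' - v T y' - \<psi> \<epsilon> x' y' T" by (simp add: \<Phi>_def)
    ultimately show ?thesis using uT[OF x'y'(1)] vT[OF x'y'(2)] by linarith
  qed
  have \<Phi>1: "\<Phi> \<epsilon> (t1, x, y) > M0 / 4" using a(2) Slow[of "Suc k"] \<eta>(4) M0 unfolding txy(1) by linarith

  \<comment> \<open>Contradiction by one further step\<close>
  show False
  proof (cases "t1 = T")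
    case True
    have "norm (x r - y r) \<le> 2 * e" if "r \<in> {0..T}" for r
      using close[of r] that e(1) unfolding True by simp
    then show False using \<Phi>T[OF txy(3,4)] \<Phi>1 unfolding True by simp
  next
    case False
    then have t1: "t0 \<le> t1" "t1 < T" using txy(2) by auto
    obtain x' y' where x'y': "x' \<in> X" "y' \<in> X" "\<And>s. s \<in> {0..t1} \<Longrightarrow> x' s = x s" "\<And>s. s \<in> {0..t1} \<Longrightarrow> y' s = y s"
      and stp: "\<And>t b. t \<in> {t1..T} \<Longrightarrow> (\<And>s. s\<in>{t1..t} \<Longrightarrow> 2 * (C + L1) * norm ((1 / \<epsilon>) *\<^sub>R (x' s - y' s) - (1 / \<epsilon>) *\<^sub>R (x t1 - y t1))
        + (F s x' ((1 / \<epsilon>) *\<^sub>R (x' s - y' s)) - F s y' ((1 / \<epsilon>) *\<^sub>R (x' s - y' s)))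
        + (1 / \<epsilon>) * (norm (x' s - y' s))\<^sup>2 \<le> b) \<Longrightarrow>
      \<Phi> \<epsilon> (t1, x, y) \<le> \<Phi> \<epsilon> (t, x', y') + (t - t1) * (b - \<gamma>)"
      using step[OF \<epsilon>(1) t1 txy(3,4)] by blast
    have TT: "x' \<in> Tr" "y' \<in> Tr" using x'y' XTr by auto
    define w where "w s = x' s - y' s" for s
    have w1: "w t1 = x t1 - y t1" using x'y'(3,4)[of t1] t0 t1 by (simp add: w_def)
    have wnear: "norm (w s - w t1) \<le> 2 * \<omega>" if "s \<in> {t1..T}" "s < t1 + \<delta>" for s
    proof -
      have sT: "s \<in> {0..T}" "t1 \<in> {0..T}" "\<bar>s - t1\<bar> < \<delta>" using that t0 t1 by auto
      have "norm (w s - w t1) \<le> norm (x' s - x' t1) + norm (y' s - y' t1)"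
        using norm_triangle_ineq4[of "x' s - x' t1" "y' s - y' t1"] by (simp add: w_def algebra_simps)
      then show ?thesis using \<delta>(2)[OF TT(1) sT] \<delta>(2)[OF TT(2) sT] by linarith
    qed
    have wsup: "norm (w r) \<le> e + 2 * \<omega>" if "r \<in> {0..T}" "r < t1 + \<delta>" for r
    proof (cases "r \<le> t1")
      case True
      then show ?thesis using close[of r] x'y'(3,4)[of r] that \<omega>(1) by (simp add: w_def)
    next
      case False
      have "norm (w r) \<le> norm (w t1) + norm (w r - w t1)" using norm_triangle_ineq[of "w t1" "w r - w t1"] by simp
      moreover have "norm (w t1) \<le> e" unfolding w1 using t0 t1 by (intro close) auto
      ultimately show ?thesis using wnear[of r] False that by auto
    qed
    \<comment> \<open>The budget: \<gamma> / 8 for the change of slope, less than \<gamma> / 4 for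
      the modulus of F at \<open>2 * e\<close>, and \<open>e / 2\<close>, hence at most \<gamma> /
      8, for the growth of the integral penalty. Half of the drift is left as a gain.\<close>
    have bound: "2 * (C + L1) * norm ((1 / \<epsilon>) *\<^sub>R (x' s - y' s) - (1 / \<epsilon>) *\<^sub>R (x t1 - y t1))
        + (F s x' ((1 / \<epsilon>) *\<^sub>R (x' s - y' s)) - F s y' ((1 / \<epsilon>) *\<^sub>R (x' s - y' s)))
        + (1 / \<epsilon>) * (norm (x' s - y' s))\<^sup>2 \<le> \<gamma> / 2" if s: "s \<in> {t1..T}" "s < t1 + \<delta>" for s
    proof -
      have "(1 / \<epsilon>) *\<^sub>R (x' s - y' s) - (1 / \<epsilon>) *\<^sub>R (x t1 - y t1) = (1 / \<epsilon>) *\<^sub>R (w s - w t1)"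
        unfolding w1 by (simp add: w_def scaleR_diff_right)
      then have "norm ((1 / \<epsilon>) *\<^sub>R (x' s - y' s) - (1 / \<epsilon>) *\<^sub>R (x t1 - y t1)) = norm (w s - w t1) / \<epsilon>"
        using \<epsilon>(1) by simp
      also have "\<dots> \<le> 2 * \<omega> / \<epsilon>" using wnear[OF s] \<epsilon>(1) by (intro divide_right_mono) auto
      finally have "2 * (C + L1) * norm ((1 / \<epsilon>) *\<^sub>R (x' s - y' s) - (1 / \<epsilon>) *\<^sub>R (x t1 - y t1)) \<le> 2 * (C + L1) * (2 * \<omega> / \<epsilon>)"
        using C L1 by (intro mult_left_mono) auto
      then have b1: "2 * (C + L1) * norm ((1 / \<epsilon>) *\<^sub>R (x' s - y' s) - (1 / \<epsilon>) *\<^sub>R (x t1 - y t1)) \<le> \<gamma> / 8"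
        using \<omega>3 by linarith
      have "norm (w s) \<le> norm (w t1) + 2 * \<omega>"
        using norm_triangle_ineq[of "w t1" "w s - w t1"] wnear[OF s] by simp
      then have "(norm (w s))\<^sup>2 \<le> (norm (w t1) + 2 * \<omega>)\<^sup>2" by (intro power_mono) auto
      also have "\<dots> \<le> 2 * (norm (w t1))\<^sup>2 + 8 * \<omega>\<^sup>2"
        using sum_squares_bound[of "norm (w t1)" "2 * \<omega>"] by (simp add: power2_sum power_mult_distrib)
      finally have "(1 / \<epsilon>) * (norm (w s))\<^sup>2 \<le> (1 / \<epsilon>) * (2 * (2 * \<sigma> * \<epsilon>) + 8 * \<omega>\<^sup>2)"
        using N1 \<epsilon>(1) unfolding w1 by (intro mult_left_mono) auto
      also have "\<dots> = 4 * \<sigma> + 8 * \<omega>\<^sup>2 / \<epsilon>" using \<epsilon>(1) by (simp add: field_simps)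
      finally have b2: "(1 / \<epsilon>) * (norm (w s))\<^sup>2 \<le> e / 2" using \<sigma>(3) \<omega>2 by linarith
      have b3: "F s x' ((1 / \<epsilon>) *\<^sub>R (x' s - y' s)) - F s y' ((1 / \<epsilon>) *\<^sub>R (x' s - y' s)) \<le> m (2 * e)"
      proof (rule Fm[OF \<epsilon>(1) _ TT])
        show "s \<in> {t0..T}" using s t1 by auto
        show "norm (x' r - y' r) \<le> e + 2 * \<omega>" if "r \<in> {0..s}" for r
          using wsup[of r] that s by (simp add: w_def)
        show "(1 / \<epsilon>) * (norm (x' s - y' s))\<^sup>2 + (e + 2 * \<omega>) \<le> 2 * e"
          using b2 \<omega>(3) unfolding w_def by linarith
      qed
      show ?thesis using b1 b2 b3 me e(4) unfolding w_def by linarith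
    qed
    \<comment> \<open>If a step of length \<open>\<delta> / 2\<close> fits before T, it increases
      the functional by \<open>\<delta> * \<gamma> / 4\<close> and beyond its supremum. Otherwise
      the step is taken up to T, where the functional is known to be below
      \<open>M0 / 4\<close>.\<close>
    show False
    proof (cases "t1 + \<delta> / 2 \<le> T")
      case True
      define t where "t = t1 + \<delta> / 2"
      have t: "t \<in> {t1..T}" using True \<delta>(1) by (simp add: t_def)
      have "\<Phi> \<epsilon> (t1, x, y) \<le> \<Phi> \<epsilon> (t, x', y') + (t - t1) * (\<gamma> / 2 - \<gamma>)"
        using t \<delta>(1) by (intro stp[OF t] bound) (auto simp: t_def)
      also have "(t - t1) * (\<gamma> / 2 - \<gamma>) = - (\<delta> * \<gamma> / 4)" by (simp add: t_def)
      finally have "\<Phi> \<epsilon> (t1, x, y) \<le> \<Phi> \<epsilon> (t, x', y') - \<delta> * \<gamma> / 4" by simp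
      moreover have "\<Phi> \<epsilon> (t, x', y') \<le> S (Suc k)"
        unfolding \<epsilon>_def using t t1 x'y' by (intro Sge) (auto simp: P_def)
      moreover have "\<delta> * \<gamma> > 0" using \<delta> \<gamma> by simp
      ultimately show False using a(2) \<eta>(3) unfolding txy(1) by linarith
    next
      case False
      have "\<Phi> \<epsilon> (t1, x, y) \<le> \<Phi> \<epsilon> (T, x', y') + (T - t1) * (\<gamma> / 2 - \<gamma>)"
        using t1 False \<delta>(1) by (intro stp bound) auto
      also have "(T - t1) * (\<gamma> / 2 - \<gamma>) \<le> 0" using t1 \<gamma> by (intro mult_nonneg_nonpos) auto
      finally have "\<Phi> \<epsilon> (t1, x, y) \<le> \<Phi> \<epsilon> (T, x', y')" by simp
      moreover have "norm (x' r - y' r) \<le> 2 * e" if "r \<in> {0..T}" for r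
        using wsup[of r] that False \<delta>(1) \<omega>(3) e(1) by (simp add: w_def)
      ultimately show False using \<Phi>T[OF x'y'(1,2)] \<Phi>1 by simp
    qed
  qed
qed

theorem theorem4p4:
  fixes \<iota> :: "'v::{banach, second_countable_topology} \<Rightarrow>\<^sub>L 'h::{real_inner, banach, second_countable_topology}"
    and A :: "real \<Rightarrow> 'v \<Rightarrow> ('v \<Rightarrow>\<^sub>L real)"
    and F :: "real \<Rightarrow> (real \<Rightarrow> 'h) \<Rightarrow> 'h \<Rightarrow> real"
    and h :: "(real \<Rightarrow> 'h) \<Rightarrow> real"
    and p q T L :: real
    and xstar :: 'h
    and \<Omega> :: "(real \<Rightarrow> 'h) set"
    and u v :: "real \<Rightarrow> (real \<Rightarrow> 'h) \<Rightarrow> real"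
  assumes "T > 0"
    and "p \<ge> 2" and "q > 1" and "1 / p + 1 / q = 1"
    and "reflexive_space TYPE('v)"
    and "compact_dense_embedding \<iota>"
    and "admissible_operator T p q A"
    and "pm_continuous (sup_dist T) (paths T) h"
    and "admissible_hamiltonian \<iota> A p q T F"
    and "L \<ge> 0"
    and "trajectories \<iota> A p q T L 0 (const_path T xstar) \<subseteq> \<Omega>"
    and "\<Omega> \<subseteq> paths T"
    and "minimax_subsolution \<iota> A p q T F h L \<Omega> u"
    and "minimax_supersolution \<iota> A p q T F h L \<Omega> v"
  shows "\<forall>t\<in>{0..T}. \<forall>x\<in>\<Omega>. u t x \<le> v t x"
proof (intro ballI)
  fix t x assume t: "t \<in> {0..T}" and x: "x \<in> \<Omega>"
  show "u t x \<le> v t x"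
  proof (cases "t = T")
    case True
    have "u T x \<le> h x" using assms(13) x by (simp add: minimax_subsolution_def)
    moreover have "h x \<le> v T x" using assms(14) x by (simp add: minimax_supersolution_def)
    ultimately show ?thesis unfolding True by linarith
  next
    case False
    then show ?thesis
      using t x by (intro minimax_comparison[OF assms(1-4,6-10,12-14)]) auto
  qed
qed

end
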